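(* Let $(M,\tau)$ be a von Neumann algebra with a faithful normal trace state. Suppose that $1\in B\subset M$ is a W$^*$-subalgebra, $X=X^*\in M$, and $p\in M$ is a nonzero projection such that $p$ is $B$-free with $X$, $p$ commutes with $B$, and $X$ is algebraically free from $B[p]$. Let $\alpha=\tau(p)$ and put $X_p=\alpha^{-1}pXp$. Define $\psi:pMp\to M$ by $\psi(pmp)=\alpha^{-1}pmp$ and $\Psi:pMp\to M$ by $\Psi=E^{(M)}_{B\langle X\rangle}\circ\psi$. Then $$(\Psi\otimes\Psi)\circ\partial_{X_p:Bp}=\partial_{X:B}\circ\Psi|_{Bp\langle X_p\rangle}.$$
   Context: $B[p]$, $B\langle X\rangle$ denote the subalgebras of $M$ generated (algebraically) by $B$ and $p$, respectively by $B$ and $X$; $Bp\langle X_p\rangle$ is the subalgebra of $pMp$ (unit $p$) generated by $Bp$ and $X_p$. For a $*$-subalgebra $1\in A\subset M$, $E^{(M)}_A$ is the unique $\tau$-preserving conditional expectation of $M$ onto $W^*(A)$. "$p$ is $B$-free with $X$" means that the algebras generated by $B\cup\{p\}$ and by $B\cup\{X\}$ are free with amalgamation over $B$ in $(M,E^{(M)}_B)$. An element $X$ of a unital algebra is algebraically free from a unital subalgebra $C$ if the canonical homomorphism from the algebra $C\langle t\rangle$ of noncommutative polynomials with coefficients in $C$ (the free product of $C$ and $\mathbb C[t]$), which is the identity on $C$ and sends $t\mapsto X$, is injective. In that case the free difference quotient $\partial_{X:C}:C\langle X\rangle\to C\langle X\rangle\otimes C\langle X\rangle$ (algebraic tensor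 product) is the unique derivation with $\partial_{X:C}(c)=0$ for $c\in C$ and $\partial_{X:C}(X)=1\otimes1$; for $\partial_{X_p:Bp}$ the unit is $p$, so $\partial_{X_p:Bp}(X_p)=p\otimes p$. The asserted identity is an equality of maps on $Bp\langle X_p\rangle$ and includes the assertion that its right-hand side is defined, i.e. that $\Psi$ sends $Bp\langle X_p\rangle$ into $B\langle X\rangle$. *)

theory Defs
  imports "HOL-Analysis.Analysis" "HOL-Library.Poly_Mapping"
begin

section \<open>Complex Hilbert spaces and bounded operators\<close>

class complex_vector = ab_group_add +
  fixes scaleC :: "complex \<Rightarrow> 'a \<Rightarrow> 'a"  (infixr "*\<^sub>C" 75)
  assumes scaleC_add_right: "c *\<^sub>C (x + y) = c *\<^sub>C x + c *\<^sub>C y"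
    and scaleC_add_left: "(c + d) *\<^sub>C x = c *\<^sub>C x + d *\<^sub>C x"
    and scaleC_scaleC: "c *\<^sub>C (d *\<^sub>C x) = (c * d) *\<^sub>C x"
    and scaleC_one: "1 *\<^sub>C x = x"

text \<open>The norm and the topology are those of the underlying real inner product
  space. The complex inner product is linear in its first argument.\<close>

class chilbert_space = complex_vector + real_inner + complete_space +
  fixes cinner :: "'a \<Rightarrow> 'a \<Rightarrow> complex"
  assumes scaleR_scaleC: "r *\<^sub>R x = complex_of_real r *\<^sub>C x"
    and cinner_add_left: "cinner (x + y) z = cinner x z + cinner y z"
    and cinner_scaleC_left: "cinner (c *\<^sub>C x) y = c * cinner x y"
    and cinner_commute: "cinner x y = cnj (cinner y x)"
    and inner_eq_Re_cinner: "inner x y = Re (cinner x y)"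

lemma scaleC_zero_right [simp]: "c *\<^sub>C (0::'a::complex_vector) = 0"
  using scaleC_add_right[of c 0 "0::'a"] by simp

lemma scaleC_minus_right: "c *\<^sub>C (- x) = - (c *\<^sub>C (x::'a::complex_vector))"
  using scaleC_add_right[of c x "- x"] by (simp add: eq_neg_iff_add_eq_0 add.commute)

lemma scaleC_diff_right: "c *\<^sub>C (x - y) = c *\<^sub>C x - c *\<^sub>C (y::'a::complex_vector)"
  using scaleC_add_right[of c x "- y"] by (simp add: scaleC_minus_right)

lemma bounded_linear_scaleC:
  "bounded_linear (\<lambda>x::'a::chilbert_space. c *\<^sub>C x)"
proof (rule bounded_linear_intro[where K = "cmod c"])
  show "c *\<^sub>C (x + y) = c *\<^sub>C x + c *\<^sub>C y" for x y :: 'a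
    by (rule scaleC_add_right)
  show "c *\<^sub>C (r *\<^sub>R x) = r *\<^sub>R (c *\<^sub>C x)" for r and x :: 'a
    by (simp add: scaleR_scaleC scaleC_scaleC mult.commute)
  show "norm (c *\<^sub>C x) \<le> norm x * cmod c" for x :: 'a
  proof -
    have right: "cinner y (c *\<^sub>C x) = cnj c * cinner y x" for y
      by (metis cinner_commute cinner_scaleC_left complex_cnj_mult)
    have "cinner (c *\<^sub>C x) (c *\<^sub>C x) = (c * cnj c) * cinner x x"
      by (simp add: cinner_scaleC_left right)
    also have "c * cnj c = complex_of_real ((cmod c)\<^sup>2)"
      by (rule complex_norm_square[symmetric])
    finally have "(norm (c *\<^sub>C x))\<^sup>2 = (norm x * cmod c)\<^sup>2"
      by (simp add: power2_norm_eq_inner inner_eq_Re_cinner power_mult_distrib mult.commute)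
    then show ?thesis
      by (simp add: power2_eq_iff_nonneg)
  qed
qed

typedef (overloaded) 'h bop =
  "{T :: 'h::chilbert_space \<Rightarrow> 'h. bounded_linear T \<and> (\<forall>c x. T (c *\<^sub>C x) = c *\<^sub>C T x)}"
  morphisms op_apply Abs_bop
  by (rule exI[of _ "\<lambda>x. 0"]) simp

setup_lifting type_definition_bop

instantiation bop :: (chilbert_space) "{ring, monoid_mult, complex_vector}"
begin

lift_definition zero_bop :: "'a bop" is "\<lambda>x. 0" by simp
lift_definition one_bop :: "'a bop" is "\<lambda>x. x" by simp
lift_definition plus_bop :: "'a bop \<Rightarrow> 'a bop \<Rightarrow> 'a bop" is "\<lambda>S T x. S x + T x"
  by (simp add: bounded_linear_add scaleC_add_right)
lift_definition minus_bop :: "'a bop \<Rightarrow> 'a bop \<Rightarrow> 'a bop" is "\<lambda>S T x. S x - T x"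
  by (auto simp: bounded_linear_sub scaleC_diff_right)
lift_definition uminus_bop :: "'a bop \<Rightarrow> 'a bop" is "\<lambda>T x. - T x"
  by (simp add: bounded_linear_minus scaleC_minus_right)
lift_definition times_bop :: "'a bop \<Rightarrow> 'a bop \<Rightarrow> 'a bop" is "\<lambda>S T x. S (T x)"
  by (simp add: bounded_linear_compose)
lift_definition scaleC_bop :: "complex \<Rightarrow> 'a bop \<Rightarrow> 'a bop" is "\<lambda>c T x. c *\<^sub>C T x"
  by (simp add: bounded_linear_compose[OF bounded_linear_scaleC] scaleC_scaleC mult.commute)

instance
proof
  fix a b c :: "'a bop" and k l :: complex
  show "a + b + c = a + (b + c)" "a + b = b + a" "0 + a = a" "- a + a = 0" "a - b = a + - b"
    "a * b * c = a * (b * c)" "1 * a = a" "a * 1 = a" "(a + b) * c = a * c + b * c"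
    by (transfer, simp add: algebra_simps)+
  show "a * (b + c) = a * b + a * c"
    by transfer (simp add: fun_eq_iff linear_add bounded_linear.linear)
  show "k *\<^sub>C (a + b) = k *\<^sub>C a + k *\<^sub>C b" "(k + l) *\<^sub>C a = k *\<^sub>C a + l *\<^sub>C a"
    "k *\<^sub>C (l *\<^sub>C a) = (k * l) *\<^sub>C a" "1 *\<^sub>C a = a"
    by (transfer, simp add: scaleC_add_right scaleC_add_left scaleC_scaleC scaleC_one)+
qed

end

definition adj :: "'h::chilbert_space bop \<Rightarrow> 'h bop" where
  "adj T = (THE S. \<forall>x y. cinner (op_apply T x) y = cinner x (op_apply S y))"


section \<open>Von Neumann algebras, traces, conditional expectations\<close>

text \<open>Subalgebras are not required to contain the unit \<open>1\<close>, since a corner has the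
  unit \<open>p\<close>. All generating sets used below contain the relevant unit.\<close>

definition subalgebra :: "'h::chilbert_space bop set \<Rightarrow> bool" where
  "subalgebra A \<longleftrightarrow> 0 \<in> A \<and> (\<forall>a\<in>A. \<forall>b\<in>A. a + b \<in> A \<and> a * b \<in> A)
     \<and> (\<forall>c. \<forall>a\<in>A. c *\<^sub>C a \<in> A)"

definition alg_gen :: "'h::chilbert_space bop set \<Rightarrow> 'h bop set" where
  "alg_gen S = subalgebra hull S"

definition commutant :: "'h::chilbert_space bop set \<Rightarrow> 'h bop set" where
  "commutant S = {T. \<forall>s\<in>S. s * T = T * s}"

definition von_neumann_algebra :: "'h::chilbert_space bop set \<Rightarrow> bool" where
  "von_neumann_algebra M \<longleftrightarrow>
     subalgebra M \<and> 1 \<in> M \<and> (\<forall>a\<in>M. adj a \<in> M) \<and> commutant (commutant M) = M"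

definition vn_gen :: "'h::chilbert_space bop set \<Rightarrow> 'h bop set" where
  "vn_gen S = von_neumann_algebra hull S"

text \<open>The ultraweak topology is the initial topology of the functionals
  \<open>T \<mapsto> \<Sum>n. \<langle>T \<xi>\<^sub>n, \<eta>\<^sub>n\<rangle>\<close> with square-summable \<open>\<xi>\<close> and \<open>\<eta>\<close>.\<close>

definition ultraweak_topology :: "'h::chilbert_space bop topology" where
  "ultraweak_topology = topology_generated_by
     {{T. suminf (\<lambda>n. cinner (op_apply T (\<xi> n)) (\<eta> n)) \<in> U} | \<xi> \<eta> U.
        summable (\<lambda>n::nat. (norm (\<xi> n))\<^sup>2) \<and> summable (\<lambda>n. (norm (\<eta> n))\<^sup>2) \<and> open U}"

text \<open>Functions on a subset of the operators, such as \<open>\<tau>\<close> on \<open>M\<close>, are represented by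
  total functions of which only the values on that subset matter.\<close>

definition linear_on :: "'a::complex_vector set \<Rightarrow> ('a \<Rightarrow> complex) \<Rightarrow> bool" where
  "linear_on A f \<longleftrightarrow> (\<forall>a\<in>A. \<forall>b\<in>A. f (a + b) = f a + f b) \<and> (\<forall>c. \<forall>a\<in>A. f (c *\<^sub>C a) = c * f a)"

definition linear_map_on :: "'a::complex_vector set \<Rightarrow> ('a \<Rightarrow> 'b::complex_vector) \<Rightarrow> bool" where
  "linear_map_on A f \<longleftrightarrow>
     (\<forall>a\<in>A. \<forall>b\<in>A. f (a + b) = f a + f b) \<and> (\<forall>c. \<forall>a\<in>A. f (c *\<^sub>C a) = c *\<^sub>C f a)"

text \<open>Normality is ultraweak continuity on \<open>M\<close>.\<close>

definition faithful_normal_trace_state ::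
  "'h::chilbert_space bop set \<Rightarrow> ('h bop \<Rightarrow> complex) \<Rightarrow> bool" where
  "faithful_normal_trace_state M \<tau> \<longleftrightarrow>
     linear_on M \<tau> \<and> \<tau> 1 = 1 \<and>
     (\<forall>x\<in>M. \<tau> (adj x * x) \<in> \<real>\<^sub>\<ge>\<^sub>0) \<and>
     (\<forall>x\<in>M. \<forall>y\<in>M. \<tau> (x * y) = \<tau> (y * x)) \<and>
     (\<forall>x\<in>M. \<tau> (adj x * x) = 0 \<longrightarrow> x = 0) \<and>
     continuous_map (subtopology ultraweak_topology M) euclidean \<tau>"

definition positive_op :: "'h::chilbert_space bop \<Rightarrow> bool" where
  "positive_op T \<longleftrightarrow> (\<forall>x. cinner (op_apply T x) x \<in> \<real>\<^sub>\<ge>\<^sub>0)"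

definition trace_preserving_cond_exp ::
  "'h::chilbert_space bop set \<Rightarrow> ('h bop \<Rightarrow> complex) \<Rightarrow> 'h bop set \<Rightarrow> ('h bop \<Rightarrow> 'h bop) \<Rightarrow> bool" where
  "trace_preserving_cond_exp M \<tau> N E \<longleftrightarrow>
     E \<in> M \<rightarrow> N \<and> linear_map_on M E \<and>
     (\<forall>x\<in>M. positive_op x \<longrightarrow> positive_op (E x)) \<and>
     (\<forall>y\<in>N. E y = y) \<and>
     (\<forall>x\<in>M. \<forall>y\<in>N. \<forall>z\<in>N. E (y * x * z) = y * E x * z) \<and>
     (\<forall>x\<in>M. \<tau> (E x) = \<tau> x)"

definition cond_exp ::
  "'h::chilbert_space bop set \<Rightarrow> ('h bop \<Rightarrow> complex) \<Rightarrow> 'h bop set \<Rightarrow> 'h bop \<Rightarrow> 'h bop" where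
  "cond_exp M \<tau> A =
     (THE E. E \<in> extensional M \<and> trace_preserving_cond_exp M \<tau> (vn_gen A) E)"

text \<open>Freeness with amalgamation of a family of subalgebras, over the range of \<open>E\<close>.\<close>

definition free_over ::
  "('h::chilbert_space bop \<Rightarrow> 'h bop) \<Rightarrow> ('i \<Rightarrow> 'h bop set) \<Rightarrow> bool" where
  "free_over E A \<longleftrightarrow>
     (\<forall>is as. as \<noteq> [] \<longrightarrow> distinct_adj is \<longrightarrow>
        list_all2 (\<lambda>i a. a \<in> A i \<and> E a = 0) is as \<longrightarrow> E (prod_list as) = 0)"

definition amalg_free_with ::
  "'h::chilbert_space bop set \<Rightarrow> ('h bop \<Rightarrow> complex) \<Rightarrow> 'h bop set \<Rightarrow> 'h bop \<Rightarrow> 'h bop \<Rightarrow> bool" where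
  "amalg_free_with M \<tau> B p X \<longleftrightarrow>
     free_over (cond_exp M \<tau> B)
       (\<lambda>i::bool. if i then alg_gen (insert p B) else alg_gen (insert X B))"


section \<open>Algebraic freeness\<close>

text \<open>Let \<open>C\<close> be an algebra with unit \<open>e\<close>. The free product of \<open>C\<close> and the polynomials in
  one variable \<open>t\<close> is the free algebra on the set \<open>C \<squnion> {t}\<close>, consisting of the finitely
  supported functions on words (with \<open>Some c\<close> for a letter \<open>c \<in> C\<close> and \<open>None\<close> for \<open>t\<close>),
  modulo the ideal of the relations saying that the letters from \<open>C\<close> add, scale
  and multiply as in \<open>C\<close> and that \<open>e\<close> is the empty word. Since the
  generators below carry arbitrary coefficients \<open>z\<close> and arbitrary words \<open>u\<close>, \<open>v\<close> on
  either side, the additive subgroup they generate is that two-sided ideal.\<close>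

definition nc_words :: "'h::chilbert_space bop set \<Rightarrow> 'h bop option list set" where
  "nc_words C = lists (insert None (Some ` C))"

inductive_set nc_ideal ::
  "'h::chilbert_space bop \<Rightarrow> 'h bop set \<Rightarrow> ('h bop option list \<Rightarrow>\<^sub>0 complex) set"
  for e :: "'h bop" and C :: "'h bop set" where
  zero: "0 \<in> nc_ideal e C"
| diff: "f \<in> nc_ideal e C \<Longrightarrow> g \<in> nc_ideal e C \<Longrightarrow> f - g \<in> nc_ideal e C"
| add_rel: "u \<in> nc_words C \<Longrightarrow> v \<in> nc_words C \<Longrightarrow> c \<in> C \<Longrightarrow> d \<in> C \<Longrightarrow>
    Poly_Mapping.single (u @ [Some (c + d)] @ v) z
      - Poly_Mapping.single (u @ [Some c] @ v) z
      - Poly_Mapping.single (u @ [Some d] @ v) z \<in> nc_ideal e C"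
| scale_rel: "u \<in> nc_words C \<Longrightarrow> v \<in> nc_words C \<Longrightarrow> c \<in> C \<Longrightarrow>
    Poly_Mapping.single (u @ [Some (k *\<^sub>C c)] @ v) z
      - Poly_Mapping.single (u @ [Some c] @ v) (k * z) \<in> nc_ideal e C"
| mult_rel: "u \<in> nc_words C \<Longrightarrow> v \<in> nc_words C \<Longrightarrow> c \<in> C \<Longrightarrow> d \<in> C \<Longrightarrow>
    Poly_Mapping.single (u @ [Some (c * d)] @ v) z
      - Poly_Mapping.single (u @ [Some c, Some d] @ v) z \<in> nc_ideal e C"
| unit_rel: "u \<in> nc_words C \<Longrightarrow> v \<in> nc_words C \<Longrightarrow>
    Poly_Mapping.single (u @ [Some e] @ v) z - Poly_Mapping.single (u @ v) z \<in> nc_ideal e C"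

definition nc_eval ::
  "'h::chilbert_space bop \<Rightarrow> 'h bop \<Rightarrow> ('h bop option list \<Rightarrow>\<^sub>0 complex) \<Rightarrow> 'h bop" where
  "nc_eval e X f =
     (\<Sum>w\<in>Poly_Mapping.keys f. Poly_Mapping.lookup f w *\<^sub>C
        (e * prod_list (map (case_option X (\<lambda>c. c)) w)))"

text \<open>Injectivity of the map induced by evaluation at \<open>t = X\<close> on the quotient.\<close>

definition algebraically_free ::
  "'h::chilbert_space bop \<Rightarrow> 'h bop set \<Rightarrow> 'h bop \<Rightarrow> bool" where
  "algebraically_free e C X \<longleftrightarrow>
     (\<forall>f g. Poly_Mapping.keys f \<subseteq> nc_words C \<longrightarrow> Poly_Mapping.keys g \<subseteq> nc_words C \<longrightarrow>
        nc_eval e X f = nc_eval e X g \<longrightarrow> f - g \<in> nc_ideal e C)"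


section \<open>Algebraic tensor products and free difference quotients\<close>

text \<open>The algebraic tensor product over the complex numbers: the free vector space on
  pairs modulo the bilinearity relations.\<close>

inductive_set tensor_null ::
  "(('a::complex_vector \<times> 'b::complex_vector) \<Rightarrow>\<^sub>0 complex) set" where
  zero: "0 \<in> tensor_null"
| diff: "f \<in> tensor_null \<Longrightarrow> g \<in> tensor_null \<Longrightarrow> f - g \<in> tensor_null"
| add_left: "Poly_Mapping.single (x + x', y) z - Poly_Mapping.single (x, y) z
    - Poly_Mapping.single (x', y) z \<in> tensor_null"
| add_right: "Poly_Mapping.single (x, y + y') z - Poly_Mapping.single (x, y) z
    - Poly_Mapping.single (x, y') z \<in> tensor_null"
| scale_left: "Poly_Mapping.single (c *\<^sub>C x, y) z - Poly_Mapping.single (x, y) (c * z) \<in> tensor_null"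
| scale_right: "Poly_Mapping.single (x, c *\<^sub>C y) z - Poly_Mapping.single (x, y) (c * z) \<in> tensor_null"

lemma tensor_null_uminus: "f \<in> tensor_null \<Longrightarrow> - f \<in> tensor_null"
  using tensor_null.diff[OF tensor_null.zero] by simp

lemma tensor_null_add: "f \<in> tensor_null \<Longrightarrow> g \<in> tensor_null \<Longrightarrow> f + g \<in> tensor_null"
  using tensor_null.diff[OF _ tensor_null_uminus] by fastforce

definition tensor_rel where
  "tensor_rel f g \<longleftrightarrow> f - g \<in> tensor_null"

lemma equivp_tensor_rel: "equivp tensor_rel"
proof (rule equivpI)
  show "reflp tensor_rel"
    by (simp add: reflp_def tensor_rel_def tensor_null.zero)
  show "symp tensor_rel"
    using tensor_null_uminus by (fastforce simp: symp_def tensor_rel_def)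
  show "transp tensor_rel"
    using tensor_null_add by (fastforce simp: transp_def tensor_rel_def)
qed

quotient_type (overloaded) ('a, 'b) tensor =
  "('a::complex_vector \<times> 'b::complex_vector) \<Rightarrow>\<^sub>0 complex" / tensor_rel
  by (rule equivp_tensor_rel)

lift_definition tensor_prod ::
  "'a::complex_vector \<Rightarrow> 'b::complex_vector \<Rightarrow> ('a, 'b) tensor"  (infixr "\<otimes>\<^sub>t" 70)
  is "\<lambda>x y. Poly_Mapping.single (x, y) 1" .

lemma lookup_poly_scale:
  "Poly_Mapping.lookup (Poly_Mapping.map ((*) (c::complex)) f) k = c * Poly_Mapping.lookup f k"
  by (simp add: Poly_Mapping.map.rep_eq when_def)

lemma poly_scale_single:
  "Poly_Mapping.map ((*) (c::complex)) (Poly_Mapping.single k z) = Poly_Mapping.single k (c * z)"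
  by (rule poly_mapping_eqI) (simp add: lookup_poly_scale lookup_single when_def)

lemma poly_scale_diff:
  "Poly_Mapping.map ((*) (c::complex)) (f - g) =
    Poly_Mapping.map ((*) c) f - Poly_Mapping.map ((*) c) g"
  by (rule poly_mapping_eqI) (simp add: lookup_poly_scale lookup_minus right_diff_distrib)

lemma tensor_null_scale:
  "f \<in> tensor_null \<Longrightarrow> Poly_Mapping.map ((*) (c::complex)) f \<in> tensor_null"
proof (induction rule: tensor_null.induct)
  case zero
  have "Poly_Mapping.map ((*) c) 0 = 0"
    by (rule poly_mapping_eqI) (simp add: lookup_poly_scale)
  then show ?case by (metis tensor_null.zero)
next
  case (scale_left k x y z)
  show ?case
    using tensor_null.scale_left[of k x y "c * z"]
    by (simp add: poly_scale_diff poly_scale_single mult.left_commute)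
next
  case (scale_right x k y z)
  show ?case
    using tensor_null.scale_right[of x k y "c * z"]
    by (simp add: poly_scale_diff poly_scale_single mult.left_commute)
qed (auto simp: poly_scale_diff poly_scale_single intro: tensor_null.intros)

instantiation tensor :: (complex_vector, complex_vector) complex_vector
begin

lift_definition zero_tensor :: "('a, 'b) tensor" is 0 .
lift_definition plus_tensor :: "('a, 'b) tensor \<Rightarrow> ('a, 'b) tensor \<Rightarrow> ('a, 'b) tensor" is "(+)"
  unfolding tensor_rel_def by (drule (1) tensor_null_add) (simp add: add_diff_add)
lift_definition uminus_tensor :: "('a, 'b) tensor \<Rightarrow> ('a, 'b) tensor" is uminus
  unfolding tensor_rel_def by (drule tensor_null_uminus) simp
lift_definition minus_tensor :: "('a, 'b) tensor \<Rightarrow> ('a, 'b) tensor \<Rightarrow> ('a, 'b) tensor" is "(-)"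
  unfolding tensor_rel_def by (drule (1) tensor_null.diff) (simp add: algebra_simps)
lift_definition scaleC_tensor :: "complex \<Rightarrow> ('a, 'b) tensor \<Rightarrow> ('a, 'b) tensor"
  is "\<lambda>c. Poly_Mapping.map ((*) c)"
  unfolding tensor_rel_def using tensor_null_scale by (metis poly_scale_diff)

instance
proof
  fix a b c :: "('a, 'b) tensor" and k l :: complex
  have eqI: "tensor_rel f g" if "f = g" for f g :: "('a \<times> 'b) \<Rightarrow>\<^sub>0 complex"
    using that by (simp add: tensor_rel_def tensor_null.zero)
  show "a + b + c = a + (b + c)" "a + b = b + a" "0 + a = a" "- a + a = 0" "a - b = a + - b"
    by (transfer, rule eqI, simp add: algebra_simps)+
  show "k *\<^sub>C (a + b) = k *\<^sub>C a + k *\<^sub>C b"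
    by (transfer, rule eqI, rule poly_mapping_eqI)
      (simp add: lookup_poly_scale lookup_add distrib_left)
  show "(k + l) *\<^sub>C a = k *\<^sub>C a + l *\<^sub>C a"
    by (transfer, rule eqI, rule poly_mapping_eqI)
      (simp add: lookup_poly_scale lookup_add distrib_right)
  show "k *\<^sub>C (l *\<^sub>C a) = (k * l) *\<^sub>C a"
    by (transfer, rule eqI, rule poly_mapping_eqI) (simp add: lookup_poly_scale mult.assoc)
  show "1 *\<^sub>C a = a"
    by (transfer, rule eqI, rule poly_mapping_eqI) (simp add: lookup_poly_scale)
qed

end

text \<open>For subspaces \<open>A\<close> and \<open>C\<close> the algebraic tensor product of \<open>A\<close> and \<open>C\<close> embeds into that
  of the ambient spaces; its image is the set of sums of elementary tensors.\<close>

definition tensor_sum :: "('a::complex_vector \<times> 'b::complex_vector) list \<Rightarrow> ('a, 'b) tensor" where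
  "tensor_sum zs = (\<Sum>(x, y)\<leftarrow>zs. x \<otimes>\<^sub>t y)"

definition tensor_span ::
  "'a::complex_vector set \<Rightarrow> 'b::complex_vector set \<Rightarrow> ('a, 'b) tensor set" where
  "tensor_span A C = tensor_sum ` lists (A \<times> C)"

text \<open>The map \<open>f \<otimes> g\<close> on the tensor product of \<open>A\<close> and \<open>C\<close>, for \<open>f\<close> linear on the
  subspace \<open>A\<close> and \<open>g\<close> linear on the subspace \<open>C\<close>.\<close>

definition tensor_map ::
  "'a::complex_vector set \<Rightarrow> 'b::complex_vector set \<Rightarrow> ('a \<Rightarrow> 'c::complex_vector) \<Rightarrow>
    ('b \<Rightarrow> 'd::complex_vector) \<Rightarrow> ('a, 'b) tensor \<Rightarrow> ('c, 'd) tensor" where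
  "tensor_map A C f g u =
     (THE v. \<exists>zs \<in> lists (A \<times> C). u = tensor_sum zs \<and> v = tensor_sum (map (map_prod f g) zs))"

definition tensor_lmult ::
  "'h::chilbert_space bop \<Rightarrow> ('h bop, 'h bop) tensor \<Rightarrow> ('h bop, 'h bop) tensor" where
  "tensor_lmult a = tensor_map UNIV UNIV (\<lambda>x. a * x) (\<lambda>y. y)"

definition tensor_rmult ::
  "('h::chilbert_space bop, 'h bop) tensor \<Rightarrow> 'h bop \<Rightarrow> ('h bop, 'h bop) tensor" where
  "tensor_rmult u b = tensor_map UNIV UNIV (\<lambda>x. x) (\<lambda>y. y * b) u"

definition is_free_difference_quotient ::
  "'h::chilbert_space bop \<Rightarrow> 'h bop set \<Rightarrow> 'h bop \<Rightarrow> ('h bop \<Rightarrow> ('h bop, 'h bop) tensor) \<Rightarrow> bool" where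
  "is_free_difference_quotient e C X D \<longleftrightarrow> (let A = alg_gen (insert X C) in
     D \<in> A \<rightarrow> tensor_span A A \<and> linear_map_on A D \<and>
     (\<forall>a\<in>A. \<forall>b\<in>A. D (a * b) = tensor_rmult (D a) b + tensor_lmult a (D b)) \<and>
     (\<forall>c\<in>C. D c = 0) \<and> D X = e \<otimes>\<^sub>t e)"

text \<open>Meaningful if \<open>C\<close> is an algebra with unit \<open>e\<close> and \<open>X\<close> is algebraically free from \<open>C\<close>.\<close>

definition free_difference_quotient ::
  "'h::chilbert_space bop \<Rightarrow> 'h bop set \<Rightarrow> 'h bop \<Rightarrow> 'h bop \<Rightarrow> ('h bop, 'h bop) tensor" where
  "free_difference_quotient e C X =
     (THE D. D \<in> extensional (alg_gen (insert X C)) \<and> is_free_difference_quotient e C X D)"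

end

theory Submission
  imports Defs
begin

text \<open>Write \<open>A = B[p]\<close>, \<open>C = B\<langle>X\<rangle>\<close>, \<open>D = A\<langle>X\<rangle>\<close>, and let \<open>E\<close> be the expectation onto \<open>W\<^sup>*(C)\<close>.
  Since \<open>\<partial>\<^bsub>X:A\<^esub>(X\<^sub>p) = \<alpha>\<^sup>-\<^sup>1 p \<otimes> p\<close>, the derivation \<open>\<alpha> \<partial>\<^bsub>X:A\<^esub>\<close> restricts to \<open>\<partial>\<close> of \<open>X\<^sub>p\<close> over
  \<open>Bp\<close>, and \<open>\<partial>\<^bsub>X:A\<^esub>\<close> restricts to \<open>\<partial>\<^bsub>X:B\<^esub>\<close> on \<open>C\<close>. As \<open>\<Psi> = \<alpha>\<^sup>-\<^sup>1 E\<close>, the claim reduces to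
  \<open>(E \<otimes> E) \<circ> \<partial>\<^bsub>X:A\<^esub> = \<partial>\<^bsub>X:A\<^esub> \<circ> E\<close> on \<open>D\<close>. Now \<open>D\<close> is the sum of \<open>C\<close>, where \<open>E\<close> is the identity, and
  of the span of the words \<open>x\<^sub>0 a\<^sub>1 x\<^sub>1 \<dots> a\<^sub>n x\<^sub>n\<close> with \<open>n \<ge> 1\<close> and centred letters (except \<open>x\<^sub>0\<close> and
  \<open>x\<^sub>n\<close>), which \<open>E\<close> kills by freeness. Differentiating such a word at a letter \<open>x\<^sub>i\<close> leaves some
  \<open>a\<^sub>j\<close> in one of the two tensor factors, so \<open>E \<otimes> E\<close> kills the derivative too.

  That \<open>E\<close> exists at all rests on the faithful normal trace, and that orthogonality to \<open>C\<close>
  implies orthogonality to \<open>W\<^sup>*(C)\<close> is the bicommutant density theorem.\<close>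

section \<open>Hilbert space preliminaries\<close>

text \<open>The scalars balance: the derivation over \<open>Bp\<close> carries one factor \<alpha>
  and the two copies of \<Psi> carry the square of its inverse, which leaves exactly the single
  inverse contained in \<Psi> on the right-hand side. Restricting one derivation over
  \<open>A\<close> makes algebraic freeness of X from B[p] the only source of difference quotients.
  This suffices because a derivation is determined by its values on generators; over
  \<open>A\<close> it is obtained by differentiating formal words, an operation that kills the
  relations between letters of \<open>A\<close>. The obstacle that shapes the rest is that
  \<open>adj\<close>, \<open>cond_exp\<close>, \<open>tensor_map\<close> and
  \<open>free_difference_quotient\<close> are definite descriptions: they denote the intended
  objects only after existence and uniqueness are established. For \<open>tensor_map\<close> this is
  why E, meaningful only on \<open>M\<close>, is replaced by a linear extension \<open>E'\<close> to
  all operators, whose tensor square is given by the universal property.\<close>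

lemma scaleC_zero_left [simp]: "0 *\<^sub>C (x::'a::complex_vector) = 0"
  using scaleC_add_left[of 0 0 x] by simp

lemma scaleC_minus_left: "(- c) *\<^sub>C x = - (c *\<^sub>C (x::'a::complex_vector))"
  using scaleC_add_left[of c "- c" x] by (simp add: eq_neg_iff_add_eq_0 add.commute)

lemma scaleC_minus_one: "(- 1) *\<^sub>C x = - (x::'a::complex_vector)"
  by (simp add: scaleC_minus_left scaleC_one)

lemma cinner_add_right: "cinner x (y + z) = cinner x y + cinner x (z::'h::chilbert_space)"
  by (metis cinner_add_left cinner_commute complex_cnj_add)

lemma cinner_scaleC_right: "cinner x (c *\<^sub>C y) = cnj c * cinner x (y::'h::chilbert_space)"
  by (metis cinner_commute cinner_scaleC_left complex_cnj_mult)

lemma cinner_zero_left [simp]: "cinner 0 (y::'h::chilbert_space) = 0"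
  using cinner_add_left[of 0 0 y] by simp

lemma cinner_zero_right [simp]: "cinner (x::'h::chilbert_space) 0 = 0"
  using cinner_add_right[of x 0 0] by simp

lemma cinner_minus_left: "cinner (- x) (y::'h::chilbert_space) = - cinner x y"
  using cinner_add_left[of x "- x" y] by (simp add: eq_neg_iff_add_eq_0 add.commute)

lemma cinner_minus_right: "cinner x (- y::'h::chilbert_space) = - cinner x y"
  using cinner_add_right[of x y "- y"] by (simp add: eq_neg_iff_add_eq_0 add.commute)

lemma cinner_diff_left: "cinner (x - y) (z::'h::chilbert_space) = cinner x z - cinner y z"
  using cinner_add_left[of x "- y" z] by (simp add: cinner_minus_left)

lemma cinner_diff_right: "cinner x (y - z::'h::chilbert_space) = cinner x y - cinner x z"
  using cinner_add_right[of x y "- z"] by (simp add: cinner_minus_right)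

lemma cinner_scaleR_left: "cinner (r *\<^sub>R x) (y::'h::chilbert_space) = of_real r * cinner x y"
  by (simp add: scaleR_scaleC cinner_scaleC_left)

lemma cinner_scaleR_right: "cinner x (r *\<^sub>R y::'h::chilbert_space) = of_real r * cinner x y"
  by (simp add: scaleR_scaleC cinner_scaleC_right)

lemma Im_cinner: "Im (cinner x y) = inner x (\<i> *\<^sub>C (y::'h::chilbert_space))"
  by (simp add: inner_eq_Re_cinner cinner_scaleC_right)

lemma cinner_self: "cinner x x = complex_of_real ((norm (x::'h::chilbert_space))\<^sup>2)"
proof -
  have "Im (cinner x x) = 0"
    using cinner_commute[of x x] by (metis add.inverse_inverse cnj.sel(2) eq_neg_iff_add_eq_0 double_zero mult_2)
  then show ?thesis
    by (simp add: complex_eq_iff power2_norm_eq_inner inner_eq_Re_cinner)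
qed

lemma norm_scaleC: "norm (c *\<^sub>C (x::'h::chilbert_space)) = cmod c * norm x"
proof -
  have "complex_of_real ((norm (c *\<^sub>C x))\<^sup>2) = c * cnj c * complex_of_real ((norm x)\<^sup>2)"
    by (simp only: cinner_self[symmetric] cinner_scaleC_left cinner_scaleC_right) simp
  also have "\<dots> = complex_of_real ((cmod c * norm x)\<^sup>2)"
    by (simp only: complex_norm_square[symmetric] power_mult_distrib of_real_mult)
  finally have "(norm (c *\<^sub>C x))\<^sup>2 = (cmod c * norm x)\<^sup>2"
    by (simp only: of_real_eq_iff)
  then show ?thesis
    by (simp add: power2_eq_iff_nonneg)
qed

lemma norm_cinner_le: "cmod (cinner x y) \<le> norm x * norm (y::'h::chilbert_space)"
proof (cases "cinner x y = 0")
  case False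
  define c where "c = cnj (cinner x y) / cmod (cinner x y)"
  have c: "cmod c = 1"
    using False by (simp add: c_def norm_divide)
  have "c * cinner x y = of_real ((cmod (cinner x y))\<^sup>2) / of_real (cmod (cinner x y))"
    unfolding c_def complex_norm_square by simp
  then have "c * cinner x y = of_real (cmod (cinner x y))"
    using False by (simp add: power2_eq_square)
  then have "cmod (cinner x y) = inner (c *\<^sub>C x) y"
    by (simp add: inner_eq_Re_cinner cinner_scaleC_left)
  also have "\<dots> \<le> norm (c *\<^sub>C x) * norm y"
    by (rule norm_cauchy_schwarz)
  finally show ?thesis
    by (simp add: norm_scaleC c)
qed simp

lemma bounded_bilinear_cinner: "bounded_bilinear (cinner :: 'h::chilbert_space \<Rightarrow> 'h \<Rightarrow> complex)"
proof
  show "\<exists>K. \<forall>a b::'h. cmod (cinner a b) \<le> norm a * norm b * K"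
    by (rule exI[of _ 1]) (simp add: norm_cinner_le)
qed (simp_all add: cinner_add_left cinner_add_right cinner_scaleR_left cinner_scaleR_right scaleR_conv_of_real)

lemmas tendsto_cinner = bounded_bilinear.tendsto[OF bounded_bilinear_cinner]

lemma cinner_left_ext: "(\<And>z. cinner x z = cinner y z) \<Longrightarrow> x = (y::'h::chilbert_space)"
  using cinner_self[of "x - y"] by (simp add: cinner_diff_left)

lemma cinner_right_ext: "(\<And>z. cinner z x = cinner z y) \<Longrightarrow> x = (y::'h::chilbert_space)"
  using cinner_self[of "x - y"] by (simp add: cinner_diff_right)

lemma Cauchy_if_dist_tendsto_zero:
  fixes s :: "nat \<Rightarrow> 'a::metric_space"
  assumes le: "\<And>m n. N \<le> m \<Longrightarrow> m \<le> n \<Longrightarrow> dist (s m) (s n) \<le> r m" and r: "r \<longlonglongrightarrow> (0::real)"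
  shows "Cauchy s"
proof (rule metric_CauchyI)
  fix e :: real assume "e > 0"
  then obtain K where K: "\<And>m. m \<ge> K \<Longrightarrow> norm (r m) < e / 2"
    using LIMSEQ_D[OF r, of "e / 2"] by auto
  have half: "dist (s (max K N)) (s n) < e / 2" if "n \<ge> max K N" for n
    using le[of "max K N" n] K[of "max K N"] that by auto
  show "\<exists>M. \<forall>m\<ge>M. \<forall>n\<ge>M. dist (s m) (s n) < e"
    using half by (meson dist_triangle_half_r)
qed

section \<open>Orthogonal projection and representation of functionals\<close>

definition csubspace :: "'a::complex_vector set \<Rightarrow> bool" where
  "csubspace S \<longleftrightarrow> 0 \<in> S \<and> (\<forall>x\<in>S. \<forall>y\<in>S. x + y \<in> S) \<and> (\<forall>c. \<forall>x\<in>S. c *\<^sub>C x \<in> S)"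

lemma csubspaceD:
  assumes "csubspace S"
  shows "0 \<in> S" "x \<in> S \<Longrightarrow> y \<in> S \<Longrightarrow> x + y \<in> S" "x \<in> S \<Longrightarrow> c *\<^sub>C x \<in> S"
    "x \<in> S \<Longrightarrow> - x \<in> S" "x \<in> S \<Longrightarrow> y \<in> S \<Longrightarrow> x - y \<in> S"
proof -
  show neg: "- x \<in> S" if "x \<in> S" for x
    using assms that scaleC_minus_one[of x] unfolding csubspace_def by metis
  show "0 \<in> S" "x \<in> S \<Longrightarrow> y \<in> S \<Longrightarrow> x + y \<in> S" "x \<in> S \<Longrightarrow> c *\<^sub>C x \<in> S"
    using assms unfolding csubspace_def by auto
  show "x \<in> S \<Longrightarrow> y \<in> S \<Longrightarrow> x - y \<in> S"
    using assms neg[of y] unfolding csubspace_def by (metis add_uminus_conv_diff)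
qed

text \<open>For c > 0 evaluate at the minimiser t = -b/c; for c = 0 a nonnegative affine function
  must be constant. This one estimate yields orthogonality of nearest points, Cauchy-Schwarz for
  positive operators and the first variation of \<open>sqdist\<close>.\<close>

lemma nonneg_quadratic_discriminant:
  fixes a b c :: real
  assumes q: "\<And>t. 0 \<le> a + 2 * t * b + t\<^sup>2 * c" and c: "0 \<le> c"
  shows "b\<^sup>2 \<le> a * c"
proof (cases "c = 0")
  case True
  have "b = 0"
  proof (rule ccontr)
    assume "b \<noteq> 0"
    then show False
      using q[of "- (a + 1) / (2 * b)"] by (simp add: True field_simps)
  qed
  then show ?thesis by (simp add: True)
next
  case False
  with c have c0: "c > 0" by simp
  have "0 \<le> (a + 2 * (- b / c) * b + (- b / c)\<^sup>2 * c) * c"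
    using q[of "- b / c"] c by (rule mult_nonneg_nonneg)
  also have "\<dots> = a * c - b\<^sup>2"
    using c0 by (simp add: field_simps power2_eq_square)
  finally show ?thesis by simp
qed

text \<open>The witness is the point of S nearest to x: the parallelogram law makes a minimising
  sequence Cauchy, completeness supplies the limit, and minimality along every real line in S gives
  orthogonality.\<close>

theorem hilbert_projection:
  fixes S :: "'h::chilbert_space set"
  assumes S: "csubspace S" and cl: "closed S"
  obtains y where "y \<in> S" "\<And>z. z \<in> S \<Longrightarrow> cinner (x - y) z = 0"
proof -
  note S' = csubspaceD[OF S]
  have SR: "r *\<^sub>R z \<in> S" if "z \<in> S" for r z
    using S'(3)[OF that] by (simp add: scaleR_scaleC)
  define Q where "Q = (\<lambda>z. (norm (x - z))\<^sup>2)"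
  define d where "d = (INF z\<in>S. Q z)"
  have bdd: "bdd_below (Q ` S)"
    by (rule bdd_belowI[of _ 0]) (auto simp: Q_def)
  have ge: "d \<le> Q z" if "z \<in> S" for z
    unfolding d_def using bdd that by (rule cINF_lower)
  have "\<exists>z\<in>S. Q z < d + inverse (real (Suc n))" for n
  proof -
    have "Inf (Q ` S) < d + inverse (real (Suc n))"
      unfolding d_def by simp
    then show ?thesis
      using cINF_less_iff[OF _ bdd, of "d + inverse (real (Suc n))"] S'(1) d_def by blast
  qed
  then obtain s where sS: "\<And>n. s n \<in> S" and s: "\<And>n. Q (s n) < d + inverse (real (Suc n))"
    by metis
  \<comment> \<open>Parallelogram law for \<open>x - s m\<close> and \<open>x - s n\<close>: their
    half sum is x minus the midpoint, which lies in S and so has squared distance at least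
    d.\<close>
  have par: "(norm (s m - s n))\<^sup>2 \<le> 2 * (Q (s m) - d) + 2 * (Q (s n) - d)" for m n
  proof -
    let ?a = "x - s m" and ?b = "x - s n"
    let ?w = "(1/2) *\<^sub>R (s m + s n)"
    have "?w \<in> S"
      using SR S'(2) sS by blast
    then have w: "d \<le> Q ?w"
      by (rule ge)
    have "x - ?w = (1/2) *\<^sub>R (?a + ?b)"
      by (simp add: algebra_simps) (simp flip: scaleR_add_left)
    then have "4 * Q ?w = (norm (?a + ?b))\<^sup>2"
      by (simp add: Q_def power_mult_distrib power_divide)
    moreover have "(norm (?a + ?b))\<^sup>2 + (norm (?b - ?a))\<^sup>2 = 2 * Q (s m) + 2 * Q (s n)"
      unfolding Q_def power2_norm_eq_inner
      by (simp add: inner_add_left inner_add_right inner_diff_left inner_diff_right inner_commute)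
    moreover have "?b - ?a = s m - s n"
      by simp
    ultimately show ?thesis
      using w by simp
  qed
  have "Cauchy s"
  proof (rule Cauchy_if_dist_tendsto_zero)
    show "dist (s m) (s n) \<le> sqrt (4 * inverse (real (Suc m)))" if "m \<le> n" for m n
    proof (rule real_le_rsqrt)
      have "inverse (real (Suc n)) \<le> inverse (real (Suc m))"
        using that by (intro le_imp_inverse_le) auto
      moreover have "u \<le> 4 * a" if "u \<le> 2 * (p - d) + 2 * (q - d)" "p < d + a" "q < d + b" "b \<le> a"
        for a b p q u :: real
        using that by (simp add: algebra_simps)
      ultimately show "(dist (s m) (s n))\<^sup>2 \<le> 4 * inverse (real (Suc m))"
        using par[of m n] s[of m] s[of n] unfolding dist_norm by blast
    qed
    have "(\<lambda>m. sqrt (4 * inverse (real (Suc m)))) \<longlonglongrightarrow> sqrt (4 * 0)"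
      by (intro tendsto_intros LIMSEQ_inverse_real_of_nat)
    then show "(\<lambda>m. sqrt (4 * inverse (real (Suc m)))) \<longlonglongrightarrow> 0"
      by simp
  qed
  then obtain y where y: "s \<longlonglongrightarrow> y"
    using Cauchy_convergent_iff convergent_def by blast
  have yS: "y \<in> S"
    using closed_sequentially[OF cl] sS y by blast
  have "(\<lambda>n. Q (s n)) \<longlonglongrightarrow> Q y"
    unfolding Q_def by (intro tendsto_intros y)
  moreover have "(\<lambda>n. d + inverse (real (Suc n))) \<longlonglongrightarrow> d + 0"
    by (intro tendsto_intros LIMSEQ_inverse_real_of_nat)
  ultimately have Qy: "Q y \<le> d"
    using LIMSEQ_le s by (metis (no_types, lifting) add.right_neutral less_imp_le)
  have inner0: "inner (x - y) z = 0" if z: "z \<in> S" for z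
  proof -
    define A where "A = inner (x - y) z"
    define C where "C = inner z z"
    have C: "C \<ge> 0" by (simp add: C_def)
    have quad: "0 \<le> t\<^sup>2 * C - 2 * t * A" for t
    proof -
      have "Q y \<le> Q (y + t *\<^sub>R z)"
        using Qy ge[of "y + t *\<^sub>R z"] S'(2)[OF yS SR[OF z]] by force
      also have "Q (y + t *\<^sub>R z) = Q y - 2 * t * A + t\<^sup>2 * C"
        unfolding Q_def A_def C_def power2_norm_eq_inner
        by (simp add: inner_add_left inner_add_right inner_diff_left inner_diff_right inner_commute
            power2_eq_square algebra_simps)
      finally show ?thesis by simp
    qed
    have "A\<^sup>2 \<le> 0 * C"
    proof (rule nonneg_quadratic_discriminant)
      show "0 \<le> 0 + 2 * t * A + t\<^sup>2 * C" for t
        using quad[of "- t"] by simp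
    qed (rule C)
    then show ?thesis by (simp add: A_def)
  qed
  \<comment> \<open>The variation sees only the real inner product; z and \<i> z together recover
    both parts of \<open>cinner\<close>.\<close>
  have "cinner (x - y) z = 0" if "z \<in> S" for z
    using inner0[OF that] inner0[OF S'(3)[OF that, of \<i>]]
    by (simp add: complex_eq_iff Im_cinner inner_eq_Re_cinner[symmetric])
  then show ?thesis
    using that yS by blast
qed

text \<open>If f is nonzero, some u with \<open>f u\<close> nonzero is orthogonal to the kernel.
  Since x minus a multiple of u lies in the kernel, a scalar multiple of u represents f.\<close>

theorem riesz_representation:
  fixes f :: "'h::chilbert_space \<Rightarrow> complex"
  assumes add: "\<And>x y. f (x + y) = f x + f y" and scale: "\<And>c x. f (c *\<^sub>C x) = c * f x"
    and bound: "\<And>x. cmod (f x) \<le> K * norm x"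
  obtains y where "\<And>x. f x = cinner x y"
proof (cases "\<forall>x. f x = 0")
  case True
  then show ?thesis
    using that[of 0] by simp
next
  case False
  then obtain x0 where x0: "f x0 \<noteq> 0" by auto
  have bl: "bounded_linear f"
    by (rule bounded_linear_intro[of _ K]) (auto simp: add scale scaleR_scaleC scaleR_conv_of_real bound mult.commute)
  have diff: "f (x - y) = f x - f y" for x y
    using bl by (simp add: bounded_linear.linear linear_diff)
  define S where "S = f -` {0}"
  have f0: "f 0 = 0"
    using add[of 0 0] by simp
  have S: "csubspace S"
    unfolding csubspace_def S_def using f0 by (auto simp: add scale)
  have "closed S"
    unfolding S_def by (intro closed_vimage closed_singleton linear_continuous_on bl)
  then obtain y where y: "y \<in> S" "\<And>z. z \<in> S \<Longrightarrow> cinner (x0 - y) z = 0"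
    using hilbert_projection[OF S, where x = x0] by blast
  define u where "u = x0 - y"
  have fu: "f u \<noteq> 0"
    using x0 y(1) by (simp add: u_def diff S_def)
  then have u0: "norm u \<noteq> 0"
    using f0 by auto
  have orth: "cinner z u = 0" if "z \<in> S" for z
    using y(2)[OF that] cinner_commute[of z u] by (simp add: u_def)
  have main: "f x = cinner x ((cnj (f u) / of_real ((norm u)\<^sup>2)) *\<^sub>C u)" for x
  proof -
    have "x - (f x / f u) *\<^sub>C u \<in> S"
      using fu by (simp add: S_def diff scale)
    from orth[OF this] have "cinner x u = f x / f u * of_real ((norm u)\<^sup>2)"
      by (simp add: cinner_diff_left cinner_scaleC_left cinner_self)
    then show ?thesis
      using fu u0 by (simp add: cinner_scaleC_right)
  qed
  show ?thesis
    by (rule that) (rule main)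
qed


section \<open>Bounded operators and adjoints\<close>

lemma op_apply_simps [simp]:
  "op_apply 0 x = 0" "op_apply 1 x = x" "op_apply (S + T) x = op_apply S x + op_apply T x"
  "op_apply (S - T) x = op_apply S x - op_apply T x" "op_apply (- T) x = - op_apply T x"
  "op_apply (S * T) x = op_apply S (op_apply T x)" "op_apply (c *\<^sub>C T) x = c *\<^sub>C op_apply T x"
  by (transfer, simp)+

lemma bop_eqI: "(\<And>x. op_apply S x = op_apply T x) \<Longrightarrow> S = T"
  by transfer auto

lemma op_apply_scaleC: "op_apply T (c *\<^sub>C x) = c *\<^sub>C op_apply T x"
  by transfer simp

lemma bounded_linear_op_apply: "bounded_linear (op_apply T)"
  by transfer simp

lemma op_apply_add: "op_apply T (x + y) = op_apply T x + op_apply T y"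
  by (simp add: bounded_linear.linear bounded_linear_op_apply linear_add)

lemma op_apply_diff: "op_apply T (x - y) = op_apply T x - op_apply T y"
  by (simp add: bounded_linear.linear bounded_linear_op_apply linear_diff)

lemma op_apply_zero [simp]: "op_apply T 0 = 0"
  by (simp add: bounded_linear.linear bounded_linear_op_apply linear_0)

lemma tendsto_op_apply: "(f \<longlongrightarrow> x) F \<Longrightarrow> ((\<lambda>n. op_apply T (f n)) \<longlongrightarrow> op_apply T x) F"
  by (rule bounded_linear.tendsto[OF bounded_linear_op_apply])

lemma op_apply_bound:
  obtains K where "K > 0" "\<And>x. norm (op_apply T x) \<le> K * norm x"
proof -
  obtain K where "K > 0" "\<forall>x. norm (op_apply T x) \<le> norm x * K"
    using bounded_linear.pos_bounded[OF bounded_linear_op_apply[of T]] by blast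
  then show ?thesis
    using that[of K] by (simp add: mult.commute)
qed

lemma bop_of_linear:
  assumes "\<And>x y. f (x + y) = f x + f y" "\<And>c x. f (c *\<^sub>C x) = c *\<^sub>C f x"
    and "\<And>x. norm (f x) \<le> K * norm x"
  obtains T where "op_apply T = (f :: 'h::chilbert_space \<Rightarrow> 'h)"
proof
  have "bounded_linear f"
    by (rule bounded_linear_intro[of _ K]) (auto simp: assms scaleR_scaleC mult.commute)
  then show "op_apply (Abs_bop f) = f"
    using assms(2) by (simp add: Abs_bop_inverse)
qed

text \<open>Riesz is applied to the conjugate of \<open>B x\<close>, which is linear; uniqueness of
  the representing vector makes it depend linearly on x. Adjoints and weak limits of operators are
  both built this way.\<close>

lemma bop_of_sesquilinear:
  fixes B :: "'h::chilbert_space \<Rightarrow> 'h \<Rightarrow> complex"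
  assumes add1: "\<And>x y z. B (x + y) z = B x z + B y z" and scale1: "\<And>c x z. B (c *\<^sub>C x) z = c * B x z"
    and add2: "\<And>x y z. B x (y + z) = B x y + B x z" and scale2: "\<And>c x z. B x (c *\<^sub>C z) = cnj c * B x z"
    and bound: "\<And>x y. cmod (B x y) \<le> K * norm x * norm y"
  obtains T where "\<And>x y. B x y = cinner (op_apply T x) y" "\<And>x. norm (op_apply T x) \<le> K * norm x"
proof -
  have "\<exists>t. \<forall>y. cnj (B x y) = cinner y t" for x
  proof -
    obtain t where "\<And>y. cnj (B x y) = cinner y t"
      by (rule riesz_representation[of "\<lambda>y. cnj (B x y)" "K * norm x"])
        (auto simp: add2 scale2 bound)
    then show ?thesis by blast
  qed
  then obtain t where "\<And>x y. cnj (B x y) = cinner y (t x)"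
    by metis
  then have t: "B x y = cinner (t x) y" for x y
    by (metis cinner_commute complex_cnj_cnj)
  \<comment> \<open>No sign of K is assumed: a negative K contradicts \<open>bound\<close> at the
    pair (x, x) unless x = 0.\<close>
  have tK: "norm (t x) \<le> K * norm x" for x
  proof (cases "t x = 0")
    case True
    then have "0 \<le> K * norm x \<or> x = 0"
      by (metis bound mult_eq_0_iff norm_ge_zero norm_zero order_trans t cinner_zero_left
          less_eq_real_def mult_pos_pos not_less zero_less_norm_iff zero_le_mult_iff)
    then show ?thesis using True by auto
  next
    case False
    have "norm (t x) * norm (t x) \<le> (K * norm x) * norm (t x)"
      using bound[of x "t x"] unfolding t cinner_self norm_of_real by (simp add: power2_eq_square)
    then show ?thesis using False by simp
  qed
  have "t (x + y) = t x + t y" for x y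
    by (rule cinner_left_ext) (simp add: cinner_add_left add1 flip: t)
  moreover have "t (c *\<^sub>C x) = c *\<^sub>C t x" for c x
    by (rule cinner_left_ext) (simp add: cinner_scaleC_left scale1 flip: t)
  ultimately obtain T where "op_apply T = t"
    using bop_of_linear[OF _ _ tK] by blast
  then show ?thesis
    using that t tK by metis
qed

text \<open>Shows that the definite description in \<open>adj\<close> succeeds: the form sending x,
  y to <x, T y> is bounded and sesquilinear, and the operator representing it from the left is the
  adjoint.\<close>

lemma cinner_adj: "cinner (op_apply T x) y = cinner x (op_apply (adj T) y)"
proof -
  obtain K where K: "K > 0" "\<And>x. norm (op_apply T x) \<le> K * norm x"
    using op_apply_bound[of T] by blast
  have bnd: "cmod (cinner x (op_apply T y)) \<le> K * norm x * norm y" for x y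
    using norm_cinner_le[of x "op_apply T y"] mult_left_mono[OF K(2)[of y] norm_ge_zero[of x]]
    by (simp add: algebra_simps)
  obtain S where S: "\<And>x y. cinner x (op_apply T y) = cinner (op_apply S x) y"
    by (rule bop_of_sesquilinear[of "\<lambda>x y. cinner x (op_apply T y)" K])
      (auto simp: cinner_add_left cinner_add_right cinner_scaleC_left cinner_scaleC_right
        op_apply_add op_apply_scaleC bnd)
  have ex: "\<forall>x y. cinner (op_apply T x) y = cinner x (op_apply S y)"
    using S by (metis cinner_commute)
  have "adj T = S"
    unfolding adj_def
  proof (rule the_equality)
    show "S' = S" if "\<forall>x y. cinner (op_apply T x) y = cinner x (op_apply S' y)" for S'
      by (intro bop_eqI cinner_right_ext) (metis ex that)
  qed (rule ex)
  then show ?thesis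
    using ex by simp
qed

lemma cinner_adj_left: "cinner (op_apply (adj T) x) y = cinner x (op_apply T y)"
  by (metis cinner_adj cinner_commute)

lemma adj_eqI: "(\<And>x y. cinner (op_apply T x) y = cinner x (op_apply S y)) \<Longrightarrow> adj T = S"
  by (intro bop_eqI cinner_right_ext) (metis cinner_adj)

lemma adj_adj [simp]: "adj (adj T) = T"
  by (rule adj_eqI) (rule cinner_adj_left)

lemma adj_simps [simp]:
  "adj 0 = 0" "adj 1 = 1" "adj (S + T) = adj S + adj T" "adj (S - T) = adj S - adj T"
  "adj (- T) = - adj T" "adj (S * T) = adj T * adj S" "adj (c *\<^sub>C T) = cnj c *\<^sub>C adj T"
  by (rule adj_eqI; simp add: cinner_add_left cinner_add_right cinner_diff_left cinner_diff_right
      cinner_minus_left cinner_minus_right cinner_scaleC_left cinner_scaleC_right cinner_adj)+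

lemma scaleC_mult_left: "(c *\<^sub>C S) * T = c *\<^sub>C (S * T)" for S :: "'h::chilbert_space bop"
  by (rule bop_eqI) simp

lemma scaleC_mult_right: "S * (c *\<^sub>C T) = c *\<^sub>C (S * T)" for S :: "'h::chilbert_space bop"
  by (rule bop_eqI) (simp add: op_apply_scaleC)

section \<open>Positive operators\<close>

lemma csubspace_closure:
  assumes "csubspace (S :: 'h::chilbert_space set)"
  shows "csubspace (closure S)"
proof -
  note S = csubspaceD[OF assms]
  have "x + y \<in> closure S" if xy: "x \<in> closure S" "y \<in> closure S" for x y
  proof -
    obtain f where "\<forall>n. f n \<in> S" "f \<longlonglongrightarrow> x"
      using xy(1) unfolding closure_sequential by blast
    moreover obtain g where "\<forall>n. g n \<in> S" "g \<longlonglongrightarrow> y"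
      using xy(2) unfolding closure_sequential by blast
    ultimately have "\<forall>n. f n + g n \<in> S" "(\<lambda>n. f n + g n) \<longlonglongrightarrow> x + y"
      by (auto intro: S(2) tendsto_add)
    then show ?thesis unfolding closure_sequential by (intro exI[of _ "\<lambda>n. f n + g n"] conjI)
  qed
  moreover have "c *\<^sub>C x \<in> closure S" if x: "x \<in> closure S" for c x
  proof -
    obtain f where "\<forall>n. f n \<in> S" "f \<longlonglongrightarrow> x"
      using x unfolding closure_sequential by blast
    then have "\<forall>n. c *\<^sub>C f n \<in> S" "(\<lambda>n. c *\<^sub>C f n) \<longlonglongrightarrow> c *\<^sub>C x"
      by (auto intro: S(3) bounded_linear.tendsto[OF bounded_linear_scaleC])
    then show ?thesis unfolding closure_sequential by (intro exI[of _ "\<lambda>n. c *\<^sub>C f n"] conjI)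
  qed
  ultimately show ?thesis
    unfolding csubspace_def using S(1) closure_subset by blast
qed

lemma inner_adj: "inner (op_apply T x) y = inner x (op_apply (adj T) y)"
  by (simp add: inner_eq_Re_cinner cinner_adj)

text \<open>Polarisation: the vectors x + y and x + \<i> y show that the sum and the difference of
  <T x, y> and <T y, x> vanish. Complex scalars are essential; a rotation of the real plane by a
  right angle also has zero form.\<close>

lemma op_eq_0_if_form_0:
  assumes "\<And>x. cinner (op_apply T x) x = 0"
  shows "T = 0"
proof (intro bop_eqI cinner_left_ext)
  fix x y
  have "cinner (op_apply T x) y + cinner (op_apply T y) x = 0"
    using assms[of "x + y"] assms[of x] assms[of y]
    by (simp add: op_apply_add cinner_add_left cinner_add_right add.commute)
  moreover have "\<i> * (cinner (op_apply T y) x - cinner (op_apply T x) y) = 0"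
    using assms[of "x + \<i> *\<^sub>C y"] assms[of x] assms[of y]
    by (simp add: op_apply_add op_apply_scaleC cinner_add_left cinner_add_right cinner_scaleC_left
        cinner_scaleC_right right_diff_distrib)
  ultimately show "cinner (op_apply T x) y = cinner (op_apply 0 x) y"
    by simp
qed

lemma cinner_self_adjoint:
  assumes "adj T = T"
  shows "cinner (op_apply T x) x = of_real (inner (op_apply T x) x)"
proof -
  have "cnj (cinner (op_apply T x) x) = cinner (op_apply T x) x"
    by (metis assms cinner_adj cinner_commute)
  then show ?thesis
    by (simp add: inner_eq_Re_cinner complex_eq_iff)
qed

text \<open>A form with real values forces self-adjointness, since \<open>T - adj T\<close> then has
  vanishing form. The later estimates can therefore use the real inner product.\<close>

lemma positive_op_iff:
  "positive_op T \<longleftrightarrow> adj T = T \<and> (\<forall>x. 0 \<le> inner (op_apply T x) x)"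
proof (intro iffI conjI allI)
  assume T: "positive_op T"
  show "0 \<le> inner (op_apply T x) x" for x
    using T by (simp add: positive_op_def inner_eq_Re_cinner complex_nonneg_Reals_iff)
  have "T - adj T = 0"
  proof (rule op_eq_0_if_form_0)
    fix x
    have "cnj (cinner (op_apply T x) x) = cinner (op_apply T x) x"
      using T by (simp add: positive_op_def complex_nonneg_Reals_iff complex_eq_iff)
    then show "cinner (op_apply (T - adj T) x) x = 0"
      by (simp add: cinner_diff_left cinner_adj_left) (metis cinner_commute)
  qed
  then show "adj T = T" by simp
next
  assume "adj T = T \<and> (\<forall>x. 0 \<le> inner (op_apply T x) x)"
  then show "positive_op T"
    by (simp add: positive_op_def cinner_self_adjoint)
qed

lemma positive_opD:
  assumes "positive_op T"
  shows "adj T = T" "0 \<le> inner (op_apply T x) x"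
  using assms by (auto simp: positive_op_iff)

lemma positive_op_1 [simp]: "positive_op 1"
  by (simp add: positive_op_iff)

lemma positive_op_scaleC: "positive_op T \<Longrightarrow> 0 \<le> r \<Longrightarrow> positive_op (complex_of_real r *\<^sub>C T)"
  by (simp add: positive_op_iff inner_scaleR_left flip: scaleR_scaleC)

lemma positive_op_adj_mult: "positive_op (adj T * T)"
  by (simp add: positive_op_iff) (metis adj_adj inner_adj inner_ge_zero)

lemma positive_op_mult_self: "adj T = T \<Longrightarrow> positive_op (T * T)"
  by (metis positive_op_adj_mult)

lemma positive_op_cauchy_schwarz:
  assumes T: "positive_op T"
  shows "(inner (op_apply T x) y)\<^sup>2 \<le> inner (op_apply T x) x * inner (op_apply T y) y"
proof (rule nonneg_quadratic_discriminant)
  fix t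
  have sym: "inner (op_apply T y) x = inner (op_apply T x) y"
    by (metis T positive_opD(1) inner_adj inner_commute)
  have "0 \<le> inner (op_apply T (x + t *\<^sub>R y)) (x + t *\<^sub>R y)"
    using T by (rule positive_opD)
  also have "\<dots> = inner (op_apply T x) x + 2 * t * inner (op_apply T x) y + t\<^sup>2 * inner (op_apply T y) y"
    by (simp add: scaleR_scaleC op_apply_add op_apply_scaleC)
      (simp add: inner_add_left inner_add_right sym power2_eq_square algebra_simps flip: scaleR_scaleC)
  finally show "0 \<le> \<dots>" .
qed (rule positive_opD(2)[OF T])

text \<open>Cauchy-Schwarz for the form of T, applied to x and y = T x, bounds |y|^4 by <T x, x> <T
  y, y>, hence by |x|^2 |y|^2.\<close>

lemma contraction_if_between_0_1:
  assumes T: "positive_op T" and T1: "positive_op (1 - T)"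
  shows "norm (op_apply T x) \<le> norm x"
proof (cases "op_apply T x = 0")
  case False
  have le: "inner (op_apply T y) y \<le> (norm y)\<^sup>2" for y
    using positive_opD(2)[OF T1, of y] by (simp add: inner_diff_left power2_norm_eq_inner)
  let ?y = "op_apply T x"
  have "((norm ?y)\<^sup>2)\<^sup>2 \<le> inner (op_apply T x) x * inner (op_apply T ?y) ?y"
    using positive_op_cauchy_schwarz[OF T, of x ?y] by (simp add: power2_norm_eq_inner)
  also have "\<dots> \<le> (norm x)\<^sup>2 * (norm ?y)\<^sup>2"
    by (intro mult_mono le positive_opD(2)[OF T]) auto
  finally have "(norm ?y)\<^sup>2 \<le> (norm x)\<^sup>2"
    using False by (simp add: power2_eq_square)
  then show ?thesis
    by (simp add: power2_le_iff_abs_le)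
qed simp

lemma positive_op_1_minus:
  assumes "adj T = T" "\<And>x. norm (op_apply T x) \<le> norm x"
  shows "positive_op (1 - T)"
proof -
  have "inner (op_apply T x) x \<le> inner x x" for x
  proof -
    have "inner (op_apply T x) x \<le> norm (op_apply T x) * norm x"
      by (rule norm_cauchy_schwarz)
    also have "\<dots> \<le> norm x * norm x"
      by (intro mult_right_mono assms) simp
    finally show ?thesis
      by (simp add: power2_norm_eq_inner flip: power2_eq_square)
  qed
  then show ?thesis
    using assms(1) by (simp add: positive_op_iff inner_diff_left)
qed


subsection \<open>Square roots\<close>

text \<open>The iterates are polynomials in z with nonnegative coefficients approximating 1 - sqrt(1
  - z); as polynomials they commute with whatever commutes with z.\<close>

fun sqrt_iter :: "'h::chilbert_space bop \<Rightarrow> nat \<Rightarrow> 'h bop" where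
  "sqrt_iter z 0 = 0"
| "sqrt_iter z (Suc n) = (1/2) *\<^sub>C (z + sqrt_iter z n * sqrt_iter z n)"

fun sqrt_bound :: "nat \<Rightarrow> real" where
  "sqrt_bound 0 = 0"
| "sqrt_bound (Suc n) = (1 + sqrt_bound n * sqrt_bound n) / 2"

lemma sqrt_bound: "0 \<le> sqrt_bound n" "sqrt_bound n \<le> 1" "sqrt_bound n \<le> sqrt_bound (Suc n)"
proof -
  have b: "0 \<le> sqrt_bound n \<and> sqrt_bound n \<le> 1" for n
    by (induction n) (auto simp: mult_le_one)
  then show "0 \<le> sqrt_bound n" "sqrt_bound n \<le> 1" by auto
  show "sqrt_bound n \<le> sqrt_bound (Suc n)"
    using sum_squares_bound[of 1 "sqrt_bound n"] by (simp add: power2_eq_square)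
qed

text \<open>The fixed point equation \<open>y = (z + y\<^sup>2) / 2\<close> says \<open>(1 - y)\<^sup>2 = 1 - z\<close>. The increments of the
  iteration are dominated by those of the same iteration started from the number \<open>z = 1\<close>.\<close>

lemma sqrt_iter_limit:
  fixes z :: "'h::chilbert_space bop"
  assumes z: "\<And>x. norm (op_apply z x) \<le> norm x" "adj z = z"
  obtains Y where "adj Y = Y" "\<And>x. norm (op_apply Y x) \<le> norm x" "2 *\<^sub>C Y = z + Y * Y"
    "\<And>T. T * z = z * T \<Longrightarrow> T * Y = Y * T"
proof -
  let ?y = "sqrt_iter z" and ?s = sqrt_bound
  have bnd: "norm (op_apply (?y n) x) \<le> ?s n * norm x" for n x
  proof (induction n arbitrary: x)
    case (Suc n)
    have "norm (op_apply (?y n) (op_apply (?y n) x)) \<le> ?s n * (?s n * norm x)"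
      using Suc[of x] Suc[of "op_apply (?y n) x"] sqrt_bound(1)[of n]
      by (meson mult_left_mono order_trans)
    then have "norm (op_apply z x + op_apply (?y n) (op_apply (?y n) x)) \<le> norm x + ?s n * (?s n * norm x)"
      using z(1)[of x] norm_triangle_ineq[of "op_apply z x"] by (meson add_mono order_trans)
    then show ?case
      by (simp add: norm_scaleC algebra_simps)
  qed simp
  have "norm (op_apply (?y (Suc n) - ?y n) x) \<le> (?s (Suc n) - ?s n) * norm x" for n x
  proof (induction n arbitrary: x)
    case 0
    show ?case using z(1)[of x] by (simp add: norm_scaleC)
  next
    case (Suc n)
    \<comment> \<open>The order of factors matters: b^2 - a^2 is written as b(b - a) + (b - a)a, so
      that the bounds on the iterates and on the increment can be applied one after the
      other.\<close>
    have half_diff: "(1/2) *\<^sub>C (z + b * b) - (1/2) *\<^sub>C (z + a * a) = (1/2) *\<^sub>C (b * (b - a) + (b - a) * a)"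
      for a b :: "'h bop"
      unfolding scaleC_diff_right[symmetric] by (simp add: algebra_simps)
    have half_diff': "b * ((b - a) * t) + (b - a) * (a * t) = 2 * (((1 + b * b) / 2 - (1 + a * a) / 2) * t)"
      for a b t :: real
      by (simp add: algebra_simps diff_divide_distrib add_divide_distrib)
    let ?D = "?y (Suc n) - ?y n" and ?d = "?s (Suc n) - ?s n"
    have d: "0 \<le> ?d" using sqrt_bound(3)[of n] by simp
    have step: "?y (Suc (Suc n)) - ?y (Suc n) = (1/2) *\<^sub>C (?y (Suc n) * ?D + ?D * ?y n)"
      using half_diff[of "?y (Suc n)" "?y n"] by (simp only: sqrt_iter.simps(2)[symmetric])
    have "norm (op_apply (?y (Suc n)) (op_apply ?D x)) \<le> ?s (Suc n) * (?d * norm x)"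
      using bnd[of "Suc n" "op_apply ?D x"] Suc[of x] sqrt_bound(1)[of "Suc n"]
      by (meson mult_left_mono order_trans)
    moreover have "norm (op_apply ?D (op_apply (?y n) x)) \<le> ?d * (?s n * norm x)"
      using Suc[of "op_apply (?y n) x"] bnd[of n x] d by (meson mult_left_mono order_trans)
    ultimately have "norm (op_apply (?y (Suc n)) (op_apply ?D x) + op_apply ?D (op_apply (?y n) x))
        \<le> ?s (Suc n) * (?d * norm x) + ?d * (?s n * norm x)"
      using norm_triangle_ineq by (meson add_mono order_trans)
    moreover have "op_apply (?y (Suc (Suc n)) - ?y (Suc n)) x
      = (1/2) *\<^sub>C (op_apply (?y (Suc n)) (op_apply ?D x) + op_apply ?D (op_apply (?y n) x))"
      unfolding step by (simp only: op_apply_simps)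
    moreover have "?s (Suc n) * (?d * norm x) + ?d * (?s n * norm x)
      = 2 * ((?s (Suc (Suc n)) - ?s (Suc n)) * norm x)"
      using half_diff'[of "?s (Suc n)" "?s n" "norm x"] by (simp only: sqrt_bound.simps(2)[symmetric])
    ultimately show ?case
      by (simp only: norm_scaleC) simp
  qed
  then have incr: "norm (op_apply (?y (Suc n)) x - op_apply (?y n) x) \<le> (?s (Suc n) - ?s n) * norm x" for n x
    by (simp del: sqrt_iter.simps sqrt_bound.simps)
  have dist: "dist (op_apply (?y m) x) (op_apply (?y n) x) \<le> (?s n - ?s m) * norm x" if "m \<le> n" for m n x
    using that
  proof (induction n rule: dec_induct)
    case (step n)
    have "dist (op_apply (?y m) x) (op_apply (?y (Suc n)) x)
      \<le> dist (op_apply (?y m) x) (op_apply (?y n) x) + dist (op_apply (?y n) x) (op_apply (?y (Suc n)) x)"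
      by (rule dist_triangle)
    also have "\<dots> \<le> (?s n - ?s m) * norm x + (?s (Suc n) - ?s n) * norm x"
      by (intro add_mono step) (subst dist_commute, simp only: dist_norm incr)
    finally show ?case
      by (simp only: flip: distrib_right) (simp del: sqrt_iter.simps sqrt_bound.simps)
  qed simp
  have "incseq ?s"
    by (rule incseq_SucI) (rule sqrt_bound)
  then obtain L where L: "?s \<longlonglongrightarrow> L" "\<And>n. ?s n \<le> L"
    using incseq_convergent[of ?s 1] sqrt_bound(2) by blast
  have "Cauchy (\<lambda>n. op_apply (?y n) x)" for x
  proof (rule Cauchy_if_dist_tendsto_zero)
    show "dist (op_apply (?y m) x) (op_apply (?y n) x) \<le> (L - ?s m) * norm x" if "m \<le> n" for m n
    proof -
      have "(?s n - ?s m) * norm x \<le> (L - ?s m) * norm x"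
        by (intro mult_right_mono) (auto simp: L(2))
      then show ?thesis
        using dist[OF that, of x] by linarith
    qed
    have "(\<lambda>m. (L - ?s m) * norm x) \<longlonglongrightarrow> (L - L) * norm x"
      by (intro tendsto_intros L)
    then show "(\<lambda>m. (L - ?s m) * norm x) \<longlonglongrightarrow> 0" by simp
  qed
  then have "\<exists>l. (\<lambda>n. op_apply (?y n) x) \<longlonglongrightarrow> l" for x
    using Cauchy_convergent_iff convergent_def by blast
  then obtain f where f: "\<And>x. (\<lambda>n. op_apply (?y n) x) \<longlonglongrightarrow> f x"
    by metis
  have bnd1: "norm (op_apply (?y n) x) \<le> norm x" for n x
    using bnd[of n x] sqrt_bound[of n] by (meson mult_left_le_one_le norm_ge_zero order_trans)
  obtain Y where Y: "op_apply Y = f"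
  proof (rule bop_of_linear[of f 1])
    show "f (x + y) = f x + f y" for x y
      using LIMSEQ_unique[OF f[of "x + y"]] tendsto_add[OF f[of x] f[of y]] by (simp add: op_apply_add)
    show "f (c *\<^sub>C x) = c *\<^sub>C f x" for c x
      using LIMSEQ_unique[OF f[of "c *\<^sub>C x"]] bounded_linear.tendsto[OF bounded_linear_scaleC f[of x]]
      by (simp add: op_apply_scaleC)
    show "norm (f x) \<le> 1 * norm x" for x
      by (rule LIMSEQ_le_const2[OF tendsto_norm[OF f]]) (auto simp: bnd1)
  qed
  have lim: "(\<lambda>n. op_apply (?y n) x) \<longlonglongrightarrow> op_apply Y x" for x
    using f Y by simp
  show ?thesis
  proof
    have sa: "adj (?y n) = ?y n" for n
      by (induction n) (auto simp: z(2))
    have "(\<lambda>n. cinner (op_apply (?y n) x) y) \<longlonglongrightarrow> cinner (op_apply Y x) y" for x y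
      by (intro tendsto_cinner lim tendsto_const)
    moreover have "(\<lambda>n. cinner (op_apply (?y n) x) y) \<longlonglongrightarrow> cinner x (op_apply Y y)" for x y
      unfolding cinner_adj sa by (intro tendsto_cinner lim tendsto_const)
    ultimately show "adj Y = Y"
      by (intro adj_eqI) (metis LIMSEQ_unique)
    show "norm (op_apply Y x) \<le> norm x" for x
      by (rule LIMSEQ_le_const2[OF tendsto_norm[OF lim]]) (auto simp: bnd1)
    show "T * Y = Y * T" if T: "T * z = z * T" for T
    proof (rule bop_eqI)
      fix x
      have "T * ?y n = ?y n * T" for n
      proof (induction n)
        case (Suc n)
        then have "T * (?y n * ?y n) = (?y n * ?y n) * T"
          by (metis mult.assoc)
        then show ?case
          by (simp add: scaleC_mult_left scaleC_mult_right distrib_left distrib_right T)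
      qed simp
      then have "op_apply T (op_apply (?y n) x) = op_apply (?y n) (op_apply T x)" for n
        by (metis op_apply_simps(6))
      then have "(\<lambda>n. op_apply (?y n) (op_apply T x)) \<longlonglongrightarrow> op_apply T (op_apply Y x)"
        using tendsto_op_apply[OF lim[of x], of T] by simp
      then show "op_apply (T * Y) x = op_apply (Y * T) x"
        using LIMSEQ_unique[OF lim] by simp
    qed
    show "2 *\<^sub>C Y = z + Y * Y"
    proof (rule bop_eqI)
      fix x
      \<comment> \<open>Squares converge strongly because the iterates are uniformly contractive:
        applying the n-th iterate to a null sequence gives a null sequence.\<close>
      have "(\<lambda>n. op_apply (?y n) (op_apply (?y n) x - op_apply Y x)) \<longlonglongrightarrow> 0"
      proof (rule Lim_null_comparison[OF always_eventually])
        show "(\<lambda>n. norm (op_apply (?y n) x - op_apply Y x)) \<longlonglongrightarrow> 0"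
          using lim[of x] by (simp add: LIM_zero_iff tendsto_norm_zero_iff)
      qed (simp add: bnd1)
      then have "(\<lambda>n. op_apply (?y n) (op_apply (?y n) x - op_apply Y x)
          + op_apply (?y n) (op_apply Y x)) \<longlonglongrightarrow> 0 + op_apply Y (op_apply Y x)"
        by (intro tendsto_add lim)
      then have sq: "(\<lambda>n. op_apply (?y n) (op_apply (?y n) x)) \<longlonglongrightarrow> op_apply Y (op_apply Y x)"
        by (simp add: op_apply_diff)
      have "(\<lambda>n. 2 *\<^sub>C op_apply (?y (Suc n)) x) \<longlonglongrightarrow> op_apply (z + Y * Y) x"
        using tendsto_add[OF tendsto_const sq, of "op_apply z x"] by (simp add: scaleC_scaleC scaleC_one)
      moreover have "(\<lambda>n. 2 *\<^sub>C op_apply (?y (Suc n)) x) \<longlonglongrightarrow> 2 *\<^sub>C op_apply Y x"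
        by (intro bounded_linear.tendsto[OF bounded_linear_scaleC] LIMSEQ_Suc lim)
      ultimately show "op_apply (2 *\<^sub>C Y) x = op_apply (z + Y * Y) x"
        using LIMSEQ_unique by simp
    qed
  qed
qed

text \<open>Rescaling by a bound of a gives 0 \<le> a1 \<le> 1, and the iteration with z = 1 - a1
  yields (1 - Y)^2 = a1. The commutation clause is what later places the root in every von Neumann
  algebra containing a.\<close>

theorem positive_op_sqrt:
  fixes a :: "'h::chilbert_space bop"
  assumes a: "positive_op a"
  obtains b where "positive_op b" "b * b = a" "\<And>T. T * a = a * T \<Longrightarrow> T * b = b * T"
proof -
  obtain K where K: "K > 0" "\<And>x. norm (op_apply a x) \<le> K * norm x"
    using op_apply_bound[of a] by blast
  define a1 where "a1 = complex_of_real (inverse K) *\<^sub>C a"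
  have a1: "positive_op a1"
    unfolding a1_def using a K(1) by (intro positive_op_scaleC) auto
  have "positive_op (1 - a1)"
  proof (rule positive_op_1_minus)
    show "norm (op_apply a1 x) \<le> norm x" for x
      using K(2)[of x] K(1) unfolding a1_def op_apply_simps norm_scaleC norm_of_real
      by (simp add: field_simps)
  qed (rule positive_opD(1)[OF a1])
  then have contr: "norm (op_apply (1 - a1) x) \<le> norm x" for x
    by (rule contraction_if_between_0_1) (simp add: a1)
  have sa: "adj (1 - a1) = 1 - a1"
    by (simp add: positive_opD(1)[OF a1])
  obtain Y where Y: "adj Y = Y" "\<And>x. norm (op_apply Y x) \<le> norm x" "2 *\<^sub>C Y = (1 - a1) + Y * Y"
    "\<And>T. T * (1 - a1) = (1 - a1) * T \<Longrightarrow> T * Y = Y * T"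
    by (rule sqrt_iter_limit[OF contr sa]) (rule that)
  have "Y + Y = 2 *\<^sub>C Y"
    using scaleC_add_left[of 1 1 Y] by (simp add: scaleC_one)
  then have sq: "(1 - Y) * (1 - Y) = a1"
    using Y(3) by (simp add: algebra_simps)
  let ?b = "complex_of_real (sqrt K) *\<^sub>C (1 - Y)"
  show ?thesis
  proof
    show "positive_op ?b"
      using Y(1,2) K(1) by (intro positive_op_scaleC positive_op_1_minus) auto
    have "?b * ?b = complex_of_real (sqrt K * sqrt K) *\<^sub>C a1"
      by (simp only: scaleC_mult_left scaleC_mult_right scaleC_scaleC sq of_real_mult)
    then show "?b * ?b = a"
      using K(1) by (simp add: a1_def scaleC_scaleC scaleC_one flip: of_real_mult)
    show "T * ?b = ?b * T" if "T * a = a * T" for T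
    proof -
      have "T * Y = Y * T"
        by (rule Y(4)) (simp add: a1_def algebra_simps scaleC_mult_left scaleC_mult_right that)
      then show ?thesis
        by (simp add: algebra_simps scaleC_mult_left scaleC_mult_right)
    qed
  qed
qed


subsection \<open>Positive and negative parts\<close>

text \<open>On the closure of the range of \<open>b\<close> the operator \<open>c = b + a\<close> is positive because
  \<open>2 b c b = c b c\<close>, and on the kernel of \<open>b\<close> it vanishes.\<close>

lemma positive_op_abs_add:
  fixes a b :: "'h::chilbert_space bop"
  assumes b: "positive_op b" and a: "adj a = a" and sq: "b * b = a * a" and com: "a * b = b * a"
  shows "positive_op (b + a)"
proof -
  define c where "c = b + a"
  have badj: "adj b = b" using b by (rule positive_opD)
  have cadj: "adj c = c" by (simp add: c_def badj a)
  \<comment> \<open>Both b^2 = a^2 and ab = ba enter: c^2 = b^2 + 2ab + a^2 = 2b(b + a).\<close>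
  have cc: "c * c = 2 *\<^sub>C (b * c)"
    using scaleC_add_left[of 1 1 "b * c"] by (simp add: scaleC_one c_def algebra_simps sq com)
  have cb: "c * b = b * c"
    by (simp add: c_def algebra_simps com)
  have range_pos: "0 \<le> inner (op_apply c (op_apply b v)) (op_apply b v)" for v
  proof -
    have "2 *\<^sub>C (b * c * b) = c * b * c"
      by (metis cb cc mult.assoc scaleC_mult_left)
    then have "2 *\<^sub>C op_apply b (op_apply c (op_apply b v)) = op_apply c (op_apply b (op_apply c v))"
      by (metis op_apply_simps(6,7))
    then have "2 * cinner (op_apply b (op_apply c (op_apply b v))) v
      = cinner (op_apply c (op_apply b (op_apply c v))) v"
      by (metis cinner_scaleC_left)
    then have "2 * inner (op_apply c (op_apply b v)) (op_apply b v)
      = inner (op_apply b (op_apply c v)) (op_apply c v)"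
      by (simp add: inner_eq_Re_cinner cinner_adj badj cadj complex_eq_iff)
    then show ?thesis
      using positive_opD(2)[OF b, of "op_apply c v"] by simp
  qed
  define S where "S = closure (range (op_apply b))"
  have "csubspace (range (op_apply b))"
    unfolding csubspace_def
    by (auto simp flip: op_apply_add op_apply_scaleC intro: range_eqI[of _ _ 0])
  then have S: "csubspace S"
    unfolding S_def by (rule csubspace_closure)
  have S_pos: "0 \<le> inner (op_apply c y) y" if yS: "y \<in> S" for y
  proof -
    obtain s where s: "\<And>n. s n \<in> range (op_apply b)" "s \<longlonglongrightarrow> y"
      using yS unfolding S_def closure_sequential by blast
    have "(\<lambda>n. inner (op_apply c (s n)) (s n)) \<longlonglongrightarrow> inner (op_apply c y) y"
      by (intro tendsto_inner tendsto_op_apply s)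
    moreover have "0 \<le> inner (op_apply c (s n)) (s n)" for n
      using s(1)[of n] range_pos by auto
    ultimately show ?thesis
      by (meson LIMSEQ_le_const)
  qed
  have "0 \<le> inner (op_apply c x) x" for x
  proof -
    obtain y where y: "y \<in> S" "\<And>z. z \<in> S \<Longrightarrow> cinner (x - y) z = 0"
      using hilbert_projection[OF S, where x = x] S_def by auto
    define v where "v = x - y"
    have "cinner (op_apply b v) w = 0" for w
      using y(2)[of "op_apply b w"] closure_subset[of "range (op_apply b)"]
      by (auto simp: cinner_adj badj v_def S_def)
    then have bv: "op_apply b v = 0"
      using cinner_left_ext[of "op_apply b v" 0] by simp
    \<comment> \<open>On the kernel of b also a vanishes: |a v|^2 = <v, a a v> = <v, b b v> =
      0.\<close>
    have "cinner (op_apply a v) (op_apply a v) = cinner v (op_apply (a * a) v)"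
      by (simp add: cinner_adj a)
    then have "cinner (op_apply a v) (op_apply a v) = 0"
      by (simp add: bv flip: sq)
    then have "op_apply a v = 0"
      by (simp add: cinner_self)
    then have cv: "op_apply c v = 0"
      by (simp add: c_def bv)
    have x: "x = y + v" by (simp add: v_def)
    have "inner (op_apply c x) x = inner (op_apply c y) y + inner (op_apply c y) v"
      unfolding x by (simp add: op_apply_add cv inner_add_left inner_add_right)
    also have "inner (op_apply c y) v = 0"
      by (metis cadj cv inner_adj inner_zero_right)
    finally show ?thesis
      using S_pos[OF y(1)] by simp
  qed
  then show ?thesis
    by (simp add: positive_op_iff cadj flip: c_def)
qed

text \<open>For y = w x the part u contributes nothing to <(w - u) y, y>, so <w y, y> \<le> |y|^2.
  Cauchy-Schwarz for w then gives |y|^2 \<le> <y, x>, and w is a contraction.\<close>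

lemma positive_part_le_1:
  assumes w: "positive_op w" and wu: "w * u = 0" and le: "positive_op (1 - (w - u))"
  shows "positive_op (1 - w)"
proof -
  have wadj: "adj w = w" using w by (rule positive_opD)
  have bound: "norm (op_apply w x) \<le> norm x" for x
  proof (cases "op_apply w x = 0")
    case False
    let ?y = "op_apply w x"
    let ?A = "inner (op_apply w ?y) ?y" and ?B = "(norm ?y)\<^sup>2" and ?D = "inner ?y x"
    have "op_apply w (op_apply u ?y) = 0"
      using wu by (metis op_apply_simps(1,6))
    then have "inner (op_apply u ?y) ?y = 0"
      by (metis inner_adj inner_commute inner_zero_left wadj)
    then have A: "?A \<le> ?B"
      using positive_opD(2)[OF le, of ?y] by (simp add: inner_diff_left power2_norm_eq_inner)
    have "inner (op_apply w x) ?y = ?B"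
      by (simp add: power2_norm_eq_inner)
    then have "?B\<^sup>2 \<le> ?D * ?A"
      using positive_op_cauchy_schwarz[OF w, of x ?y] by simp
    also have "\<dots> \<le> ?D * ?B"
      by (intro mult_left_mono A positive_opD(2)[OF w])
    finally have "?B \<le> ?D"
      using False by (simp add: power2_eq_square)
    also have "?D \<le> norm ?y * norm x"
      by (rule norm_cauchy_schwarz)
    finally show ?thesis
      using False by (simp add: power2_eq_square)
  qed simp
  show ?thesis
    by (rule positive_op_1_minus[OF wadj bound])
qed


section \<open>Von Neumann algebras\<close>

lemma subalgebraD:
  assumes "subalgebra A"
  shows "0 \<in> A" "a \<in> A \<Longrightarrow> b \<in> A \<Longrightarrow> a + b \<in> A" "a \<in> A \<Longrightarrow> b \<in> A \<Longrightarrow> a * b \<in> A"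
    "a \<in> A \<Longrightarrow> c *\<^sub>C a \<in> A" "a \<in> A \<Longrightarrow> - a \<in> A" "a \<in> A \<Longrightarrow> b \<in> A \<Longrightarrow> a - b \<in> A"
proof -
  have "csubspace A"
    using assms unfolding csubspace_def subalgebra_def by auto
  note S = csubspaceD[OF this]
  show "0 \<in> A" "a \<in> A \<Longrightarrow> b \<in> A \<Longrightarrow> a + b \<in> A" "a \<in> A \<Longrightarrow> c *\<^sub>C a \<in> A"
    "a \<in> A \<Longrightarrow> - a \<in> A" "a \<in> A \<Longrightarrow> b \<in> A \<Longrightarrow> a - b \<in> A"
    by (fact S)+
  show "a \<in> A \<Longrightarrow> b \<in> A \<Longrightarrow> a * b \<in> A"
    using assms by (simp add: subalgebra_def)
qed

lemma von_neumann_algebraD: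
  assumes "von_neumann_algebra M"
  shows "subalgebra M" "1 \<in> M" "a \<in> M \<Longrightarrow> adj a \<in> M"
    "0 \<in> M" "a \<in> M \<Longrightarrow> b \<in> M \<Longrightarrow> a + b \<in> M" "a \<in> M \<Longrightarrow> b \<in> M \<Longrightarrow> a * b \<in> M"
    "a \<in> M \<Longrightarrow> c *\<^sub>C a \<in> M" "a \<in> M \<Longrightarrow> - a \<in> M" "a \<in> M \<Longrightarrow> b \<in> M \<Longrightarrow> a - b \<in> M"
proof -
  show sub: "subalgebra M"
    using assms unfolding von_neumann_algebra_def by auto
  show "1 \<in> M" "a \<in> M \<Longrightarrow> adj a \<in> M"
    using assms unfolding von_neumann_algebra_def by auto
  show "0 \<in> M" "a \<in> M \<Longrightarrow> b \<in> M \<Longrightarrow> a + b \<in> M" "a \<in> M \<Longrightarrow> b \<in> M \<Longrightarrow> a * b \<in> M"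
    "a \<in> M \<Longrightarrow> c *\<^sub>C a \<in> M" "a \<in> M \<Longrightarrow> - a \<in> M" "a \<in> M \<Longrightarrow> b \<in> M \<Longrightarrow> a - b \<in> M"
    by (fact subalgebraD[OF sub])+
qed

lemma von_neumann_algebra_memI:
  assumes "von_neumann_algebra M" "\<And>s. s \<in> commutant M \<Longrightarrow> s * T = T * s"
  shows "T \<in> M"
proof -
  have "T \<in> commutant (commutant M)"
    using assms(2) by (simp add: commutant_def)
  then show ?thesis
    using assms(1) by (simp add: von_neumann_algebra_def)
qed

lemma commutant_antimono: "S \<subseteq> T \<Longrightarrow> commutant T \<subseteq> commutant S"
  unfolding commutant_def by blast

lemma subset_bicommutant: "S \<subseteq> commutant (commutant S)"
  unfolding commutant_def by auto

lemma adj_commutant: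
  assumes "\<And>s. s \<in> S \<Longrightarrow> adj s \<in> S" "T \<in> commutant S"
  shows "adj T \<in> commutant S"
proof -
  have "s * adj T = adj T * s" if "s \<in> S" for s
  proof -
    have "adj (adj s * T) = adj (T * adj s)"
      using assms that unfolding commutant_def by force
    then show ?thesis by simp
  qed
  then show ?thesis by (simp add: commutant_def)
qed

lemma von_neumann_algebra_commutant:
  assumes "\<And>s. s \<in> S \<Longrightarrow> adj s \<in> S"
  shows "von_neumann_algebra (commutant S)"
  unfolding von_neumann_algebra_def
proof (intro conjI ballI)
  show "subalgebra (commutant S)"
    unfolding subalgebra_def
  proof (intro conjI ballI allI)
    fix a b c assume a: "a \<in> commutant S" and b: "b \<in> commutant S"
    have com: "s * a = a * s" "s * b = b * s" if "s \<in> S" for s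
      using a b that by (auto simp: commutant_def)
    have "s * (a * b) = (a * b) * s" if "s \<in> S" for s
      using com[OF that] by (metis mult.assoc)
    then show "a * b \<in> commutant S"
      by (simp add: commutant_def)
    show "a + b \<in> commutant S"
      by (simp add: commutant_def com distrib_left distrib_right)
    show "c *\<^sub>C a \<in> commutant S"
      by (simp add: commutant_def com scaleC_mult_left scaleC_mult_right)
  qed (simp add: commutant_def)
  show "1 \<in> commutant S"
    by (simp add: commutant_def)
  show "adj a \<in> commutant S" if "a \<in> commutant S" for a
    using assms that by (rule adj_commutant)
  show "commutant (commutant (commutant S)) = commutant S"
    by (intro equalityI commutant_antimono[OF subset_bicommutant[of S]] subset_bicommutant[of "commutant S"])
qed

lemma von_neumann_algebra_Inter:
  assumes "\<And>M. M \<in> F \<Longrightarrow> von_neumann_algebra M"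
  shows "von_neumann_algebra (\<Inter>F)"
  unfolding von_neumann_algebra_def
proof (intro conjI ballI)
  note V = von_neumann_algebraD[OF assms]
  show "subalgebra (\<Inter>F)"
    unfolding subalgebra_def by (auto intro: V(4-7))
  show "1 \<in> \<Inter>F" "\<And>a. a \<in> \<Inter>F \<Longrightarrow> adj a \<in> \<Inter>F"
    by (auto intro: V(2,3))
  have "commutant (commutant (\<Inter>F)) \<subseteq> M" if "M \<in> F" for M
  proof -
    have "commutant (commutant (\<Inter>F)) \<subseteq> commutant (commutant M)"
      using that by (intro commutant_antimono) blast
    then show ?thesis
      using assms[OF that] by (simp add: von_neumann_algebra_def)
  qed
  then show "commutant (commutant (\<Inter>F)) = \<Inter>F"
    by (intro equalityI subset_bicommutant Inter_greatest)
qed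

lemma von_neumann_algebra_vn_gen: "von_neumann_algebra (vn_gen S)"
  unfolding vn_gen_def hull_def by (rule von_neumann_algebra_Inter) auto

lemma vn_gen_superset: "S \<subseteq> vn_gen S"
  unfolding vn_gen_def by (rule hull_subset)

lemma vn_gen_minimal: "S \<subseteq> M \<Longrightarrow> von_neumann_algebra M \<Longrightarrow> vn_gen S \<subseteq> M"
  unfolding vn_gen_def by (rule hull_minimal)

lemma vn_gen_eq: "von_neumann_algebra M \<Longrightarrow> vn_gen M = M"
  by (intro equalityI vn_gen_minimal vn_gen_superset order_refl)

lemma von_neumann_sqrt:
  assumes M: "von_neumann_algebra M" and a: "positive_op a" "a \<in> M"
  obtains b where "positive_op b" "b \<in> M" "b * b = a" "\<And>T. T * a = a * T \<Longrightarrow> T * b = b * T"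
proof -
  obtain b where b: "positive_op b" "b * b = a" "\<And>T. T * a = a * T \<Longrightarrow> T * b = b * T"
    by (rule positive_op_sqrt[OF a(1)]) (rule that)
  have "s * b = b * s" if s: "s \<in> commutant M" for s
    using s a(2) by (intro b(3)) (simp add: commutant_def)
  then have "b \<in> M"
    by (rule von_neumann_algebra_memI[OF M])
  from that[OF b(1) this b(2)] b(3) show ?thesis by simp
qed

text \<open>\<open>b\<close> is the modulus of a, the root of a^2. The parts are half of b + a and
  half of b - a; their products vanish because b^2 = a^2 and b commutes with a.\<close>

lemma von_neumann_parts:
  assumes M: "von_neumann_algebra M" and a: "adj a = a" "a \<in> M"
  obtains w u where "positive_op w" "positive_op u" "w \<in> M" "u \<in> M" "a = w - u" "w * u = 0" "u * w = 0"
proof -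
  note V = von_neumann_algebraD[OF M]
  obtain b where b: "positive_op b" "b \<in> M" "b * b = a * a" "\<And>T. T * (a * a) = (a * a) * T \<Longrightarrow> T * b = b * T"
    by (rule von_neumann_sqrt[OF M positive_op_mult_self[OF a(1)] V(6)[OF a(2) a(2)]]) (rule that)
  have com: "a * b = b * a"
    by (rule b(4)) (simp add: mult.assoc)
  let ?w = "complex_of_real (1/2) *\<^sub>C (b + a)" and ?u = "complex_of_real (1/2) *\<^sub>C (b + - a)"
  show ?thesis
  proof
    show "positive_op ?w"
      by (intro positive_op_scaleC positive_op_abs_add) (auto simp: a b com)
    show "positive_op ?u"
      by (intro positive_op_scaleC positive_op_abs_add) (auto simp: a b com)
    show "?w \<in> M" "?u \<in> M"
      by (intro V a b)+
    have "complex_of_real (1/2) *\<^sub>C (a + a) = a"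
      using scaleC_add_left[of "1/2" "1/2" a] by (simp add: scaleC_add_right scaleC_one)
    moreover have "a + a = (b + a) - (b + - a)"
      by simp
    ultimately show "a = ?w - ?u"
      by (simp only: scaleC_diff_right)
    have "(b + a) * (b + - a) = (b * b - a * a) + (a * b - b * a)"
      "(b + - a) * (b + a) = (b * b - a * a) - (a * b - b * a)"
      by (simp_all add: algebra_simps)
    then have "(b + a) * (b + - a) = 0" "(b + - a) * (b + a) = 0"
      by (simp_all only: com b(3)) simp_all
    then show "?w * ?u = 0" "?u * ?w = 0"
      by (simp_all only: scaleC_mult_left scaleC_mult_right scaleC_zero_right)
  qed
qed

lemma von_neumann_re_im:
  assumes M: "von_neumann_algebra M" and x: "x \<in> M"
  obtains h k where "h \<in> M" "k \<in> M" "adj h = h" "adj k = k" "x = h + \<i> *\<^sub>C k"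
proof
  note V = von_neumann_algebraD[OF M]
  let ?h = "(1/2) *\<^sub>C (x + adj x)" and ?k = "(\<i>/2) *\<^sub>C (adj x - x)"
  show "?h \<in> M" "?k \<in> M" "adj ?h = ?h" "adj ?k = ?k"
    by (auto simp: V x add.commute scaleC_minus_left simp flip: scaleC_minus_right)
  have "(1/2) *\<^sub>C x + (1/2) *\<^sub>C x = x"
    using scaleC_add_left[of "1/2" "1/2" x] by (simp add: scaleC_one)
  then show "x = ?h + \<i> *\<^sub>C ?k"
    by (simp add: scaleC_scaleC scaleC_add_right scaleC_diff_right scaleC_minus_left algebra_simps)
qed


section \<open>Weak compactness and normal functionals\<close>

text \<open>Tychonoff: the form of a contraction is a point of a product of closed discs. The
  Hilbert space may be nonseparable, so the cluster point is reached along a filter finer than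
  \<open>sequentially\<close> rather than along a subsequence.\<close>

lemma weak_cluster_operator:
  fixes t :: "nat \<Rightarrow> 'h::chilbert_space bop"
  assumes t: "\<And>n x. norm (op_apply (t n) x) \<le> norm x"
  shows "\<exists>G T. G \<noteq> bot \<and> G \<le> sequentially \<and> (\<forall>x. norm (op_apply T x) \<le> norm x) \<and>
    (\<forall>x y. ((\<lambda>n. cinner (op_apply (t n) x) y) \<longlongrightarrow> cinner (op_apply T x) y) G)"
proof -
  define f where "f n z = cinner (op_apply (t n) (fst z)) (snd z)" for n and z :: "'h \<times> 'h"
  define U where "U = Pi\<^sub>E UNIV (\<lambda>z::'h \<times> 'h. cball (0::complex) (norm (fst z) * norm (snd z)))"
  have "compactin (product_topology (\<lambda>z. euclidean) UNIV) U"
    unfolding U_def compactin_PiE by simp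
  then have "compact U"
    by (simp add: euclidean_product_topology)
  moreover have fU: "f n \<in> U" for n
    unfolding U_def f_def
    by (auto intro!: order_trans[OF norm_cinner_le] mult_right_mono t)
  ultimately obtain l where l: "l \<in> U" "inf (nhds l) (filtermap f sequentially) \<noteq> bot"
    unfolding compact_filter
    by (metis (no_types, lifting) always_eventually eventually_filtermap filtermap_bot_iff
        sequentially_bot)
  define G where "G = inf (filtercomap f (nhds l)) sequentially"
  have G: "G \<noteq> bot"
  proof
    assume "G = bot"
    then have "eventually (\<lambda>_. False) G" by simp
    then obtain P Q where PQ: "eventually P (filtercomap f (nhds l))" "eventually Q sequentially"
      "\<And>n. P n \<Longrightarrow> Q n \<Longrightarrow> False"
      unfolding G_def eventually_inf by auto
    obtain P' where P': "eventually P' (nhds l)" "\<And>n. P' (f n) \<Longrightarrow> P n"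
      using PQ(1) unfolding eventually_filtercomap by auto
    have "eventually (\<lambda>z. \<exists>n. z = f n \<and> Q n) (filtermap f sequentially)"
      unfolding eventually_filtermap using PQ(2) by (rule eventually_mono) auto
    with P'(1) have "eventually (\<lambda>_. False) (inf (nhds l) (filtermap f sequentially))"
      unfolding eventually_inf using PQ(3) P'(2) by blast
    then show False
      using l(2) by simp
  qed
  have "filterlim f (nhds l) G"
    unfolding G_def by (meson filterlim_filtercomap filterlim_mono inf.cobounded1 order_refl)
  then have lim: "((\<lambda>n. f n z) \<longlongrightarrow> l z) G" for z
  proof (intro topological_tendstoI)
    fix S assume fl: "filterlim f (nhds l) G" and S: "open S" "l z \<in> S"
    have "open ((\<lambda>g::'h \<times> 'h \<Rightarrow> complex. g z) -` S)"
      using S(1) by (intro open_vimage continuous_on_product_coordinates)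
    then have "eventually (\<lambda>g. g z \<in> S) (nhds l)"
      using S(2) unfolding eventually_nhds by (intro exI[of _ "(\<lambda>g. g z) -` S"]) auto
    then show "eventually (\<lambda>n. f n z \<in> S) G"
      using fl by (rule eventually_compose_filterlim)
  qed
  have lim': "((\<lambda>n. cinner (op_apply (t n) x) y) \<longlongrightarrow> l (x, y)) G" for x y
    using lim[of "(x, y)"] by (simp add: f_def)
  \<comment> \<open>Limits along the proper filter G are unique, so every algebraic identity of the
    forms passes to \<open>l\<close>.\<close>
  have uniq: "((\<lambda>n. cinner (op_apply (t n) x) y) \<longlongrightarrow> c) G \<Longrightarrow> l (x, y) = c" for x y c
    using lim' G tendsto_unique by blast
  obtain T where T: "\<And>x y. l (x, y) = cinner (op_apply T x) y" "\<And>x. norm (op_apply T x) \<le> 1 * norm x"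
  proof (rule bop_of_sesquilinear[of "\<lambda>x y. l (x, y)" 1])
    show "l (x + y, z) = l (x, z) + l (y, z)" for x y z
      by (rule uniq) (simp add: op_apply_add cinner_add_left tendsto_add lim')
    show "l (x, y + z) = l (x, y) + l (x, z)" for x y z
      by (rule uniq) (simp add: cinner_add_right tendsto_add lim')
    show "l (c *\<^sub>C x, z) = c * l (x, z)" for c x z
      by (rule uniq) (simp add: op_apply_scaleC cinner_scaleC_left tendsto_mult_left lim')
    show "l (x, c *\<^sub>C z) = cnj c * l (x, z)" for c x z
      by (rule uniq) (simp add: cinner_scaleC_right tendsto_mult_left lim')
    show "cmod (l (x, y)) \<le> 1 * norm x * norm y" for x y
      using l(1) unfolding U_def PiE_iff by auto
  qed (rule that)
  show ?thesis
  proof (intro exI conjI allI)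
    show "G \<le> sequentially" by (simp add: G_def)
    show "norm (op_apply T x) \<le> norm x" for x
      using T(2)[of x] by simp
    show "((\<lambda>n. cinner (op_apply (t n) x) y) \<longlongrightarrow> cinner (op_apply T x) y) G" for x y
      using lim'[of x y] by (simp add: T)
  qed (rule G)
qed

lemma summable_norm_mult:
  fixes \<xi> \<eta> :: "nat \<Rightarrow> 'h::real_normed_vector"
  assumes "summable (\<lambda>n. (norm (\<xi> n))\<^sup>2)" "summable (\<lambda>n. (norm (\<eta> n))\<^sup>2)"
  shows "summable (\<lambda>n. norm (\<xi> n) * norm (\<eta> n))"
proof (rule summable_comparison_test')
  show "summable (\<lambda>n. (norm (\<xi> n))\<^sup>2 + (norm (\<eta> n))\<^sup>2)"
    by (intro summable_add assms)
  show "norm (norm (\<xi> n) * norm (\<eta> n)) \<le> (norm (\<xi> n))\<^sup>2 + (norm (\<eta> n))\<^sup>2" if "n \<ge> 0" for n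
  proof -
    have "2 * norm (\<xi> n) * norm (\<eta> n) \<le> (norm (\<xi> n))\<^sup>2 + (norm (\<eta> n))\<^sup>2"
      by (rule sum_squares_bound)
    moreover have "0 \<le> norm (\<xi> n) * norm (\<eta> n)" by simp
    ultimately have "norm (\<xi> n) * norm (\<eta> n) \<le> (norm (\<xi> n))\<^sup>2 + (norm (\<eta> n))\<^sup>2"
      unfolding mult.assoc by linarith
    then show ?thesis by (simp add: abs_mult)
  qed
qed

abbreviation ultraweak_subbasis :: "'h::chilbert_space bop set set" where
  "ultraweak_subbasis \<equiv> {{T. suminf (\<lambda>n. cinner (op_apply T (\<xi> n)) (\<eta> n)) \<in> U} | \<xi> \<eta> U.
        summable (\<lambda>n::nat. (norm (\<xi> n))\<^sup>2) \<and> summable (\<lambda>n. (norm (\<eta> n))\<^sup>2) \<and> open U}"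

text \<open>On bounded sets the ultraweak topology is the weak operator topology.\<close>

lemma eventually_ultraweak:
  fixes t :: "nat \<Rightarrow> 'h::chilbert_space bop"
  assumes G: "G \<noteq> bot" and bound: "\<And>n x. norm (op_apply (t n) x) \<le> K * norm x"
    and lim: "\<And>x y. ((\<lambda>n. cinner (op_apply (t n) x) y) \<longlongrightarrow> cinner (op_apply T x) y) G"
    and V: "openin ultraweak_topology V" "T \<in> V"
  shows "eventually (\<lambda>n. t n \<in> V) G"
proof -
  have "generate_topology_on ultraweak_subbasis V"
    using V(1) by (simp add: ultraweak_topology_def openin_topology_generated_by_iff)
  then show ?thesis
    using V(2)
  proof (induction rule: generate_topology_on.induct)
    case (Int a b)
    then show ?case by (simp add: eventually_conj)
  next
    case (UN \<K>)
    then obtain k where k: "k \<in> \<K>" "T \<in> k" by auto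
    show ?case
      by (rule eventually_mono[OF UN.IH[OF k]]) (use k in auto)
  next
    case (Basis s)
    then obtain \<xi> \<eta> U where s: "s = {T. suminf (\<lambda>n. cinner (op_apply T (\<xi> n)) (\<eta> n)) \<in> U}"
      and sm: "summable (\<lambda>n::nat. (norm (\<xi> n))\<^sup>2)" "summable (\<lambda>n. (norm (\<eta> n))\<^sup>2)" and U: "open U"
      by blast
    have "((\<lambda>n. suminf (\<lambda>k. cinner (op_apply (t n) (\<xi> k)) (\<eta> k))) \<longlongrightarrow> suminf (\<lambda>k. cinner (op_apply T (\<xi> k)) (\<eta> k))) G"
    \<comment> \<open>Tannery's theorem exchanges limit and series; the uniform bound K on the
      operators provides the summable majorant.\<close>
    proof (rule tannerys_theorem[THEN conjunct2, THEN conjunct2])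
      show "summable (\<lambda>k. K * (norm (\<xi> k) * norm (\<eta> k)))"
        by (intro summable_mult summable_norm_mult sm)
      have "norm (cinner (op_apply (t n) (\<xi> k)) (\<eta> k)) \<le> K * (norm (\<xi> k) * norm (\<eta> k))" for n k
        using order_trans[OF norm_cinner_le mult_right_mono[OF bound norm_ge_zero]]
        by (simp add: mult.assoc)
      then show "\<forall>\<^sub>F (k, n) in sequentially \<times>\<^sub>F G.
          norm (cinner (op_apply (t n) (\<xi> k)) (\<eta> k)) \<le> K * (norm (\<xi> k) * norm (\<eta> k))"
        by (intro always_eventually) auto
    qed (auto simp: G intro: lim)
    moreover have "suminf (\<lambda>k. cinner (op_apply T (\<xi> k)) (\<eta> k)) \<in> U"
      using Basis.prems by (simp add: s)
    ultimately have "\<forall>\<^sub>F n in G. suminf (\<lambda>k. cinner (op_apply (t n) (\<xi> k)) (\<eta> k)) \<in> U"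
      using U topological_tendstoD by blast
    then show ?case by (simp add: s)
  qed simp
qed

lemma topspace_ultraweak [simp]: "topspace ultraweak_topology = (UNIV :: 'h::chilbert_space bop set)"
proof -
  have "(UNIV :: 'h bop set) = {T. suminf (\<lambda>n. cinner (op_apply T ((\<lambda>_::nat. 0) n)) ((\<lambda>_. 0) n)) \<in> UNIV}"
    by simp
  then have "(UNIV :: 'h bop set) \<in> ultraweak_subbasis"
    by (intro CollectI exI[of _ "\<lambda>_. 0"] exI[of _ UNIV]) simp
  then show ?thesis
    unfolding ultraweak_topology_def topology_generated_by_topspace
    by (intro equalityI subset_UNIV Union_upper)
qed


section \<open>The trace\<close>

locale tracial_von_neumann_algebra =
  fixes M :: "'h::chilbert_space bop set" and \<tau> :: "'h bop \<Rightarrow> complex"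
  assumes vna: "von_neumann_algebra M" and trace: "faithful_normal_trace_state M \<tau>"
begin

lemmas M = von_neumann_algebraD[OF vna]

lemma tau_add: "a \<in> M \<Longrightarrow> b \<in> M \<Longrightarrow> \<tau> (a + b) = \<tau> a + \<tau> b"
  and tau_scale: "a \<in> M \<Longrightarrow> \<tau> (c *\<^sub>C a) = c * \<tau> a"
  and tau_comm: "a \<in> M \<Longrightarrow> b \<in> M \<Longrightarrow> \<tau> (a * b) = \<tau> (b * a)"
  and tau_adj_mult: "a \<in> M \<Longrightarrow> \<tau> (adj a * a) \<in> \<real>\<^sub>\<ge>\<^sub>0"
  and tau_faithful: "a \<in> M \<Longrightarrow> \<tau> (adj a * a) = 0 \<Longrightarrow> a = 0"
  and tau_continuous: "continuous_map (subtopology ultraweak_topology M) euclidean \<tau>"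
  using trace unfolding faithful_normal_trace_state_def linear_on_def by auto

lemma tau_minus: "a \<in> M \<Longrightarrow> \<tau> (- a) = - \<tau> a"
  using tau_scale[of a "- 1"] by (simp add: scaleC_minus_one)

lemma tau_diff: "a \<in> M \<Longrightarrow> b \<in> M \<Longrightarrow> \<tau> (a - b) = \<tau> a - \<tau> b"
  using tau_add[of a "- b"] by (simp add: tau_minus M)

lemma tau_0: "\<tau> 0 = 0"
  using tau_add[of 0 0] by (simp add: M)

lemma tau_open_preimage:
  assumes "open U"
  obtains V where "openin ultraweak_topology V" "\<And>x. x \<in> M \<Longrightarrow> x \<in> V \<longleftrightarrow> \<tau> x \<in> U"
proof -
  have "openin (subtopology ultraweak_topology M) {x \<in> M. \<tau> x \<in> U}"
    using tau_continuous assms unfolding continuous_map_def by simp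
  then obtain V where "openin ultraweak_topology V" "{x \<in> M. \<tau> x \<in> U} = V \<inter> M"
    unfolding openin_subtopology by blast
  then show ?thesis
    using that[of V] by blast
qed

lemma tau_tendsto:
  assumes "G \<noteq> bot" "\<And>n x. norm (op_apply (t n) x) \<le> K * norm x"
    and "\<And>x y. ((\<lambda>n. cinner (op_apply (t n) x) y) \<longlongrightarrow> cinner (op_apply T x) y) G"
    and t: "\<And>n. t n \<in> M" and T: "T \<in> M"
  shows "((\<lambda>n::nat. \<tau> (t n)) \<longlongrightarrow> \<tau> T) G"
proof (rule topological_tendstoI)
  fix U assume "open U" "\<tau> T \<in> U"
  then obtain V where V: "openin ultraweak_topology V" "\<And>x. x \<in> M \<Longrightarrow> x \<in> V \<longleftrightarrow> \<tau> x \<in> U"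
    using tau_open_preimage by blast
  have "eventually (\<lambda>n. t n \<in> V) G"
    using V(2)[OF T] \<open>\<tau> T \<in> U\<close> by (intro eventually_ultraweak[OF assms(1-3) V(1)]) auto
  then show "eventually (\<lambda>n. \<tau> (t n) \<in> U) G"
    by (simp add: V(2) t)
qed

text \<open>A product of positive operators need not be positive, but with x = s s and y = w w
  cyclicity turns its trace into that of \<open>adj (s * w) * (s * w)\<close>.\<close>

lemma tau_positive_mult:
  assumes x: "positive_op x" "x \<in> M" and y: "positive_op y" "y \<in> M"
  shows "\<tau> (x * y) \<in> \<real>\<^sub>\<ge>\<^sub>0"
proof -
  obtain s where s: "positive_op s" "s \<in> M" "s * s = x"
    using von_neumann_sqrt[OF vna x] by metis
  obtain w where w: "positive_op w" "w \<in> M" "w * w = y"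
    using von_neumann_sqrt[OF vna y] by metis
  have "\<tau> (x * y) = \<tau> ((s * s * w) * w)"
    by (simp add: mult.assoc flip: s(3) w(3))
  also have "\<dots> = \<tau> (w * (s * s * w))"
    by (intro tau_comm M s w)
  also have "w * (s * s * w) = adj (s * w) * (s * w)"
    by (simp add: positive_opD(1)[OF s(1)] positive_opD(1)[OF w(1)] mult.assoc)
  finally show ?thesis
    using tau_adj_mult[of "s * w"] by (simp add: M s w)
qed

lemma tau_positive: "positive_op x \<Longrightarrow> x \<in> M \<Longrightarrow> \<tau> x \<in> \<real>\<^sub>\<ge>\<^sub>0"
  using tau_positive_mult[of x 1] by (simp add: M)

lemma tau_self_adjoint:
  assumes "adj x = x" "x \<in> M"
  shows "Im (\<tau> x) = 0"
proof -
  obtain w u where "positive_op w" "positive_op u" "w \<in> M" "u \<in> M" "x = w - u"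
    using von_neumann_parts[OF vna assms] by metis
  then show ?thesis
    using tau_positive[of w] tau_positive[of u] by (simp add: tau_diff complex_nonneg_Reals_iff)
qed

lemma tau_adj:
  assumes "x \<in> M"
  shows "\<tau> (adj x) = cnj (\<tau> x)"
proof -
  have "Im (\<tau> (x + adj x)) = 0"
    by (rule tau_self_adjoint) (auto simp: M assms add.commute)
  moreover have "Im (\<tau> (\<i> *\<^sub>C (x - adj x))) = 0"
    by (rule tau_self_adjoint) (auto simp: M assms scaleC_minus_left simp flip: scaleC_minus_right)
  ultimately show ?thesis
    by (simp add: tau_add tau_scale tau_diff M assms complex_eq_iff)
qed

text \<open>Testing against the adjoint of x - y, which lies in N, shows that x - y has 2-norm zero;
  faithfulness concludes.\<close>

lemma tau_separates:
  assumes N: "von_neumann_algebra N" "N \<subseteq> M" and "x \<in> N" "y \<in> N"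
    and eq: "\<And>z. z \<in> N \<Longrightarrow> \<tau> (x * z) = \<tau> (y * z)"
  shows "x = y"
proof -
  note V = von_neumann_algebraD[OF N(1)]
  have d: "x - y \<in> N" "adj (x - y) \<in> N"
    by (intro V assms)+
  have "\<tau> (adj (x - y) * (x - y)) = \<tau> ((x - y) * adj (x - y))"
    using d N(2) by (intro tau_comm) auto
  also have "\<dots> = \<tau> (x * adj (x - y) - y * adj (x - y))"
    by (simp only: left_diff_distrib)
  also have "\<dots> = 0"
    using d assms N(2) by (subst tau_diff) (auto intro!: M eq simp del: adj_simps)
  finally have "x - y = 0"
    using d N(2) by (intro tau_faithful) auto
  then show ?thesis by simp
qed


section \<open>Existence of the conditional expectation\<close>

text \<open>For \<open>0 \<le> x \<le> 1\<close> the expectation onto \<open>N\<close> is the nearest point of \<open>N\<close> in the \<open>2\<close>-norm. Truncating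
  the spectrum to \<open>[0, 1]\<close> does not increase the distance to \<open>x\<close>, so a minimizing sequence may be
  taken bounded in operator norm, and then it has a weak limit point inside \<open>N\<close>.\<close>

definition sqdist :: "'h bop \<Rightarrow> 'h bop \<Rightarrow> real" where
  "sqdist x a = Re (\<tau> ((x - a) * (x - a)))"

lemma sqdist_nonneg: "x \<in> M \<Longrightarrow> a \<in> M \<Longrightarrow> adj x = x \<Longrightarrow> adj a = a \<Longrightarrow> 0 \<le> sqdist x a"
  unfolding sqdist_def using tau_adj_mult[of "x - a"] by (simp add: M complex_nonneg_Reals_iff)

text \<open>Passing from w to w - u adds \<tau>(x u), \<tau>(u x) and \<tau>(u u), all nonnegative
  since x and u are positive; the mixed terms of w and u vanish.\<close>

lemma sqdist_positive_part:
  assumes x: "positive_op x" "x \<in> M" and w: "w \<in> M" and u: "positive_op u" "u \<in> M"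
    and wu: "w * u = 0" "u * w = 0"
  shows "sqdist x w \<le> sqdist x (w - u)"
proof -
  have "(x - (w - u)) * (x - (w - u)) = (x - w) * (x - w) + (x * u + u * x + u * u)"
    using wu by (simp add: algebra_simps)
  then have "\<tau> ((x - (w - u)) * (x - (w - u))) = \<tau> ((x - w) * (x - w)) + (\<tau> (x * u) + \<tau> (u * x) + \<tau> (u * u))"
    by (simp add: tau_add M x w u)
  then show ?thesis
    using tau_positive_mult[OF x u] tau_positive_mult[OF u x] tau_positive_mult[OF u u]
    by (simp add: sqdist_def complex_nonneg_Reals_iff)
qed

lemma sqdist_reflect: "sqdist (1 - x) (1 - a) = sqdist x a"
  unfolding sqdist_def by (simp add: algebra_simps)

text \<open>Reflection in 1 turns the lower cut-off into the upper one: the positive part w of 1 - a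
  makes 1 - w at most 1, and the positive part \<open>w2\<close> of 1 - w is the truncation of a to
  [0, 1]. Neither cut increases the distance.\<close>

lemma sqdist_truncate:
  assumes N: "von_neumann_algebra N" "N \<subseteq> M" and x: "positive_op x" "positive_op (1 - x)" "x \<in> M"
    and a: "adj a = a" "a \<in> N"
  shows "\<exists>t\<in>N. positive_op t \<and> positive_op (1 - t) \<and> sqdist x t \<le> sqdist x a"
proof -
  note V = von_neumann_algebraD[OF N(1)]
  obtain w u where wu: "positive_op w" "positive_op u" "w \<in> N" "u \<in> N" "1 - a = w - u" "w * u = 0" "u * w = 0"
    by (rule von_neumann_parts[OF N(1), of "1 - a"]) (auto simp: V a)
  have 1: "sqdist x (1 - w) \<le> sqdist x a"
  proof -
    have "sqdist (1 - x) w \<le> sqdist (1 - x) (w - u)"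
      using x wu N(2) by (intro sqdist_positive_part) (auto simp: M)
    then show ?thesis
      using sqdist_reflect[of x "1 - w"] sqdist_reflect[of x a] wu(5) by simp
  qed
  have sa: "adj (1 - w) = 1 - w"
    by (simp add: positive_opD(1)[OF wu(1)])
  obtain w2 u2 where w2: "positive_op w2" "positive_op u2" "w2 \<in> N" "u2 \<in> N" "1 - w = w2 - u2"
    "w2 * u2 = 0" "u2 * w2 = 0"
    by (rule von_neumann_parts[OF N(1) sa]) (auto simp: V wu(3))
  have "sqdist x w2 \<le> sqdist x (w2 - u2)"
    using x w2 N(2) by (intro sqdist_positive_part) auto
  moreover have "positive_op (1 - w2)"
    by (rule positive_part_le_1[OF w2(1) w2(6)]) (simp add: wu(1) flip: w2(5))
  ultimately show ?thesis
    using 1 w2(1,3,5) by (metis order_trans)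
qed

text \<open>First variation at an approximate minimiser: the squared distance from x to t + s y,
  minus d, is a nonnegative quadratic in s, so its discriminant controls the pairing of x - t with y
  by the excess of t over d.\<close>

lemma sqdist_variation:
  assumes N: "von_neumann_algebra N" "N \<subseteq> M" and x: "x \<in> M"
    and t: "t \<in> N" "adj t = t" and y: "y \<in> N" "adj y = y"
    and min: "\<And>a. a \<in> N \<Longrightarrow> adj a = a \<Longrightarrow> d \<le> sqdist x a"
  shows "(Re (\<tau> ((x - t) * y)))\<^sup>2 \<le> (sqdist x t - d) * Re (\<tau> (y * y))"
proof -
  note V = von_neumann_algebraD[OF N(1)]
  have M': "t \<in> M" "y \<in> M" using t y N(2) by auto
  have "(- Re (\<tau> ((x - t) * y)))\<^sup>2 \<le> (sqdist x t - d) * Re (\<tau> (y * y))"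
  proof (rule nonneg_quadratic_discriminant)
    fix s :: real
    let ?c = "complex_of_real s"
    let ?g = "x - t"
    have "d \<le> sqdist x (t + ?c *\<^sub>C y)"
      by (rule min) (auto simp: V t y)
    also have "(x - (t + ?c *\<^sub>C y)) * (x - (t + ?c *\<^sub>C y))
        = ?g * ?g - ?c *\<^sub>C (?g * y) - ?c *\<^sub>C (y * ?g) + (?c * ?c) *\<^sub>C (y * y)"
    proof -
      have "(g - b) * (g - b) = g * g - g * b - b * g + b * b" for g b :: "'h bop"
        by (simp add: algebra_simps)
      from this[of ?g "?c *\<^sub>C y"] show ?thesis
        by (simp only: diff_diff_eq scaleC_mult_left scaleC_mult_right scaleC_scaleC)
    qed
    then have "sqdist x (t + ?c *\<^sub>C y) = sqdist x t - 2 * s * Re (\<tau> (?g * y)) + s\<^sup>2 * Re (\<tau> (y * y))"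
      unfolding sqdist_def using tau_comm[of y ?g]
      by (simp add: tau_add tau_diff tau_scale M M' x power2_eq_square)
    finally show "0 \<le> sqdist x t - d + 2 * s * - Re (\<tau> (?g * y)) + s\<^sup>2 * Re (\<tau> (y * y))"
      by simp
    show "0 \<le> Re (\<tau> (y * y))"
      using tau_adj_mult[of y] by (simp add: y M' complex_nonneg_Reals_iff)
  qed
  then show ?thesis by simp
qed

lemma cond_exp_exists_contraction:
  assumes N: "von_neumann_algebra N" "N \<subseteq> M" and x: "positive_op x" "positive_op (1 - x)" "x \<in> M"
  shows "\<exists>e\<in>N. positive_op e \<and> (\<forall>y\<in>N. \<tau> (e * y) = \<tau> (x * y))"
proof -
  note V = von_neumann_algebraD[OF N(1)]
  have xadj: "adj x = x" using x(1) by (rule positive_opD)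
  define S where "S = {a \<in> N. adj a = a}"
  define d where "d = (INF a\<in>S. sqdist x a)"
  have S0: "0 \<in> S" by (simp add: S_def V)
  have bdd: "bdd_below (sqdist x ` S)"
    using N(2) by (intro bdd_belowI[of _ 0]) (auto simp: S_def x xadj intro!: sqdist_nonneg)
  have min: "d \<le> sqdist x a" if "a \<in> N" "adj a = a" for a
    unfolding d_def using that by (intro cINF_lower[OF bdd]) (simp add: S_def)
  have "\<exists>t. t \<in> N \<and> positive_op t \<and> positive_op (1 - t) \<and> sqdist x t < d + inverse (real (Suc n))" for n
  proof -
    have "\<exists>a\<in>S. sqdist x a < d + inverse (real (Suc n))"
    proof (rule ccontr)
      assume "\<not> ?thesis"
      then have "d + inverse (real (Suc n)) \<le> d"
        using S0 unfolding d_def by (intro cINF_greatest) (auto simp: not_less)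
      then show False by simp
    qed
    then show ?thesis
      using sqdist_truncate[OF N x] unfolding S_def by (smt (verit) mem_Collect_eq)
  qed
  then obtain t where tN: "\<And>n. t n \<in> N" and t: "\<And>n. positive_op (t n)" "\<And>n. positive_op (1 - t n)"
    and td: "\<And>n. sqdist x (t n) < d + inverse (real (Suc n))"
    by metis
  have contr: "norm (op_apply (t n) v) \<le> norm v" for n v
    by (rule contraction_if_between_0_1[OF t])
  \<comment> \<open>The limit point e is not identified as a minimiser; only its pairing with N is
    computed, by passing to the limit along G.\<close>
  obtain G e where G: "G \<noteq> bot" "G \<le> sequentially"
    and lim: "\<And>v w. ((\<lambda>n. cinner (op_apply (t n) v) w) \<longlongrightarrow> cinner (op_apply e v) w) G"
    using weak_cluster_operator[of t, OF contr] by metis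
  \<comment> \<open>Commuting with the commutant of N is a weakly closed condition.\<close>
  have eN: "e \<in> N"
  proof (rule von_neumann_algebra_memI[OF N(1)])
    fix s assume s: "s \<in> commutant N"
    show "s * e = e * s"
    proof (intro bop_eqI cinner_left_ext)
      fix v w
      have "t n * s = s * t n" for n
        using s tN[of n] by (simp add: commutant_def)
      then have ts: "op_apply s (op_apply (t n) v) = op_apply (t n) (op_apply s v)" for n
        by (metis op_apply_simps(6))
      have "((\<lambda>n. cinner (op_apply (t n) (op_apply s v)) w) \<longlongrightarrow> cinner (op_apply s (op_apply e v)) w) G"
        using lim[of v "op_apply (adj s) w"] by (simp add: ts flip: cinner_adj)
      then show "cinner (op_apply (s * e) v) w = cinner (op_apply (e * s) v) w"
        using tendsto_unique[OF G(1) _ lim] by simp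
    qed
  qed
  have epos: "positive_op e"
    unfolding positive_op_def
  proof
    fix v
    show "cinner (op_apply e v) v \<in> \<real>\<^sub>\<ge>\<^sub>0"
      using t(1) by (intro Lim_in_closed_set[OF closed_nonneg_Reals_complex _ G(1) lim] always_eventually)
        (simp add: positive_op_def)
  qed
  have sa: "\<tau> (e * y) = \<tau> (x * y)" if y: "y \<in> N" "adj y = y" for y
  proof -
    obtain K where K: "K > 0" "\<And>v. norm (op_apply y v) \<le> K * norm v"
      using op_apply_bound[of y] by blast
    have te: "((\<lambda>n. \<tau> (t n * y)) \<longlongrightarrow> \<tau> (e * y)) G"
    proof (rule tau_tendsto[OF G(1)])
      show "norm (op_apply (t n * y) v) \<le> K * norm v" for n v
        using contr[of n "op_apply y v"] K(2)[of v] by simp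
      show "t n * y \<in> M" "e * y \<in> M" for n
        using tN eN y N(2) by (auto intro!: M)
    qed (simp add: lim)
    have "(\<lambda>n. (Re (\<tau> ((x - t n) * y)))\<^sup>2) \<longlonglongrightarrow> 0"
    proof (rule Lim_null_comparison[OF always_eventually])
      have c: "0 \<le> Re (\<tau> (y * y))"
        using tau_adj_mult[of y] y N(2) by (auto simp: complex_nonneg_Reals_iff)
      show "\<forall>n. norm ((Re (\<tau> ((x - t n) * y)))\<^sup>2) \<le> inverse (real (Suc n)) * Re (\<tau> (y * y))"
      proof
        fix n
        have "(Re (\<tau> ((x - t n) * y)))\<^sup>2 \<le> (sqdist x (t n) - d) * Re (\<tau> (y * y))"
          by (rule sqdist_variation[OF N x(3) tN positive_opD(1)[OF t(1)] y min])
        also have "\<dots> \<le> inverse (real (Suc n)) * Re (\<tau> (y * y))"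
          using td[of n] by (intro mult_right_mono c) simp
        finally show "norm ((Re (\<tau> ((x - t n) * y)))\<^sup>2) \<le> inverse (real (Suc n)) * Re (\<tau> (y * y))"
          by simp
      qed
      show "(\<lambda>n. inverse (real (Suc n)) * Re (\<tau> (y * y))) \<longlonglongrightarrow> 0"
        by (rule tendsto_mult_left_zero[OF LIMSEQ_inverse_real_of_nat])
    qed
    then have "(\<lambda>n. Re (\<tau> ((x - t n) * y))) \<longlonglongrightarrow> 0"
      using tendsto_real_sqrt[of "\<lambda>n. (Re (\<tau> ((x - t n) * y)))\<^sup>2" 0 sequentially]
      by (simp add: tendsto_rabs_zero_iff)
    then have "((\<lambda>n. Re (\<tau> ((x - t n) * y))) \<longlongrightarrow> 0) G"
      using G(2) tendsto_mono by blast
    moreover have "\<tau> ((x - t n) * y) = \<tau> (x * y) - \<tau> (t n * y)" for n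
      using tN y N(2) x(3) by (simp add: left_diff_distrib tau_diff M subset_iff)
    ultimately have "((\<lambda>n. Re (\<tau> (x * y)) - Re (\<tau> (t n * y))) \<longlongrightarrow> 0) G"
      by simp
    moreover have "((\<lambda>n. Re (\<tau> (x * y)) - Re (\<tau> (t n * y))) \<longlongrightarrow> Re (\<tau> (x * y)) - Re (\<tau> (e * y))) G"
      by (intro tendsto_intros te)
    ultimately have Re: "Re (\<tau> (e * y)) = Re (\<tau> (x * y))"
      using tendsto_unique[OF G(1)] by fastforce
    \<comment> \<open>The variation controls real parts only. The trace of a product of two
      self-adjoint elements is real by cyclicity, so this determines the pairing.\<close>
    have real: "Im (\<tau> (g * y)) = 0" if g: "g \<in> M" "adj g = g" for g
    proof -
      have "y \<in> M" using y(1) N(2) by auto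
      then have "cnj (\<tau> (g * y)) = \<tau> (g * y)"
        using tau_adj[of "g * y"] tau_comm[of y g] by (simp add: g y M)
      then show ?thesis by (simp add: complex_eq_iff)
    qed
    show ?thesis
      using Re real[of e] real[of x] eN N(2) positive_opD(1)[OF epos] xadj x(3)
      by (auto simp: complex_eq_iff)
  qed
  have "\<tau> (e * y) = \<tau> (x * y)" if y: "y \<in> N" for y
  proof -
    obtain h k where hk: "h \<in> N" "k \<in> N" "adj h = h" "adj k = k" "y = h + \<i> *\<^sub>C k"
      using von_neumann_re_im[OF N(1) y] by metis
    have "\<tau> (g * y) = \<tau> (g * h) + \<i> * \<tau> (g * k)" if "g \<in> M" for g
    proof -
      have "h \<in> M" "k \<in> M" using hk(1,2) N(2) by auto
      then show ?thesis
        using that by (simp add: hk(5) distrib_left scaleC_mult_right tau_add tau_scale M)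
    qed
    then show ?thesis
      using sa[OF hk(1,3)] sa[OF hk(2,4)] eN x(3) N(2) by auto
  qed
  then show ?thesis
    using eN epos by blast
qed


lemma cond_exp_exists_positive:
  assumes N: "von_neumann_algebra N" "N \<subseteq> M" and x: "positive_op x" "x \<in> M"
  shows "\<exists>e\<in>N. positive_op e \<and> (\<forall>y\<in>N. \<tau> (e * y) = \<tau> (x * y))"
proof -
  obtain K where K: "K > 0" "\<And>v. norm (op_apply x v) \<le> K * norm v"
    using op_apply_bound[of x] by blast
  let ?k = "complex_of_real (inverse K)" and ?K = "complex_of_real K"
  have pos: "positive_op (?k *\<^sub>C x)"
    using K(1) x(1) by (intro positive_op_scaleC) auto
  have "positive_op (1 - ?k *\<^sub>C x)"
  proof (rule positive_op_1_minus[OF positive_opD(1)[OF pos]])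
    show "norm (op_apply (?k *\<^sub>C x) v) \<le> norm v" for v
      using K(2)[of v] K(1) unfolding op_apply_simps norm_scaleC norm_of_real
      by (simp add: field_simps)
  qed
  then obtain e where e: "e \<in> N" "positive_op e" "\<And>y. y \<in> N \<Longrightarrow> \<tau> (e * y) = \<tau> ((?k *\<^sub>C x) * y)"
    using cond_exp_exists_contraction[OF N pos] M(7)[OF x(2)] by meson
  have "\<tau> ((?K *\<^sub>C e) * y) = \<tau> (x * y)" if y: "y \<in> N" for y
  proof -
    have m: "e \<in> M" "y \<in> M" using e(1) y N(2) by auto
    have "\<tau> ((?K *\<^sub>C e) * y) = ?K * (?k * \<tau> (x * y))"
      using e(3)[OF y] m x(2) by (simp only: scaleC_mult_left tau_scale M)
    then show ?thesis
      using K(1) by simp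
  qed
  moreover have "?K *\<^sub>C e \<in> N" "positive_op (?K *\<^sub>C e)"
    using K(1) e(1,2) von_neumann_algebraD(7)[OF N(1)] by (auto intro!: positive_op_scaleC)
  ultimately show ?thesis by blast
qed

lemma cond_exp_exists:
  assumes N: "von_neumann_algebra N" "N \<subseteq> M" and x: "x \<in> M"
  shows "\<exists>e\<in>N. \<forall>y\<in>N. \<tau> (e * y) = \<tau> (x * y)"
proof -
  note V = von_neumann_algebraD[OF N(1)]
  have sa: "\<exists>e\<in>N. \<forall>y\<in>N. \<tau> (e * y) = \<tau> (h * y)" if h: "adj h = h" "h \<in> M" for h
  proof -
    obtain w u where wu: "positive_op w" "positive_op u" "w \<in> M" "u \<in> M" "h = w - u"
      using von_neumann_parts[OF vna h] by metis
    obtain e where e: "e \<in> N" "\<forall>y\<in>N. \<tau> (e * y) = \<tau> (w * y)"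
      using cond_exp_exists_positive[OF N wu(1,3)] by auto
    obtain f where f: "f \<in> N" "\<forall>y\<in>N. \<tau> (f * y) = \<tau> (u * y)"
      using cond_exp_exists_positive[OF N wu(2,4)] by auto
    have "\<tau> ((e - f) * y) = \<tau> (h * y)" if y: "y \<in> N" for y
    proof -
      have "y \<in> M" "e \<in> M" "f \<in> M" using y e(1) f(1) N(2) by auto
      then show ?thesis
        using e(2) f(2) y wu(3,4) by (simp add: wu(5) left_diff_distrib tau_diff M)
    qed
    then show ?thesis
      using V(9)[OF e(1) f(1)] by blast
  qed
  obtain h k where hk: "h \<in> M" "k \<in> M" "adj h = h" "adj k = k" "x = h + \<i> *\<^sub>C k"
    using von_neumann_re_im[OF vna x] by metis
  obtain e where e: "e \<in> N" "\<forall>y\<in>N. \<tau> (e * y) = \<tau> (h * y)"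
    using sa[OF hk(3,1)] by blast
  obtain f where f: "f \<in> N" "\<forall>y\<in>N. \<tau> (f * y) = \<tau> (k * y)"
    using sa[OF hk(4,2)] by blast
  have split: "\<tau> ((a + \<i> *\<^sub>C b) * y) = \<tau> (a * y) + \<i> * \<tau> (b * y)" if "a \<in> M" "b \<in> M" "y \<in> M" for a b y
    using that by (simp add: distrib_right scaleC_mult_left tau_add tau_scale M)
  have "\<tau> ((e + \<i> *\<^sub>C f) * y) = \<tau> (x * y)" if y: "y \<in> N" for y
  proof -
    have m: "y \<in> M" "e \<in> M" "f \<in> M" using y e(1) f(1) N(2) by auto
    have "\<tau> (x * y) = \<tau> (h * y) + \<i> * \<tau> (k * y)"
      using split[OF hk(1,2) m(1)] hk(5) by simp
    then show ?thesis
      using split[OF m(2,3,1)] e(2) f(2) y by metis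
  qed
  moreover have "e + \<i> *\<^sub>C f \<in> N"
    by (intro V e f)
  ultimately show ?thesis by blast
qed

section \<open>The expectation as a bimodule map: uniqueness and existence\<close>

lemma trace_preserving_cond_expD:
  assumes E: "trace_preserving_cond_exp M \<tau> N E" and N: "von_neumann_algebra N" "N \<subseteq> M"
  shows "x \<in> M \<Longrightarrow> E x \<in> N" "y \<in> N \<Longrightarrow> E y = y"
    "x \<in> M \<Longrightarrow> y \<in> M \<Longrightarrow> E (x + y) = E x + E y" "x \<in> M \<Longrightarrow> E (c *\<^sub>C x) = c *\<^sub>C E x"
    "x \<in> M \<Longrightarrow> y \<in> N \<Longrightarrow> z \<in> N \<Longrightarrow> E (y * x * z) = y * E x * z"
    "x \<in> M \<Longrightarrow> y \<in> N \<Longrightarrow> E (y * x) = y * E x" "x \<in> M \<Longrightarrow> y \<in> N \<Longrightarrow> E (x * y) = E x * y"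
    "x \<in> M \<Longrightarrow> \<tau> (E x) = \<tau> x" "x \<in> M \<Longrightarrow> y \<in> N \<Longrightarrow> \<tau> (E x * y) = \<tau> (x * y)"
proof -
  show "x \<in> M \<Longrightarrow> E x \<in> N" "y \<in> N \<Longrightarrow> E y = y"
    "x \<in> M \<Longrightarrow> y \<in> M \<Longrightarrow> E (x + y) = E x + E y" "x \<in> M \<Longrightarrow> E (c *\<^sub>C x) = c *\<^sub>C E x"
    using E unfolding trace_preserving_cond_exp_def linear_map_on_def by auto
  show bimod: "x \<in> M \<Longrightarrow> y \<in> N \<Longrightarrow> z \<in> N \<Longrightarrow> E (y * x * z) = y * E x * z" for x y z
    using E unfolding trace_preserving_cond_exp_def by auto
  show "x \<in> M \<Longrightarrow> y \<in> N \<Longrightarrow> E (y * x) = y * E x"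
    using bimod[of x y 1] von_neumann_algebraD(2)[OF N(1)] by simp
  show right: "x \<in> M \<Longrightarrow> y \<in> N \<Longrightarrow> E (x * y) = E x * y"
    using bimod[of x 1 y] von_neumann_algebraD(2)[OF N(1)] by simp
  show tau: "x \<in> M \<Longrightarrow> \<tau> (E x) = \<tau> x" for x
    using E unfolding trace_preserving_cond_exp_def by auto
  show "x \<in> M \<Longrightarrow> y \<in> N \<Longrightarrow> \<tau> (E x * y) = \<tau> (x * y)"
    using tau[of "x * y"] right N(2) M(6) by (simp add: subset_iff)
qed

lemma trace_preserving_cond_exp_unique:
  assumes N: "von_neumann_algebra N" "N \<subseteq> M"
    and E: "trace_preserving_cond_exp M \<tau> N E" and F: "trace_preserving_cond_exp M \<tau> N F" and x: "x \<in> M"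
  shows "E x = F x"
  using trace_preserving_cond_expD[OF E N] trace_preserving_cond_expD[OF F N] x
  by (intro tau_separates[OF N]) auto

text \<open>E x is the unique element of N with the same pairings against N as x. Linearity and the
  bimodule property follow by comparing pairings; positivity holds because the element constructed
  for a positive x is itself positive.\<close>

lemma trace_preserving_cond_exp_exists:
  assumes N: "von_neumann_algebra N" "N \<subseteq> M"
  shows "\<exists>E \<in> extensional M. trace_preserving_cond_exp M \<tau> N E"
proof -
  note V = von_neumann_algebraD[OF N(1)]
  have NM: "y \<in> M" if "y \<in> N" for y using that N(2) by auto
  have "\<forall>x\<in>M. \<exists>e. e \<in> N \<and> (\<forall>y\<in>N. \<tau> (e * y) = \<tau> (x * y))"
    using cond_exp_exists[OF N] by blast
  then obtain F where F: "\<forall>x\<in>M. F x \<in> N \<and> (\<forall>y\<in>N. \<tau> (F x * y) = \<tau> (x * y))"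
    by (rule bchoice[THEN exE])
  define E where "E = restrict F M"
  have EN: "E x \<in> N" and tau: "y \<in> N \<Longrightarrow> \<tau> (E x * y) = \<tau> (x * y)" if "x \<in> M" for x y
    using F that by (auto simp: E_def)
  have uniq: "E x = e" if "x \<in> M" "e \<in> N" "\<And>y. y \<in> N \<Longrightarrow> \<tau> (e * y) = \<tau> (x * y)" for x e
    by (rule tau_separates[OF N]) (auto simp: EN tau that)
  have "trace_preserving_cond_exp M \<tau> N E"
    unfolding trace_preserving_cond_exp_def linear_map_on_def
  proof (intro conjI ballI allI impI)
    show "E \<in> M \<rightarrow> N" using EN by auto
    show "E (a + b) = E a + E b" if "a \<in> M" "b \<in> M" for a b
      by (rule uniq) (use that in \<open>simp_all add: M V EN distrib_right tau_add NM tau\<close>)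
    show "E (c *\<^sub>C a) = c *\<^sub>C E a" if "a \<in> M" for a c
      by (rule uniq) (use that in \<open>simp_all add: M V EN scaleC_mult_left tau_scale NM tau\<close>)
    show "positive_op (E x)" if x: "x \<in> M" "positive_op x" for x
    proof -
      obtain e where "e \<in> N" "positive_op e" "\<And>y. y \<in> N \<Longrightarrow> \<tau> (e * y) = \<tau> (x * y)"
        using cond_exp_exists_positive[OF N x(2,1)] by meson
      then show ?thesis using uniq[OF x(1)] by metis
    qed
    show "E y = y" if "y \<in> N" for y
      using that by (intro uniq) (auto simp: NM)
    show "E (y * x * z) = y * E x * z" if xyz: "x \<in> M" "y \<in> N" "z \<in> N" for x y z
    proof (rule uniq)
      fix v assume v: "v \<in> N"
      have m: "x \<in> M" "y \<in> M" "z \<in> M" "v \<in> M" "E x \<in> M"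
        using xyz v NM EN by auto
      have "\<tau> (y * E x * z * v) = \<tau> (y * (E x * (z * v)))"
        by (simp add: mult.assoc)
      also have "\<dots> = \<tau> (E x * (z * v) * y)"
        by (intro tau_comm M m)
      also have "\<dots> = \<tau> (E x * (z * v * y))"
        by (simp add: mult.assoc)
      also have "\<dots> = \<tau> (x * (z * v * y))"
        by (intro tau V xyz v)
      also have "\<dots> = \<tau> (x * (z * v) * y)"
        by (simp add: mult.assoc)
      also have "\<dots> = \<tau> (y * (x * (z * v)))"
        by (intro tau_comm M m)
      also have "\<dots> = \<tau> (y * x * z * v)"
        by (simp add: mult.assoc)
      finally show "\<tau> (y * E x * z * v) = \<tau> (y * x * z * v)" .
    qed (use xyz in \<open>simp_all add: M V EN NM\<close>)
    show "\<tau> (E x) = \<tau> x" if "x \<in> M" for x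
      using tau[OF that V(2)] by simp
  qed
  moreover have "E \<in> extensional M"
    by (simp add: E_def)
  ultimately show ?thesis by blast
qed

theorem cond_exp_trace_preserving:
  assumes "A \<subseteq> M"
  shows "trace_preserving_cond_exp M \<tau> (vn_gen A) (cond_exp M \<tau> A)"
proof -
  have N: "von_neumann_algebra (vn_gen A)" "vn_gen A \<subseteq> M"
    using assms by (auto simp: von_neumann_algebra_vn_gen vn_gen_minimal vna del: subsetI)
  obtain E where E: "E \<in> extensional M" "trace_preserving_cond_exp M \<tau> (vn_gen A) E"
    by (rule bexE[OF trace_preserving_cond_exp_exists[OF N]]) (rule that)
  have "\<exists>!E. E \<in> extensional M \<and> trace_preserving_cond_exp M \<tau> (vn_gen A) E"
  proof (rule ex1I[of _ E])
    show "E \<in> extensional M \<and> trace_preserving_cond_exp M \<tau> (vn_gen A) E"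
      using E by (rule conjI)
    fix F assume F: "F \<in> extensional M \<and> trace_preserving_cond_exp M \<tau> (vn_gen A) F"
    show "F = E"
      by (rule extensionalityI[OF conjunct1[OF F] E(1)])
        (rule trace_preserving_cond_exp_unique[OF N conjunct2[OF F] E(2)])
  qed
  from theI'[OF this] show ?thesis
    unfolding cond_exp_def by (rule conjunct2)
qed

end

section \<open>Square-summable sequences in a Hilbert space\<close>

text \<open>The amplification space H \<otimes> l^2. An ultraweak neighbourhood tests infinitely
  many vectors at once, and these are packed into a single vector here.\<close>

typedef (overloaded) 'a ell2 = "{f :: nat \<Rightarrow> 'a::chilbert_space. summable (\<lambda>n. (norm (f n))\<^sup>2)}"
  morphisms coord Abs_ell2
  by (rule exI[of _ "\<lambda>_. 0"]) simp

setup_lifting type_definition_ell2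

lemma summable_coord: "summable (\<lambda>n. (norm (coord x n))\<^sup>2)"
  using coord[of x] by simp

lemma ell2_eqI: "(\<And>n. coord x n = coord y n) \<Longrightarrow> x = y"
  by (simp add: coord_inject[symmetric] fun_eq_iff)

lemma summable_norm_add:
  fixes f g :: "nat \<Rightarrow> 'a::real_normed_vector"
  assumes "summable (\<lambda>n. (norm (f n))\<^sup>2)" "summable (\<lambda>n. (norm (g n))\<^sup>2)"
  shows "summable (\<lambda>n. (norm (f n + g n))\<^sup>2)"
proof (rule summable_comparison_test')
  show "summable (\<lambda>n. 2 * (norm (f n))\<^sup>2 + 2 * (norm (g n))\<^sup>2)"
    by (intro summable_add summable_mult assms)
  show "norm ((norm (f n + g n))\<^sup>2) \<le> 2 * (norm (f n))\<^sup>2 + 2 * (norm (g n))\<^sup>2" if "n \<ge> 0" for n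
  proof -
    have "(norm (f n + g n))\<^sup>2 \<le> (norm (f n) + norm (g n))\<^sup>2"
      by (intro power_mono norm_triangle_ineq) simp
    also have "\<dots> \<le> 2 * (norm (f n))\<^sup>2 + 2 * (norm (g n))\<^sup>2"
      using sum_squares_bound[of "norm (f n)" "norm (g n)"] by (simp add: power2_sum)
    finally show ?thesis by simp
  qed
qed

lemma summable_norm_le:
  assumes "summable (\<lambda>n. (norm (g n))\<^sup>2)" "\<And>n. norm (f n) \<le> K * norm (g n)"
  shows "summable (\<lambda>n::nat. (norm (f n))\<^sup>2)"
proof (rule summable_comparison_test')
  show "summable (\<lambda>n. K\<^sup>2 * (norm (g n))\<^sup>2)"
    by (intro summable_mult assms)
  show "norm ((norm (f n))\<^sup>2) \<le> K\<^sup>2 * (norm (g n))\<^sup>2" if "n \<ge> 0" for n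
    using power_mono[OF assms(2)[of n] norm_ge_zero, of 2] by (simp add: power_mult_distrib)
qed

instantiation ell2 :: (chilbert_space) complex_vector
begin

lift_definition zero_ell2 :: "'a ell2" is "\<lambda>_. 0" by simp
lift_definition plus_ell2 :: "'a ell2 \<Rightarrow> 'a ell2 \<Rightarrow> 'a ell2" is "\<lambda>f g n. f n + g n"
  by (rule summable_norm_add)
lift_definition uminus_ell2 :: "'a ell2 \<Rightarrow> 'a ell2" is "\<lambda>f n. - f n" by simp
lift_definition minus_ell2 :: "'a ell2 \<Rightarrow> 'a ell2 \<Rightarrow> 'a ell2" is "\<lambda>f g n. f n - g n"
  using summable_norm_add[where g = "\<lambda>n. - g n" for g] by fastforce
lift_definition scaleC_ell2 :: "complex \<Rightarrow> 'a ell2 \<Rightarrow> 'a ell2" is "\<lambda>c f n. c *\<^sub>C f n"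
  by (simp add: norm_scaleC power_mult_distrib summable_mult)

instance
  by standard (transfer, simp add: fun_eq_iff algebra_simps scaleC_add_right scaleC_add_left scaleC_scaleC
      scaleC_one)+

end

instantiation ell2 :: (chilbert_space) real_inner
begin

lift_definition scaleR_ell2 :: "real \<Rightarrow> 'a ell2 \<Rightarrow> 'a ell2" is "\<lambda>r f n. r *\<^sub>R f n"
  by (simp add: power_mult_distrib summable_mult)

definition inner_ell2 :: "'a ell2 \<Rightarrow> 'a ell2 \<Rightarrow> real" where
  "inner_ell2 x y = suminf (\<lambda>n. inner (coord x n) (coord y n))"

definition norm_ell2 :: "'a ell2 \<Rightarrow> real" where
  "norm_ell2 x = sqrt (inner x x)"

definition dist_ell2 :: "'a ell2 \<Rightarrow> 'a ell2 \<Rightarrow> real" where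
  "dist_ell2 x y = norm (x - y)"

definition sgn_ell2 :: "'a ell2 \<Rightarrow> 'a ell2" where
  "sgn_ell2 x = scaleR (inverse (norm x)) x"

definition uniformity_ell2 :: "('a ell2 \<times> 'a ell2) filter" where
  "uniformity_ell2 = (INF e\<in>{0<..}. principal {(x, y). dist x y < e})"

definition open_ell2 :: "'a ell2 set \<Rightarrow> bool" where
  "open_ell2 U \<longleftrightarrow> (\<forall>x\<in>U. eventually (\<lambda>(x', y). x' = x \<longrightarrow> y \<in> U) uniformity)"

lemma summable_inner_coord: "summable (\<lambda>n. inner (coord x n) (coord y n :: 'a))"
  by (rule summable_comparison_test'[OF summable_norm_mult[OF summable_coord[of x] summable_coord[of y]], of 0])
    (simp add: Cauchy_Schwarz_ineq2)

instance
proof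
  fix x y z :: "'a ell2" and a b r :: real
  show "a *\<^sub>R (x + y) = a *\<^sub>R x + a *\<^sub>R y" "(a + b) *\<^sub>R x = a *\<^sub>R x + b *\<^sub>R x"
    "a *\<^sub>R b *\<^sub>R x = (a * b) *\<^sub>R x" "1 *\<^sub>R x = x"
    by (transfer, simp add: fun_eq_iff algebra_simps)+
  show "inner x y = inner y x"
    by (simp add: inner_ell2_def inner_commute)
  show "inner (x + y) z = inner x z + inner y z"
    unfolding inner_ell2_def
    by (simp add: plus_ell2.rep_eq inner_add_left suminf_add summable_inner_coord)
  show "inner (r *\<^sub>R x) y = r * inner x y"
    unfolding inner_ell2_def
    by (simp add: scaleR_ell2.rep_eq suminf_mult summable_inner_coord)
  show "0 \<le> inner x x"
    unfolding inner_ell2_def by (intro suminf_nonneg summable_inner_coord) simp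
  show "inner x x = 0 \<longleftrightarrow> x = 0"
  proof
    assume "inner x x = 0"
    then have "\<forall>n. inner (coord x n) (coord x n) = 0"
      unfolding inner_ell2_def by (subst (asm) suminf_eq_zero_iff[OF summable_inner_coord]) auto
    then show "x = 0"
      by (intro ell2_eqI) (simp add: zero_ell2.rep_eq)
  qed (simp add: inner_ell2_def zero_ell2.rep_eq)
qed (simp_all only: norm_ell2_def dist_ell2_def sgn_ell2_def uniformity_ell2_def open_ell2_def)

end

lemma norm_ell2_sq: "(norm x)\<^sup>2 = suminf (\<lambda>n. (norm (coord x n))\<^sup>2)"
  by (simp add: power2_norm_eq_inner inner_ell2_def)

lemma coord_simps [simp]:
  "coord 0 n = 0" "coord (x + y) n = coord x n + coord y n" "coord (x - y) n = coord x n - coord y n"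
  "coord (- x) n = - coord x n" "coord (c *\<^sub>C x) n = c *\<^sub>C coord x n" "coord (r *\<^sub>R x) n = r *\<^sub>R coord x n"
  by (transfer, simp)+

lemma norm_coord_le: "norm (coord x n) \<le> norm x"
proof -
  have "(norm (coord x n))\<^sup>2 \<le> (norm x)\<^sup>2"
    unfolding norm_ell2_sq using sum_le_suminf[OF summable_coord, of "{n}" x] by simp
  then show ?thesis
    by (simp add: power2_le_iff_abs_le)
qed

lemma norm_ell2_leI:
  assumes "0 \<le> K" "\<And>m. (\<Sum>n<m. (norm (coord x n))\<^sup>2) \<le> K\<^sup>2"
  shows "norm x \<le> K"
proof -
  have "(norm x)\<^sup>2 \<le> K\<^sup>2"
    unfolding norm_ell2_sq by (rule suminf_le_const[OF summable_coord assms(2)])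
  then show ?thesis
    using assms(1) by (simp add: power2_le_iff_abs_le)
qed

instance ell2 :: (chilbert_space) complete_space
proof
  fix X :: "nat \<Rightarrow> 'a ell2" assume X: "Cauchy X"
  have "Cauchy (\<lambda>k. coord (X k) n)" for n
  proof (rule metric_CauchyI)
    fix e :: real assume "e > 0"
    then obtain K where "\<forall>j\<ge>K. \<forall>k\<ge>K. dist (X j) (X k) < e"
      using X metric_CauchyD by blast
    moreover have "dist (coord (X j) n) (coord (X k) n) \<le> dist (X j) (X k)" for j k
      using norm_coord_le[of "X j - X k" n] by (simp add: dist_norm)
    ultimately show "\<exists>K. \<forall>j\<ge>K. \<forall>k\<ge>K. dist (coord (X j) n) (coord (X k) n) < e"
      by (meson order_le_less_trans)
  qed
  then have "\<exists>l. (\<lambda>k. coord (X k) n) \<longlonglongrightarrow> l" for n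
    using Cauchy_convergent_iff convergent_def by blast
  then obtain f where f: "\<And>n. (\<lambda>k. coord (X k) n) \<longlonglongrightarrow> f n"
    by metis
  \<comment> \<open>Finite partial sums allow k to tend to infinity inside the norm, and the
    resulting bound is uniform in m.\<close>
  have tail: "\<exists>K. \<forall>j\<ge>K. \<forall>m. (\<Sum>n<m. (norm (coord (X j) n - f n))\<^sup>2) \<le> e\<^sup>2" if "e > 0" for e
  proof -
    obtain K where K: "\<And>j k. j \<ge> K \<Longrightarrow> k \<ge> K \<Longrightarrow> dist (X j) (X k) < e"
      using X metric_CauchyD \<open>e > 0\<close> by blast
    have "(\<Sum>n<m. (norm (coord (X j) n - f n))\<^sup>2) \<le> e\<^sup>2" if j: "j \<ge> K" for j m
    proof (rule LIMSEQ_le_const2)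
      show "(\<lambda>k. \<Sum>n<m. (norm (coord (X j) n - coord (X k) n))\<^sup>2)
          \<longlonglongrightarrow> (\<Sum>n<m. (norm (coord (X j) n - f n))\<^sup>2)"
        by (intro tendsto_intros f)
      have "(\<Sum>n<m. (norm (coord (X j) n - coord (X k) n))\<^sup>2) \<le> e\<^sup>2" if k: "k \<ge> K" for k
      proof -
        have "(\<Sum>n<m. (norm (coord (X j) n - coord (X k) n))\<^sup>2) \<le> (norm (X j - X k))\<^sup>2"
          unfolding norm_ell2_sq using sum_le_suminf[OF summable_coord, of "{..<m}" "X j - X k"] by simp
        also have "\<dots> \<le> e\<^sup>2"
          using K[OF j k] by (intro power_mono) (auto simp: dist_norm)
        finally show ?thesis .
      qed
      then show "\<exists>N. \<forall>k\<ge>N. (\<Sum>n<m. (norm (coord (X j) n - coord (X k) n))\<^sup>2) \<le> e\<^sup>2"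
        by blast
    qed
    then show ?thesis by blast
  qed
  obtain K where K: "\<And>m. (\<Sum>n<m. (norm (coord (X K) n - f n))\<^sup>2) \<le> 1\<^sup>2"
    using tail[of 1] by auto
  have "summable (\<lambda>n. (norm (coord (X K) n - f n))\<^sup>2)"
    by (rule summableI_nonneg_bounded[of _ "1\<^sup>2"]) (auto simp: K[simplified])
  \<comment> \<open>f is the difference of \<open>X K\<close> and \<open>X K - f\<close>, both
    square-summable.\<close>
  then have "summable (\<lambda>n. (norm (coord (X K) n + - (coord (X K) n - f n)))\<^sup>2)"
    by (intro summable_norm_add summable_coord) (simp add: norm_minus_commute)
  then obtain l where l: "coord l = f"
    using Abs_ell2_inverse[of f] by auto
  have "X \<longlonglongrightarrow> l"
  proof (rule metric_LIMSEQ_I)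
    fix e :: real assume e: "e > 0"
    obtain K where K: "\<And>j m. j \<ge> K \<Longrightarrow> (\<Sum>n<m. (norm (coord (X j) n - f n))\<^sup>2) \<le> (e/2)\<^sup>2"
      using tail[of "e/2"] e by auto
    have "norm (X j - l) \<le> e/2" if "j \<ge> K" for j
      by (rule norm_ell2_leI) (use e K[OF that] in \<open>auto simp: l\<close>)
    then show "\<exists>K. \<forall>j\<ge>K. dist (X j) l < e"
      using e by (intro exI[of _ K]) (force simp: dist_norm)
  qed
  then show "convergent X"
    by (auto simp: convergent_def)
qed

instantiation ell2 :: (chilbert_space) chilbert_space
begin

definition cinner_ell2 :: "'a ell2 \<Rightarrow> 'a ell2 \<Rightarrow> complex" where
  "cinner_ell2 x y = suminf (\<lambda>n. cinner (coord x n) (coord y n))"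

lemma summable_cinner_coord: "summable (\<lambda>n. cinner (coord x n) (coord y n :: 'a))"
  by (rule summable_comparison_test'[OF summable_norm_mult[OF summable_coord[of x] summable_coord[of y]], of 0])
    (simp add: norm_cinner_le)

instance
proof
  fix x y z :: "'a ell2" and r :: real and c :: complex
  show "r *\<^sub>R x = complex_of_real r *\<^sub>C x"
    by (rule ell2_eqI) (simp add: scaleR_scaleC)
  show "cinner (x + y) z = cinner x z + cinner y z"
    unfolding cinner_ell2_def by (simp add: cinner_add_left suminf_add summable_cinner_coord)
  show "cinner (c *\<^sub>C x) y = c * cinner x y"
    unfolding cinner_ell2_def by (simp add: cinner_scaleC_left suminf_mult summable_cinner_coord)
  have "cnj (cinner y x) = suminf (\<lambda>n. cnj (cinner (coord y n) (coord x n)))"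
    unfolding cinner_ell2_def
    by (rule bounded_linear.suminf[OF bounded_linear_cnj summable_cinner_coord])
  then show "cinner x y = cnj (cinner y x)"
    by (simp add: cinner_ell2_def flip: cinner_commute)
  show "inner x y = Re (cinner x y)"
    unfolding inner_ell2_def cinner_ell2_def inner_eq_Re_cinner
    by (rule bounded_linear.suminf[OF bounded_linear_Re summable_cinner_coord, symmetric])
qed

end


section \<open>The density theorem\<close>

lift_definition ell2_single :: "nat \<Rightarrow> 'a::chilbert_space \<Rightarrow> 'a ell2" is
  "\<lambda>j h n. if n = j then h else 0"
proof -
  fix j :: nat and h :: 'a
  have "(\<lambda>n. (norm (if n = j then h else 0))\<^sup>2) = (\<lambda>n. if n = j then (norm h)\<^sup>2 else 0)"
    by auto
  then show "summable (\<lambda>n. (norm (if n = j then h else 0))\<^sup>2)"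
    using summable_single[of j "\<lambda>_. (norm h)\<^sup>2"] by simp
qed

lemma coord_single [simp]: "coord (ell2_single j h) n = (if n = j then h else 0)"
  by (simp add: ell2_single.rep_eq)

lemma norm_single: "norm (ell2_single j h) = norm h"
proof -
  have "(\<lambda>n. (norm (coord (ell2_single j h) n))\<^sup>2) = (\<lambda>n. if n = j then (norm h)\<^sup>2 else 0)"
    by auto
  then have "(norm (ell2_single j h))\<^sup>2 = (norm h)\<^sup>2"
    unfolding norm_ell2_sq using sums_single[of j "\<lambda>_. (norm h)\<^sup>2", THEN sums_unique] by simp
  then show ?thesis by (simp add: power2_eq_iff_nonneg)
qed

fun ell2_trunc :: "nat \<Rightarrow> 'a::chilbert_space ell2 \<Rightarrow> 'a ell2" where
  "ell2_trunc 0 v = 0"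
| "ell2_trunc (Suc n) v = ell2_trunc n v + ell2_single n (coord v n)"

lemma coord_trunc: "coord (ell2_trunc n v) k = (if k < n then coord v k else 0)"
  by (induction n) auto

lemma ell2_trunc_tendsto: "(\<lambda>n. ell2_trunc n v) \<longlonglongrightarrow> v"
proof -
  let ?a = "\<lambda>k. (norm (coord v k))\<^sup>2"
  have "(norm (ell2_trunc n v - v))\<^sup>2 = suminf ?a - (\<Sum>k<n. ?a k)" for n
  proof -
    have "(\<lambda>k. (norm (coord (ell2_trunc n v - v) k))\<^sup>2) = (\<lambda>k. ?a k - (if k \<in> {..<n} then ?a k else 0))"
      by (auto simp: coord_trunc fun_eq_iff)
    moreover have "(\<lambda>k. if k \<in> {..<n} then ?a k else 0) sums (\<Sum>k<n. ?a k)"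
      by (rule sums_If_finite_set) simp
    ultimately show ?thesis
      unfolding norm_ell2_sq
      by (simp only: sums_unique[OF sums_diff[OF summable_sums[OF summable_coord]], symmetric])
  qed
  moreover have "(\<lambda>n. suminf ?a - (\<Sum>k<n. ?a k)) \<longlonglongrightarrow> suminf ?a - suminf ?a"
    by (intro tendsto_intros summable_LIMSEQ summable_coord)
  ultimately have "(\<lambda>n. (norm (ell2_trunc n v - v))\<^sup>2) \<longlonglongrightarrow> 0"
    by simp
  then have "(\<lambda>n. norm (ell2_trunc n v - v)) \<longlonglongrightarrow> 0"
    using tendsto_real_sqrt[of "\<lambda>n. (norm (ell2_trunc n v - v))\<^sup>2" 0 sequentially] by simp
  then show ?thesis
    by (rule LIM_zero_cancel[OF tendsto_norm_zero_cancel])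
qed

lift_definition amp_vec :: "'a::chilbert_space bop \<Rightarrow> 'a ell2 \<Rightarrow> 'a ell2" is
  "\<lambda>T f n. op_apply T (f n)"
proof -
  fix T :: "'a bop" and f :: "nat \<Rightarrow> 'a" assume f: "summable (\<lambda>n. (norm (f n))\<^sup>2)"
  obtain K where "\<And>x. norm (op_apply T x) \<le> K * norm x"
    using op_apply_bound[of T] by blast
  then show "summable (\<lambda>n. (norm (op_apply T (f n)))\<^sup>2)"
    by (intro summable_norm_le[OF f])
qed

lemma coord_amp_vec [simp]: "coord (amp_vec T v) n = op_apply T (coord v n)"
  by (simp add: amp_vec.rep_eq)

lemma norm_amp_vec_le:
  assumes "0 \<le> K" "\<And>x. norm (op_apply T x) \<le> K * norm x"
  shows "norm (amp_vec T v) \<le> K * norm v"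
proof (rule norm_ell2_leI)
  fix m
  have "(\<Sum>n<m. (norm (coord (amp_vec T v) n))\<^sup>2) \<le> (\<Sum>n<m. K\<^sup>2 * (norm (coord v n))\<^sup>2)"
    using power_mono[OF assms(2) norm_ge_zero, of _ 2] by (intro sum_mono) (simp add: power_mult_distrib)
  also have "\<dots> = K\<^sup>2 * (\<Sum>n<m. (norm (coord v n))\<^sup>2)"
    by (simp add: sum_distrib_left)
  also have "\<dots> \<le> K\<^sup>2 * (norm v)\<^sup>2"
    unfolding norm_ell2_sq using sum_le_suminf[OF summable_coord, of "{..<m}" v]
    by (intro mult_left_mono) auto
  finally show "(\<Sum>n<m. (norm (coord (amp_vec T v) n))\<^sup>2) \<le> (K * norm v)\<^sup>2"
    by (simp add: power_mult_distrib)
qed (simp add: assms(1))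

lemma amp_exists: "\<exists>A. op_apply A = amp_vec (T :: 'a::chilbert_space bop)"
proof -
  obtain K where K: "K > 0" "\<And>x. norm (op_apply T x) \<le> K * norm x"
    using op_apply_bound[of T] by blast
  have "norm (amp_vec T v) \<le> K * norm v" for v
    using K by (intro norm_amp_vec_le) auto
  then show ?thesis
    by (metis (no_types, opaque_lifting) bop_of_linear ell2_eqI coord_amp_vec coord_simps(2,5)
        op_apply_add op_apply_scaleC)
qed

definition amp :: "'a::chilbert_space bop \<Rightarrow> 'a ell2 bop" where
  "amp T = (SOME A. op_apply A = amp_vec T)"

lemma op_apply_amp: "op_apply (amp T) = amp_vec T"
  unfolding amp_def by (rule someI_ex[OF amp_exists])

lemma cinner_amp_vec: "cinner (amp_vec T u) v = cinner u (amp_vec (adj T) v)"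
  by (simp add: cinner_ell2_def cinner_adj)

text \<open>The matrix entries of the projection onto the closure of \<open>C v\<close> commute with \<open>C\<close>, hence with
  the bicommutant of \<open>C\<close>.\<close>

theorem density:
  fixes C :: "'h::chilbert_space bop set"
  assumes C: "subalgebra C" "1 \<in> C" "\<And>c. c \<in> C \<Longrightarrow> adj c \<in> C"
    and y: "y \<in> commutant (commutant C)" and e: "e > 0"
  shows "\<exists>c\<in>C. norm (amp_vec c v - amp_vec y v) < e"
proof -
  define S0 where "S0 = (\<lambda>c. amp_vec c v) ` C"
  define S where "S = closure S0"
  have "csubspace S0"
    unfolding csubspace_def
  proof (intro conjI ballI allI)
    show "0 \<in> S0"
      unfolding S0_def using subalgebraD(1)[OF C(1)] by (intro image_eqI[of _ _ 0] ell2_eqI) auto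
    show "a + b \<in> S0" if "a \<in> S0" "b \<in> S0" for a b
    proof -
      obtain c d where "c \<in> C" "d \<in> C" "a = amp_vec c v" "b = amp_vec d v"
        using \<open>a \<in> S0\<close> \<open>b \<in> S0\<close> S0_def by auto
      then show ?thesis
        unfolding S0_def using subalgebraD(2)[OF C(1)] by (intro image_eqI[of _ _ "c + d"] ell2_eqI) auto
    qed
    show "k *\<^sub>C a \<in> S0" if "a \<in> S0" for k a
    proof -
      obtain c where "c \<in> C" "a = amp_vec c v"
        using \<open>a \<in> S0\<close> S0_def by auto
      then show ?thesis
        unfolding S0_def using subalgebraD(4)[OF C(1)] by (intro image_eqI[of _ _ "k *\<^sub>C c"] ell2_eqI) auto
    qed
  qed
  then have S: "csubspace S"
    unfolding S_def by (rule csubspace_closure)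
  have SC: "amp_vec c a \<in> S" if c: "c \<in> C" and a: "a \<in> S" for c a
  proof -
    obtain f where f: "\<And>n. f n \<in> S0" "f \<longlonglongrightarrow> a"
      using a unfolding S_def closure_sequential by blast
    have "amp_vec c (f n) \<in> S0" for n
    proof -
      obtain d where "d \<in> C" "f n = amp_vec d v"
        using f(1)[of n] S0_def by auto
      then show ?thesis
        unfolding S0_def using subalgebraD(3)[OF C(1) c] by (intro image_eqI[of _ _ "c * d"] ell2_eqI) auto
    qed
    moreover have "(\<lambda>n. amp_vec c (f n)) \<longlonglongrightarrow> amp_vec c a"
      using tendsto_op_apply[OF f(2), of "amp c"] by (simp add: op_apply_amp)
    ultimately show ?thesis
      unfolding S_def closure_sequential by (intro exI[of _ "\<lambda>n. amp_vec c (f n)"]) auto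
  qed
  have "\<exists>b. b \<in> S \<and> (\<forall>z\<in>S. cinner (a - b) z = 0)" for a
    using hilbert_projection[OF S, where x = a] by (metis S_def closed_closure)
  then obtain p where p: "\<And>a. p a \<in> S" "\<And>a z. z \<in> S \<Longrightarrow> cinner (a - p a) z = 0"
    by metis
  have p_eqI: "p a = b" if b: "b \<in> S" "\<And>z. z \<in> S \<Longrightarrow> cinner (a - b) z = 0" for a b
  proof -
    have d: "p a - b \<in> S" using csubspaceD(5)[OF S p(1) b(1)] .
    have "cinner (p a - b) (p a - b) = cinner (a - b) (p a - b) - cinner (a - p a) (p a - b)"
      by (simp flip: cinner_diff_left)
    then have "cinner (p a - b) (p a - b) = 0"
      using b(2)[OF d] p(2)[OF d] by simp
    then show ?thesis by (simp add: cinner_self)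
  qed
  have p_norm: "norm (p a) \<le> 1 * norm a" for a
  proof (cases "p a = 0")
    case False
    have "cinner (p a) (p a) = cinner a (p a)"
      using p(2)[OF p(1), of a] by (simp add: cinner_diff_left)
    then have "norm (p a) * norm (p a) \<le> norm a * norm (p a)"
      using norm_cinner_le[of a "p a"] unfolding cinner_self
      by (metis cinner_self norm_of_real abs_power2 power2_eq_square abs_mult_self_eq norm_mult of_real_mult)
    then show ?thesis using False by simp
  qed simp
  obtain P where P: "op_apply P = p"
  proof (rule bop_of_linear[OF _ _ p_norm])
    show "p (a + b) = p a + p b" for a b
    proof (rule p_eqI)
      show "p a + p b \<in> S" by (intro csubspaceD(2)[OF S] p)
      show "cinner (a + b - (p a + p b)) z = 0" if "z \<in> S" for z
        using p(2)[OF that, of a] p(2)[OF that, of b] by (simp add: cinner_diff_left cinner_add_left)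
    qed
    show "p (c *\<^sub>C a) = c *\<^sub>C p a" for c a
    proof (rule p_eqI)
      show "c *\<^sub>C p a \<in> S" by (intro csubspaceD(3)[OF S] p)
      show "cinner (c *\<^sub>C a - c *\<^sub>C p a) z = 0" if "z \<in> S" for z
        using p(2)[OF that, of a] by (simp add: cinner_diff_left cinner_scaleC_left)
    qed
  qed (rule that)
  \<comment> \<open>S is invariant under C and C is closed under adjoints, so the orthogonal
    complement of S is invariant as well.\<close>
  have p_com: "p (amp_vec c a) = amp_vec c (p a)" if c: "c \<in> C" for c a
  proof (rule p_eqI)
    show "amp_vec c (p a) \<in> S" by (intro SC c p)
    show "cinner (amp_vec c a - amp_vec c (p a)) z = 0" if "z \<in> S" for z
      using p(2)[OF SC[OF C(3)[OF c] that], of a] by (simp add: cinner_diff_left cinner_amp_vec)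
  qed
  have single: "p (amp_vec y (ell2_single j h)) = amp_vec y (p (ell2_single j h))" for j h
  proof (rule ell2_eqI)
    fix i
    have amp_single: "amp_vec T (ell2_single j h) = ell2_single j (op_apply T h)" for T :: "'h bop" and h
      by (rule ell2_eqI) simp
    \<comment> \<open>Q is the (i, j) entry of the projection, viewed as an infinite matrix of
      operators.\<close>
    obtain Q where Q: "op_apply Q = (\<lambda>h. coord (p (ell2_single j h)) i)"
    proof (rule bop_of_linear[of "\<lambda>h. coord (p (ell2_single j h)) i" 1])
      show "coord (p (ell2_single j (x + z))) i = coord (p (ell2_single j x)) i + coord (p (ell2_single j z)) i"
        for x z
      proof -
        have "ell2_single j (x + z) = ell2_single j x + ell2_single j z"
          by (rule ell2_eqI) simp
        then show ?thesis by (simp add: op_apply_add flip: P)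
      qed
      show "coord (p (ell2_single j (c *\<^sub>C x))) i = c *\<^sub>C coord (p (ell2_single j x)) i" for c x
      proof -
        have "ell2_single j (c *\<^sub>C x) = c *\<^sub>C ell2_single j x"
          by (rule ell2_eqI) simp
        then show ?thesis by (simp add: op_apply_scaleC flip: P)
      qed
      show "norm (coord (p (ell2_single j x)) i) \<le> 1 * norm x" for x
        using norm_coord_le[of "p (ell2_single j x)" i] p_norm[of "ell2_single j x"] by (simp add: norm_single)
    qed (rule that)
    have "Q \<in> commutant C"
    proof -
      have "c * Q = Q * c" if "c \<in> C" for c
        by (rule bop_eqI) (simp add: Q p_com[OF that] flip: amp_single)
      then show ?thesis by (simp add: commutant_def)
    qed
    then have "Q * y = y * Q"
      using y by (simp add: commutant_def)
    then have "op_apply Q (op_apply y h) = op_apply y (op_apply Q h)"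
      by (metis op_apply_simps(6))
    then show "coord (p (amp_vec y (ell2_single j h))) i = coord (amp_vec y (p (ell2_single j h))) i"
      by (simp add: Q amp_single)
  qed
  \<comment> \<open>Commutation is known on vectors with one nonzero coordinate; linearity gives
    finitely supported vectors and continuity then gives v.\<close>
  have trunc: "op_apply P (op_apply (amp y) (ell2_trunc n a)) = op_apply (amp y) (op_apply P (ell2_trunc n a))" for n a
  proof (induction n)
    case (Suc n)
    then show ?case
      using single by (simp add: op_apply_add) (simp add: op_apply_amp P)
  qed simp
  have "op_apply P (op_apply (amp y) v) = op_apply (amp y) (op_apply P v)"
  proof (rule LIMSEQ_unique)
    show "(\<lambda>n. op_apply P (op_apply (amp y) (ell2_trunc n v))) \<longlonglongrightarrow> op_apply P (op_apply (amp y) v)"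
      by (intro tendsto_op_apply ell2_trunc_tendsto)
    show "(\<lambda>n. op_apply P (op_apply (amp y) (ell2_trunc n v))) \<longlonglongrightarrow> op_apply (amp y) (op_apply P v)"
      unfolding trunc by (intro tendsto_op_apply ell2_trunc_tendsto)
  qed
  \<comment> \<open>Because C contains 1, the vector v lies in S and is fixed by the projection, so
    commutation puts its image under y into S.\<close>
  moreover have "v \<in> S"
  proof -
    have "amp_vec 1 v = v" by (rule ell2_eqI) simp
    then have "v \<in> S0"
      unfolding S0_def using C(2) by (intro image_eqI[of _ _ 1]) auto
    then show ?thesis
      unfolding S_def using closure_subset by blast
  qed
  then have "p v = v"
    by (rule p_eqI) simp
  ultimately have "amp_vec y v = p (amp_vec y v)"
    by (simp add: op_apply_amp P)
  then have "amp_vec y v \<in> closure S0"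
    using p(1) S_def by metis
  then show ?thesis
    using e unfolding closure_approachable S0_def by (auto simp: dist_norm)
qed


subsection \<open>Ultraweakly open sets are ultrastrongly open\<close>

text \<open>Interleaving makes two ultrastrong conditions into a condition at one vector, since
  squared norms add.\<close>

lift_definition ell2_merge :: "'a::chilbert_space ell2 \<Rightarrow> 'a ell2 \<Rightarrow> 'a ell2" is
  "\<lambda>f g n. if even n then f (n div 2) else g ((n - 1) div 2)"
proof -
  fix f g :: "nat \<Rightarrow> 'a" assume "summable (\<lambda>n. (norm (f n))\<^sup>2)" "summable (\<lambda>n. (norm (g n))\<^sup>2)"
  then have "summable (\<lambda>n. if even n then (norm (f (n div 2)))\<^sup>2 else (norm (g ((n - 1) div 2)))\<^sup>2)"
    using sums_if[OF summable_sums summable_sums] sums_summable by blast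
  then show "summable (\<lambda>n. (norm (if even n then f (n div 2) else g ((n - 1) div 2)))\<^sup>2)"
    by (rule back_subst[of summable]) auto
qed

lemma norm_merge: "(norm (ell2_merge u v))\<^sup>2 = (norm u)\<^sup>2 + (norm v)\<^sup>2"
proof -
  have "(\<lambda>n. (norm (coord (ell2_merge u v) n))\<^sup>2)
    = (\<lambda>n. if even n then (norm (coord u (n div 2)))\<^sup>2 else (norm (coord v ((n - 1) div 2)))\<^sup>2)"
    by (auto simp: ell2_merge.rep_eq)
  then show ?thesis
    unfolding norm_ell2_sq
    using sums_unique[OF sums_if[OF summable_sums[OF summable_coord[of v]] summable_sums[OF summable_coord[of u]]]]
    by simp
qed

text \<open>Induction over the generated topology: intersections are handled by interleaving the
  test vectors, and a subbasic set depends on R only through a pairing <R v, w>, which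
  Cauchy-Schwarz controls.\<close>

lemma ultraweak_nhd_ultrastrong:
  assumes V: "openin ultraweak_topology V" "T \<in> V"
  shows "\<exists>v e. e > 0 \<and> (\<forall>R. norm (amp_vec R v - amp_vec T v) < e \<longrightarrow> R \<in> V)"
proof -
  have "generate_topology_on ultraweak_subbasis V"
    using V(1) by (simp add: ultraweak_topology_def openin_topology_generated_by_iff)
  then show ?thesis
    using V(2)
  proof (induction rule: generate_topology_on.induct)
    case (Int a b)
    then obtain u d v e where *: "d > 0" "\<And>R. norm (amp_vec R u - amp_vec T u) < d \<Longrightarrow> R \<in> a"
      "e > 0" "\<And>R. norm (amp_vec R v - amp_vec T v) < e \<Longrightarrow> R \<in> b"
      by auto
    have m: "(norm (amp_vec R (ell2_merge u v) - amp_vec T (ell2_merge u v)))\<^sup>2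
        = (norm (amp_vec R u - amp_vec T u))\<^sup>2 + (norm (amp_vec R v - amp_vec T v))\<^sup>2" for R
    proof -
      have "amp_vec R (ell2_merge u v) - amp_vec T (ell2_merge u v)
        = ell2_merge (amp_vec R u - amp_vec T u) (amp_vec R v - amp_vec T v)"
        by (rule ell2_eqI) (simp add: ell2_merge.rep_eq)
      then show ?thesis by (simp add: norm_merge)
    qed
    have le1: "norm (amp_vec R u - amp_vec T u) \<le> norm (amp_vec R (ell2_merge u v) - amp_vec T (ell2_merge u v))" for R
      by (rule power2_le_imp_le)
        (simp_all only: m norm_ge_zero le_add_same_cancel1 le_add_same_cancel2 zero_le_power2)
    have le2: "norm (amp_vec R v - amp_vec T v) \<le> norm (amp_vec R (ell2_merge u v) - amp_vec T (ell2_merge u v))" for R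
      by (rule power2_le_imp_le)
        (simp_all only: m norm_ge_zero le_add_same_cancel1 le_add_same_cancel2 zero_le_power2)
    have "R \<in> a \<inter> b" if "norm (amp_vec R (ell2_merge u v) - amp_vec T (ell2_merge u v)) < min d e" for R
      using *(2)[of R] *(4)[of R] le1[of R] le2[of R] that by (meson IntI min_less_iff_conj order_le_less_trans)
    moreover have "min d e > 0" using *(1,3) by simp
    ultimately show ?case by blast
  next
    case (UN \<K>)
    then obtain k where k: "k \<in> \<K>" "T \<in> k" by auto
    from UN.IH[OF k] show ?case using k(1) by (meson UnionI)
  next
    case (Basis s)
    then obtain \<xi> \<eta> U where s: "s = {T. suminf (\<lambda>n. cinner (op_apply T (\<xi> n)) (\<eta> n)) \<in> U}"
      and sm: "summable (\<lambda>n::nat. (norm (\<xi> n))\<^sup>2)" "summable (\<lambda>n. (norm (\<eta> n))\<^sup>2)" and U: "open U"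
      by blast
    define v w where "v = Abs_ell2 \<xi>" and "w = Abs_ell2 \<eta>"
    have vw: "coord v = \<xi>" "coord w = \<eta>"
      using sm by (auto simp: v_def w_def Abs_ell2_inverse)
    have s': "R \<in> s \<longleftrightarrow> cinner (amp_vec R v) w \<in> U" for R
      by (simp add: s cinner_ell2_def vw)
    obtain d where d: "d > 0" "\<And>z. dist z (cinner (amp_vec T v) w) < d \<Longrightarrow> z \<in> U"
      using U Basis.prems s' unfolding open_dist by blast
    have "R \<in> s" if R: "norm (amp_vec R v - amp_vec T v) < d / (norm w + 1)" for R
    proof -
      have "norm (cinner (amp_vec R v - amp_vec T v) w) \<le> norm (amp_vec R v - amp_vec T v) * norm w"
        by (rule norm_cinner_le)
      also have "\<dots> \<le> norm (amp_vec R v - amp_vec T v) * (norm w + 1)"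
        by (intro mult_left_mono) auto
      also have "\<dots> < d"
        using R by (simp add: field_simps add_pos_nonneg add_nonneg_pos)
      finally show ?thesis
        unfolding s' by (intro d(2)) (simp add: dist_norm cinner_diff_left)
    qed
    moreover have "d / (norm w + 1) > 0"
      using d(1) by (simp add: add_nonneg_pos)
    ultimately show ?case by blast
  qed simp
qed

context tracial_von_neumann_algebra
begin

text \<open>By normality the condition \<tau> \<noteq> 0 is ultraweakly open in \<open>M\<close>. If
  k y satisfied it, so would every element of \<open>M\<close> in an ultrastrong neighbourhood of k
  y, and density provides a c in C with k c in that neighbourhood.\<close>

theorem tau_eq_0_vn_gen:
  assumes C: "subalgebra C" "1 \<in> C" "\<And>c. c \<in> C \<Longrightarrow> adj c \<in> C" "C \<subseteq> M"
    and k: "k \<in> M" and zero: "\<And>c. c \<in> C \<Longrightarrow> \<tau> (k * c) = 0" and y: "y \<in> vn_gen C"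
  shows "\<tau> (k * y) = 0"
proof (rule ccontr)
  assume neq: "\<tau> (k * y) \<noteq> 0"
  have yM: "y \<in> M"
    using y vn_gen_minimal[OF C(4) vna] by blast
  have "vn_gen C \<subseteq> commutant (commutant C)"
    by (intro vn_gen_minimal subset_bicommutant von_neumann_algebra_commutant adj_commutant C(3))
  then have y2: "y \<in> commutant (commutant C)"
    using y by blast
  obtain V where V: "openin ultraweak_topology V" "\<And>x. x \<in> M \<Longrightarrow> x \<in> V \<longleftrightarrow> \<tau> x \<in> - {0}"
    by (rule tau_open_preimage[of "- {0}"]) auto
  have "k * y \<in> V"
    using neq V(2)[of "k * y"] by (simp add: M k yM)
  then obtain v e where e: "e > 0" "\<And>R. norm (amp_vec R v - amp_vec (k * y) v) < e \<Longrightarrow> R \<in> V"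
    using ultraweak_nhd_ultrastrong[OF V(1)] by blast
  obtain K where K: "K > 0" "\<And>x. norm (op_apply k x) \<le> K * norm x"
    using op_apply_bound[of k] by blast
  \<comment> \<open>Left multiplication by k costs at most the factor K, hence the tolerance e /
    K.\<close>
  obtain c where c: "c \<in> C" "norm (amp_vec c v - amp_vec y v) < e / K"
    using density[OF C(1-3) y2, of "e / K" v] e(1) K(1) by auto
  have "amp_vec (k * c) v - amp_vec (k * y) v = amp_vec k (amp_vec c v - amp_vec y v)"
    by (rule ell2_eqI) (simp add: op_apply_diff)
  then have "norm (amp_vec (k * c) v - amp_vec (k * y) v) \<le> K * norm (amp_vec c v - amp_vec y v)"
    using K by (simp add: norm_amp_vec_le)
  also have "\<dots> < e"
    using c(2) K(1) by (simp add: field_simps)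
  finally have "k * c \<in> V"
    by (rule e(2))
  then show False
    using V(2)[of "k * c"] zero[OF c(1)] c(1) C(4) k M(6) by auto
qed

end

section \<open>Additive maps on finitely supported functions\<close>

text \<open>The coefficient is an argument of h, so the target need only be an abelian group.
  Evaluations into vector spaces and maps from polynomials to polynomials are thus treated
  alike.\<close>

definition pm_ext :: "('k \<Rightarrow> complex \<Rightarrow> 'v::ab_group_add) \<Rightarrow> ('k \<Rightarrow>\<^sub>0 complex) \<Rightarrow> 'v" where
  "pm_ext h f = (\<Sum>k\<in>Poly_Mapping.keys f. h k (Poly_Mapping.lookup f k))"

definition coeff_additive :: "('k \<Rightarrow> complex \<Rightarrow> 'v::ab_group_add) \<Rightarrow> bool" where
  "coeff_additive h \<longleftrightarrow> (\<forall>k a b. h k (a + b) = h k a + h k b)"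

lemma coeff_additive_0: "coeff_additive h \<Longrightarrow> h k 0 = 0"
  using add_cancel_right_right[of "h k 0" "h k 0"] unfolding coeff_additive_def
  by (metis add_0)

lemma pm_ext_superset:
  assumes "coeff_additive h" "finite S" "Poly_Mapping.keys f \<subseteq> S"
  shows "pm_ext h f = (\<Sum>k\<in>S. h k (Poly_Mapping.lookup f k))"
  unfolding pm_ext_def
  by (rule sum.mono_neutral_left) (auto simp: assms(2,3) in_keys_iff coeff_additive_0[OF assms(1)])

lemma pm_ext_add:
  assumes h: "coeff_additive h"
  shows "pm_ext h (f + g) = pm_ext h f + pm_ext h g"
proof -
  let ?S = "Poly_Mapping.keys f \<union> Poly_Mapping.keys g"
  have "Poly_Mapping.keys (f + g) \<subseteq> ?S" by (rule keys_add)
  then have "pm_ext h (f + g) = (\<Sum>k\<in>?S. h k (Poly_Mapping.lookup (f + g) k))"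
    by (intro pm_ext_superset h) auto
  also have "\<dots> = (\<Sum>k\<in>?S. h k (Poly_Mapping.lookup f k)) + (\<Sum>k\<in>?S. h k (Poly_Mapping.lookup g k))"
    using h by (simp add: coeff_additive_def lookup_add sum.distrib)
  also have "\<dots> = pm_ext h f + pm_ext h g"
    by (simp add: pm_ext_superset[OF h, of ?S])
  finally show ?thesis .
qed

lemma pm_ext_0 [simp]: "pm_ext h 0 = 0"
  by (simp add: pm_ext_def)

lemma pm_ext_diff:
  assumes h: "coeff_additive h"
  shows "pm_ext h (f - g) = pm_ext h f - pm_ext h g"
  using pm_ext_add[OF h, of "f - g" g] by simp

lemma pm_ext_single: "coeff_additive h \<Longrightarrow> pm_ext h (Poly_Mapping.single k z) = h k z"
  by (simp add: pm_ext_def coeff_additive_0)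

lemma pm_induct [consumes 1, case_names zero add_single]:
  assumes "Poly_Mapping.keys f \<subseteq> W" and zero: "P 0"
    and step: "\<And>f w z. Poly_Mapping.keys f \<subseteq> W \<Longrightarrow> P f \<Longrightarrow> w \<in> W \<Longrightarrow> P (f + Poly_Mapping.single w (z::complex))"
  shows "P f"
proof -
  define r where "r S = (\<Sum>k\<in>S. Poly_Mapping.single k (Poly_Mapping.lookup f k))" for S
  have "Poly_Mapping.keys (r S) \<subseteq> W \<and> P (r S)" if "S \<subseteq> W" "finite S" for S
    using that(2,1)
  proof (induction S rule: finite_induct)
    case (insert k S)
    have r: "r (insert k S) = r S + Poly_Mapping.single k (Poly_Mapping.lookup f k)"
      using insert by (simp add: r_def add.commute)
    have k: "k \<in> W" and S: "Poly_Mapping.keys (r S) \<subseteq> W" "P (r S)"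
      using insert by auto
    have "Poly_Mapping.keys (r (insert k S)) \<subseteq> W"
      unfolding r using S(1) k by (intro order_trans[OF keys_add]) auto
    then show ?case
      unfolding r using step[OF S k] by simp
  qed (simp add: r_def zero)
  moreover have "r (Poly_Mapping.keys f) = f"
  proof (rule poly_mapping_eqI)
    fix k
    have "Poly_Mapping.lookup (r (Poly_Mapping.keys f)) k
      = (\<Sum>j\<in>Poly_Mapping.keys f. if j = k then Poly_Mapping.lookup f k else 0)"
      unfolding r_def lookup_sum by (intro sum.cong) (auto simp: lookup_single when_def)
    then show "Poly_Mapping.lookup (r (Poly_Mapping.keys f)) k = Poly_Mapping.lookup f k"
      by (simp add: in_keys_iff)
  qed
  ultimately show ?thesis
    using assms(1) by (metis finite_keys)
qed


section \<open>Linear maps on algebraic tensor products\<close>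

lemma linear_map_onD:
  assumes "linear_map_on A f"
  shows "a \<in> A \<Longrightarrow> b \<in> A \<Longrightarrow> f (a + b) = f a + f b" "a \<in> A \<Longrightarrow> f (c *\<^sub>C a) = c *\<^sub>C f a"
  using assms unfolding linear_map_on_def by auto

lemma linear_map_on_0: "linear_map_on A f \<Longrightarrow> csubspace A \<Longrightarrow> f 0 = 0"
  using linear_map_onD(2)[of A f 0 0] by (simp add: csubspaceD)

lemma csubspace_UNIV [simp]: "csubspace UNIV"
  by (simp add: csubspace_def)

lemma csubspace_subalgebra: "subalgebra A \<Longrightarrow> csubspace A"
  unfolding csubspace_def subalgebra_def by auto

lemma vector_space_scaleC: "vector_space (scaleC :: complex \<Rightarrow> 'a \<Rightarrow> 'a::complex_vector)"
  by unfold_locales (auto simp: scaleC_add_left scaleC_add_right scaleC_scaleC scaleC_one)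

text \<open>A linear map is prescribed on a basis of A and extended from there. This replaces a map
  meaningful only on a subspace, such as E on \<open>M\<close>, by a globally linear one to which
  the universal property applies.\<close>

lemma linear_map_on_extend:
  fixes f :: "'a::complex_vector \<Rightarrow> 'b::complex_vector"
  assumes A: "csubspace A" and f: "linear_map_on A f"
  shows "\<exists>g. linear_map_on UNIV g \<and> (\<forall>a\<in>A. g a = f a)"
proof -
  interpret v: vector_space_pair "scaleC :: complex \<Rightarrow> 'a \<Rightarrow> 'a" "scaleC :: complex \<Rightarrow> 'b \<Rightarrow> 'b"
    by (intro vector_space_pair.intro vector_space_scaleC)
  have sub: "v.vs1.subspace A"
    using A by (auto simp: v.vs1.subspace_def csubspaceD)
  obtain B where B: "B \<subseteq> A" "v.vs1.independent B" "A \<subseteq> v.vs1.span B"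
    using v.vs1.basis_exists[of A] by metis
  obtain g where g: "Vector_Spaces.linear scaleC scaleC g" "\<And>x. x \<in> B \<Longrightarrow> g x = f x"
    using v.linear_independent_extend[OF B(2), of f] by auto
  have glin: "g (x + y) = g x + g y" "g (c *\<^sub>C x) = c *\<^sub>C g x" for x y c
    using v.linear_add[OF g(1)] v.linear_scale[OF g(1)] by auto
  have "x \<in> A \<and> g x = f x" if "x \<in> v.vs1.span B" for x
    using that
  proof (induction rule: v.vs1.span_induct_alt)
    case base
    show ?case
      using glin(2)[of 0 0] linear_map_on_0[OF f A] csubspaceD(1)[OF A] by simp
  next
    case (step c x y)
    have "x \<in> A" using step.hyps B(1) by auto
    then show ?case
      using step g(2) A f by (simp add: glin linear_map_onD csubspaceD)
  qed
  then have "\<forall>a\<in>A. g a = f a"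
    using B(3) by auto
  then show ?thesis
    using glin unfolding linear_map_on_def by auto
qed

section \<open>Universal property of the tensor product\<close>

definition cbilinear :: "('a::complex_vector \<Rightarrow> 'b::complex_vector \<Rightarrow> 'v::complex_vector) \<Rightarrow> bool" where
  "cbilinear \<beta> \<longleftrightarrow> (\<forall>x. linear_map_on UNIV (\<beta> x)) \<and> (\<forall>y. linear_map_on UNIV (\<lambda>x. \<beta> x y))"

lemma cbilinearD:
  assumes "cbilinear \<beta>"
  shows "\<beta> (x + x') y = \<beta> x y + \<beta> x' y" "\<beta> x (y + y') = \<beta> x y + \<beta> x y'"
    "\<beta> (c *\<^sub>C x) y = c *\<^sub>C \<beta> x y" "\<beta> x (c *\<^sub>C y) = c *\<^sub>C \<beta> x y"
  using assms unfolding cbilinear_def linear_map_on_def by auto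

definition tensor_lift ::
  "('a::complex_vector \<Rightarrow> 'b::complex_vector \<Rightarrow> 'v::complex_vector) \<Rightarrow> ('a, 'b) tensor \<Rightarrow> 'v" where
  "tensor_lift \<beta> u = pm_ext (\<lambda>k z. z *\<^sub>C \<beta> (fst k) (snd k)) (rep_tensor u)"

lemma coeff_additive_scaleC [simp]: "coeff_additive (\<lambda>k z. z *\<^sub>C g k)"
  by (simp add: coeff_additive_def scaleC_add_left)

lemma tensor_null_pm_ext:
  assumes \<beta>: "cbilinear \<beta>"
  shows "F \<in> tensor_null \<Longrightarrow> pm_ext (\<lambda>k z. z *\<^sub>C \<beta> (fst k) (snd k)) F = 0"
  by (induction rule: tensor_null.induct)
    (simp_all add: pm_ext_diff pm_ext_single cbilinearD[OF \<beta>] scaleC_add_right scaleC_scaleC mult.commute)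

lemma tensor_lift_abs:
  assumes \<beta>: "cbilinear \<beta>"
  shows "tensor_lift \<beta> (abs_tensor F) = pm_ext (\<lambda>k z. z *\<^sub>C \<beta> (fst k) (snd k)) F"
proof -
  have "tensor_rel (rep_tensor (abs_tensor F)) F"
    by (rule Quotient_rep_abs[OF Quotient_tensor]) (rule equivp_reflp[OF equivp_tensor_rel])
  then have "pm_ext (\<lambda>k z. z *\<^sub>C \<beta> (fst k) (snd k)) (rep_tensor (abs_tensor F) - F) = 0"
    unfolding tensor_rel_def by (rule tensor_null_pm_ext[OF \<beta>])
  then show ?thesis
    by (simp add: tensor_lift_def pm_ext_diff)
qed

lemma abs_tensor_surj: "\<exists>F. u = abs_tensor F"
  using Quotient_abs_rep[OF Quotient_tensor] by metis

lemma tensor_lift_add: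
  assumes "cbilinear \<beta>"
  shows "tensor_lift \<beta> (u + v) = tensor_lift \<beta> u + tensor_lift \<beta> v"
proof -
  obtain F G where "u = abs_tensor F" "v = abs_tensor G"
    using abs_tensor_surj by metis
  then show ?thesis
    by (simp add: plus_tensor.abs_eq tensor_lift_abs assms pm_ext_add)
qed

lemma tensor_lift_prod:
  assumes "cbilinear \<beta>"
  shows "tensor_lift \<beta> (x \<otimes>\<^sub>t y) = \<beta> x y"
  by (simp add: tensor_prod.abs_eq tensor_lift_abs assms pm_ext_single scaleC_one)

lemma abs_tensor_eqI: "F - G \<in> tensor_null \<Longrightarrow> abs_tensor F = abs_tensor G"
  by (rule Quotient_rel_abs[OF Quotient_tensor]) (simp add: tensor_rel_def)

lemma tensor_prod_add:
  "(x + x') \<otimes>\<^sub>t y = x \<otimes>\<^sub>t y + x' \<otimes>\<^sub>t y" "x \<otimes>\<^sub>t (y + y') = x \<otimes>\<^sub>t y + x \<otimes>\<^sub>t y'"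
  unfolding tensor_prod.abs_eq plus_tensor.abs_eq
  using tensor_null.add_left[of x x' y 1] tensor_null.add_right[of x y y' 1]
  by (auto intro!: abs_tensor_eqI simp: diff_diff_eq)

lemma scaleC_abs_single:
  "c *\<^sub>C abs_tensor (Poly_Mapping.single k z) = abs_tensor (Poly_Mapping.single k (c * z))"
  by (simp add: scaleC_tensor.abs_eq poly_scale_single)

lemma tensor_prod_scaleC:
  "(c *\<^sub>C x) \<otimes>\<^sub>t y = c *\<^sub>C (x \<otimes>\<^sub>t y)" "x \<otimes>\<^sub>t (c *\<^sub>C y) = c *\<^sub>C (x \<otimes>\<^sub>t y)"
  unfolding tensor_prod.abs_eq scaleC_abs_single
  using tensor_null.scale_left[of c x y 1] tensor_null.scale_right[of x c y 1]
  by (auto intro!: abs_tensor_eqI)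

lemma tensor_prod_0 [simp]: "0 \<otimes>\<^sub>t y = 0" "x \<otimes>\<^sub>t 0 = 0"
  using tensor_prod_scaleC(1)[of 0 0 y] tensor_prod_scaleC(2)[of x 0 0] by simp_all

lemma tensor_induct [case_names prod add]:
  assumes prod: "\<And>x y. P (x \<otimes>\<^sub>t y)" and add: "\<And>u v. P u \<Longrightarrow> P v \<Longrightarrow> P (u + v)"
  shows "P u"
proof -
  have zero: "P 0" using prod[of 0 0] by simp
  obtain F where u: "u = abs_tensor F"
    using abs_tensor_surj by metis
  have "Poly_Mapping.keys F \<subseteq> UNIV" by simp
  then have "P (abs_tensor F)"
  proof (induction F rule: pm_induct)
    case zero
    show ?case using \<open>P 0\<close> by (simp add: zero_tensor_def)
  next
    case (add_single F w z)
    have "abs_tensor (Poly_Mapping.single w z) = (z *\<^sub>C fst w) \<otimes>\<^sub>t snd w"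
      unfolding tensor_prod_scaleC unfolding tensor_prod.abs_eq scaleC_abs_single by simp
    then show ?case
      using add[OF add_single.IH prod] by (metis plus_tensor.abs_eq)
  qed
  then show ?thesis by (simp add: u)
qed

lemma tensor_lift_scaleC:
  assumes \<beta>: "cbilinear \<beta>"
  shows "tensor_lift \<beta> (c *\<^sub>C u) = c *\<^sub>C tensor_lift \<beta> u"
proof (induction u rule: tensor_induct)
  case (prod x y)
  show ?case
    unfolding tensor_prod_scaleC(1)[symmetric] tensor_lift_prod[OF \<beta>] by (rule cbilinearD[OF \<beta>])
qed (simp add: scaleC_add_right tensor_lift_add[OF \<beta>])

text \<open>The counterpart of \<open>tensor_map\<close> for globally linear maps, obtained from the
  universal property instead of a definite description; the computations are carried out with
  it.\<close>

definition tensor_hom ::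
  "('a::complex_vector \<Rightarrow> 'c::complex_vector) \<Rightarrow> ('b::complex_vector \<Rightarrow> 'd::complex_vector) \<Rightarrow>
    ('a, 'b) tensor \<Rightarrow> ('c, 'd) tensor" where
  "tensor_hom f g = tensor_lift (\<lambda>x y. f x \<otimes>\<^sub>t g y)"

lemma cbilinear_hom:
  "linear_map_on UNIV f \<Longrightarrow> linear_map_on UNIV g \<Longrightarrow> cbilinear (\<lambda>x y. f x \<otimes>\<^sub>t g y)"
  unfolding cbilinear_def linear_map_on_def by (simp add: tensor_prod_add tensor_prod_scaleC)

lemma tensor_hom_simps:
  assumes "linear_map_on UNIV f" "linear_map_on UNIV g"
  shows "tensor_hom f g (x \<otimes>\<^sub>t y) = f x \<otimes>\<^sub>t g y"
    "tensor_hom f g (u + v) = tensor_hom f g u + tensor_hom f g v"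
    "tensor_hom f g (c *\<^sub>C u) = c *\<^sub>C tensor_hom f g u"
    "tensor_hom f g 0 = 0"
proof -
  note b = cbilinear_hom[OF assms]
  show "tensor_hom f g (x \<otimes>\<^sub>t y) = f x \<otimes>\<^sub>t g y"
    "tensor_hom f g (u + v) = tensor_hom f g u + tensor_hom f g v"
    and sc: "tensor_hom f g (c *\<^sub>C u) = c *\<^sub>C tensor_hom f g u" for c u
    unfolding tensor_hom_def by (simp_all add: tensor_lift_prod[OF b] tensor_lift_add[OF b] tensor_lift_scaleC[OF b])
  show "tensor_hom f g 0 = 0"
    using sc[of 0 0] by simp
qed

lemma tensor_sum_simps [simp]:
  "tensor_sum [] = 0" "tensor_sum (z # zs) = fst z \<otimes>\<^sub>t snd z + tensor_sum zs"
  "tensor_sum (zs @ ws) = tensor_sum zs + tensor_sum ws"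
  by (simp_all add: tensor_sum_def split_beta)

lemma tensor_hom_sum:
  assumes "linear_map_on UNIV f" "linear_map_on UNIV g"
  shows "tensor_hom f g (tensor_sum zs) = tensor_sum (map (map_prod f g) zs)"
  by (induction zs) (simp_all add: tensor_hom_simps[OF assms])

lemma tensor_spanI: "x \<in> A \<Longrightarrow> y \<in> C \<Longrightarrow> x \<otimes>\<^sub>t y \<in> tensor_span A C"
  unfolding tensor_span_def by (intro image_eqI[of _ _ "[(x, y)]"]) auto

lemma tensor_span_0: "0 \<in> tensor_span A C"
  unfolding tensor_span_def by (intro image_eqI[of _ _ "[]"]) auto

lemma tensor_span_add:
  assumes "u \<in> tensor_span A C" "v \<in> tensor_span A C"
  shows "u + v \<in> tensor_span A C"
proof -
  obtain zs ws where "u = tensor_sum zs" "zs \<in> lists (A \<times> C)" "v = tensor_sum ws" "ws \<in> lists (A \<times> C)"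
    using assms unfolding tensor_span_def by auto
  then show ?thesis
    unfolding tensor_span_def by (intro image_eqI[of _ _ "zs @ ws"]) auto
qed

lemma tensor_span_induct [consumes 1, case_names zero prod add]:
  assumes "u \<in> tensor_span A C" and zero: "P 0"
    and prod: "\<And>x y. x \<in> A \<Longrightarrow> y \<in> C \<Longrightarrow> P (x \<otimes>\<^sub>t y)"
    and add: "\<And>u v. u \<in> tensor_span A C \<Longrightarrow> v \<in> tensor_span A C \<Longrightarrow> P u \<Longrightarrow> P v \<Longrightarrow> P (u + v)"
  shows "P u"
proof -
  obtain zs where u: "u = tensor_sum zs" "zs \<in> lists (A \<times> C)"
    using assms(1) unfolding tensor_span_def by auto
  have "tensor_sum zs \<in> tensor_span A C \<and> P (tensor_sum zs)"
    using u(2)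
  proof (induction zs)
    case (Cons z zs)
    then have "fst z \<otimes>\<^sub>t snd z \<in> tensor_span A C" "P (fst z \<otimes>\<^sub>t snd z)"
      by (auto intro!: tensor_spanI prod)
    with Cons show ?case
      by (simp add: tensor_span_add add)
  qed (simp add: zero tensor_span_0)
  then show ?thesis by (simp add: u)
qed

lemma tensor_span_mono: "A \<subseteq> A' \<Longrightarrow> C \<subseteq> C' \<Longrightarrow> tensor_span A C \<subseteq> tensor_span A' C'"
  unfolding tensor_span_def by (intro image_mono lists_mono Sigma_mono) auto

lemma tensor_span_UNIV: "u \<in> tensor_span UNIV UNIV"
  by (induction u rule: tensor_induct) (auto intro: tensor_spanI tensor_span_add)

lemma tensor_hom_cong:
  assumes u: "u \<in> tensor_span A C" and f: "linear_map_on UNIV f" "linear_map_on UNIV g"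
    and f': "linear_map_on UNIV f'" "linear_map_on UNIV g'"
    and eq: "\<And>a. a \<in> A \<Longrightarrow> f a = f' a" "\<And>c. c \<in> C \<Longrightarrow> g c = g' c"
  shows "tensor_hom f g u = tensor_hom f' g' u"
  using u by (induction rule: tensor_span_induct) (simp_all add: tensor_hom_simps[OF f] tensor_hom_simps[OF f'] eq)

text \<open>Only the values on the two subspaces matter, because a linear map on a subspace extends
  to the whole space.\<close>

lemma tensor_map_eq_hom:
  assumes A: "csubspace A" "linear_map_on A f" and C: "csubspace C" "linear_map_on C g"
    and f': "linear_map_on UNIV f'" "\<And>a. a \<in> A \<Longrightarrow> f' a = f a"
    and g': "linear_map_on UNIV g'" "\<And>c. c \<in> C \<Longrightarrow> g' c = g c"
    and u: "u \<in> tensor_span A C"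
  shows "tensor_map A C f g u = tensor_hom f' g' u"
  unfolding tensor_map_def
proof (rule the_equality)
  have eq: "tensor_sum (map (map_prod f g) zs) = tensor_hom f' g' (tensor_sum zs)" if "zs \<in> lists (A \<times> C)" for zs
  proof -
    have "map (map_prod f g) zs = map (map_prod f' g') zs"
      using that by (auto simp: f'(2) g'(2))
    then show ?thesis by (simp only: tensor_hom_sum[OF f'(1) g'(1)])
  qed
  obtain zs where "u = tensor_sum zs" "zs \<in> lists (A \<times> C)"
    using u unfolding tensor_span_def by auto
  then show "\<exists>zs\<in>lists (A \<times> C). u = tensor_sum zs \<and> tensor_hom f' g' u = tensor_sum (map (map_prod f g) zs)"
    by (intro bexI[of _ zs]) (simp_all add: eq)
  show "v = tensor_hom f' g' u"
    if "\<exists>zs\<in>lists (A \<times> C). u = tensor_sum zs \<and> v = tensor_sum (map (map_prod f g) zs)" for v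
    using that eq by auto
qed

lemma linear_map_on_mult:
  "linear_map_on UNIV (\<lambda>x. a * x)" "linear_map_on UNIV (\<lambda>x. x * a)" "linear_map_on UNIV (\<lambda>x. x)"
  for a :: "'h::chilbert_space bop"
  unfolding linear_map_on_def by (simp_all add: distrib_left distrib_right scaleC_mult_left scaleC_mult_right)

lemma tensor_lmult_hom: "tensor_lmult a = tensor_hom (\<lambda>x. a * x) (\<lambda>y. y)"
  unfolding tensor_lmult_def
  by (rule ext, rule tensor_map_eq_hom) (simp_all add: linear_map_on_mult tensor_span_UNIV)

lemma tensor_rmult_hom: "tensor_rmult u b = tensor_hom (\<lambda>x. x) (\<lambda>y. y * b) u"
  unfolding tensor_rmult_def
  by (rule tensor_map_eq_hom) (simp_all add: linear_map_on_mult tensor_span_UNIV)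

lemma tensor_lmult_simps [simp]:
  "tensor_lmult a (x \<otimes>\<^sub>t y) = (a * x) \<otimes>\<^sub>t y"
  "tensor_lmult a (u + v) = tensor_lmult a u + tensor_lmult a v"
  "tensor_lmult a (c *\<^sub>C u) = c *\<^sub>C tensor_lmult a u" "tensor_lmult a 0 = 0"
  unfolding tensor_lmult_hom by (simp_all add: tensor_hom_simps linear_map_on_mult)

lemma tensor_rmult_simps [simp]:
  "tensor_rmult (x \<otimes>\<^sub>t y) b = x \<otimes>\<^sub>t (y * b)"
  "tensor_rmult (u + v) b = tensor_rmult u b + tensor_rmult v b"
  "tensor_rmult (c *\<^sub>C u) b = c *\<^sub>C tensor_rmult u b" "tensor_rmult 0 b = 0"
  unfolding tensor_rmult_hom by (simp_all add: tensor_hom_simps linear_map_on_mult)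

lemma tensor_bimodule:
  "tensor_lmult (a * b) u = tensor_lmult a (tensor_lmult b u)"
  "tensor_rmult u (a * b) = tensor_rmult (tensor_rmult u a) b"
  "tensor_lmult a (tensor_rmult u b) = tensor_rmult (tensor_lmult a u) b"
  "tensor_lmult (a + b) u = tensor_lmult a u + tensor_lmult b u"
  "tensor_rmult u (a + b) = tensor_rmult u a + tensor_rmult u b"
  "tensor_lmult (c *\<^sub>C a) u = c *\<^sub>C tensor_lmult a u"
  "tensor_rmult u (c *\<^sub>C a) = c *\<^sub>C tensor_rmult u a"
  "tensor_lmult 1 u = u" "tensor_rmult u 1 = u" "tensor_lmult 0 u = 0" "tensor_rmult u 0 = 0"
  by (induction u rule: tensor_induct;
      simp add: mult.assoc distrib_left distrib_right scaleC_mult_left scaleC_mult_right tensor_prod_add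
        tensor_prod_scaleC scaleC_add_right add_ac)+

lemma tensor_span_lmult:
  assumes "u \<in> tensor_span A C" "\<And>x. x \<in> A \<Longrightarrow> a * x \<in> A'"
  shows "tensor_lmult a u \<in> tensor_span A' C"
  using assms(1) by (induction rule: tensor_span_induct)
    (auto intro: tensor_span_0 tensor_spanI tensor_span_add assms(2))

lemma tensor_span_rmult:
  assumes "u \<in> tensor_span A C" "\<And>y. y \<in> C \<Longrightarrow> y * b \<in> C'"
  shows "tensor_rmult u b \<in> tensor_span A C'"
  using assms(1) by (induction rule: tensor_span_induct)
    (auto intro: tensor_span_0 tensor_spanI tensor_span_add assms(2))

lemma tensor_span_scaleC:
  assumes "u \<in> tensor_span A C" "csubspace A"
  shows "c *\<^sub>C u \<in> tensor_span A C"
  using assms(1)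
proof (induction rule: tensor_span_induct)
  case (prod x y)
  then show ?case
    unfolding tensor_prod_scaleC(1)[symmetric] by (intro tensor_spanI csubspaceD(3)[OF assms(2)])
qed (simp_all add: tensor_span_0 scaleC_add_right tensor_span_add)

section \<open>Generated algebras\<close>

lemma subalgebra_Inter: "(\<And>A. A \<in> F \<Longrightarrow> subalgebra A) \<Longrightarrow> subalgebra (\<Inter>F)"
  unfolding subalgebra_def by simp

lemma subalgebra_alg_gen: "subalgebra (alg_gen S)"
  unfolding alg_gen_def hull_def by (rule subalgebra_Inter) auto

lemmas alg_gen_closed = subalgebraD[OF subalgebra_alg_gen]

lemma alg_gen_superset: "S \<subseteq> alg_gen S"
  unfolding alg_gen_def by (rule hull_subset)

lemma alg_gen_base: "x \<in> S \<Longrightarrow> x \<in> alg_gen S"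
  using alg_gen_superset[of S] by auto

lemma alg_gen_minimal: "S \<subseteq> A \<Longrightarrow> subalgebra A \<Longrightarrow> alg_gen S \<subseteq> A"
  unfolding alg_gen_def by (rule hull_minimal)

lemma alg_gen_mono: "S \<subseteq> T \<Longrightarrow> alg_gen S \<subseteq> alg_gen T"
  by (rule alg_gen_minimal[OF order_trans[OF _ alg_gen_superset] subalgebra_alg_gen])

lemma alg_gen_induct [consumes 1, case_names base zero add mult scale]:
  assumes x: "x \<in> alg_gen S" and base: "\<And>x. x \<in> S \<Longrightarrow> P x" and zero: "P 0"
    and add: "\<And>a b. a \<in> alg_gen S \<Longrightarrow> b \<in> alg_gen S \<Longrightarrow> P a \<Longrightarrow> P b \<Longrightarrow> P (a + b)"
    and mult: "\<And>a b. a \<in> alg_gen S \<Longrightarrow> b \<in> alg_gen S \<Longrightarrow> P a \<Longrightarrow> P b \<Longrightarrow> P (a * b)"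
    and scale: "\<And>c a. a \<in> alg_gen S \<Longrightarrow> P a \<Longrightarrow> P (c *\<^sub>C a)"
  shows "P x"
proof -
  have "subalgebra {x \<in> alg_gen S. P x}"
    unfolding subalgebra_def by (simp add: alg_gen_closed zero add mult scale)
  moreover have "S \<subseteq> {x \<in> alg_gen S. P x}"
    using alg_gen_superset[of S] base by auto
  ultimately have "alg_gen S \<subseteq> {x \<in> alg_gen S. P x}"
    by (intro alg_gen_minimal)
  then show ?thesis using x by auto
qed


section \<open>Free difference quotients\<close>

lemma free_difference_quotientD:
  assumes "is_free_difference_quotient e C X D"
  defines "A \<equiv> alg_gen (insert X C)"
  shows "a \<in> A \<Longrightarrow> D a \<in> tensor_span A A" "linear_map_on A D"
    "a \<in> A \<Longrightarrow> b \<in> A \<Longrightarrow> D (a + b) = D a + D b" "a \<in> A \<Longrightarrow> D (k *\<^sub>C a) = k *\<^sub>C D a"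
    "a \<in> A \<Longrightarrow> b \<in> A \<Longrightarrow> D (a * b) = tensor_rmult (D a) b + tensor_lmult a (D b)"
    "c \<in> C \<Longrightarrow> D c = 0" "D X = e \<otimes>\<^sub>t e" "D 0 = 0"
proof -
  show lin: "linear_map_on A D" "a \<in> A \<Longrightarrow> D a \<in> tensor_span A A"
    "a \<in> A \<Longrightarrow> b \<in> A \<Longrightarrow> D (a * b) = tensor_rmult (D a) b + tensor_lmult a (D b)"
    "c \<in> C \<Longrightarrow> D c = 0" "D X = e \<otimes>\<^sub>t e" for a b c
    using assms(1) unfolding is_free_difference_quotient_def Let_def A_def[symmetric] by auto
  show "a \<in> A \<Longrightarrow> b \<in> A \<Longrightarrow> D (a + b) = D a + D b" "a \<in> A \<Longrightarrow> D (k *\<^sub>C a) = k *\<^sub>C D a"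
    using lin(1) by (auto simp: linear_map_onD)
  show "D 0 = 0"
    by (rule linear_map_on_0[OF lin(1)]) (simp add: A_def csubspace_subalgebra subalgebra_alg_gen)
qed

lemma free_difference_quotient_unique:
  assumes D: "is_free_difference_quotient e C X D" and D': "is_free_difference_quotient e C X D'"
    and a: "a \<in> alg_gen (insert X C)"
  shows "D a = D' a"
  using a
proof (induction rule: alg_gen_induct)
  case (base x)
  then show ?case
    using free_difference_quotientD(6,7)[OF D] free_difference_quotientD(6,7)[OF D'] by auto
qed (simp_all add: free_difference_quotientD[OF D] free_difference_quotientD[OF D'])

text \<open>Restricting D to the algebra makes it extensional without affecting the axioms, so the
  restriction is the function singled out by the definite description.\<close>

lemma free_difference_quotient_eq:
  assumes D: "is_free_difference_quotient e C X D" and y: "y \<in> alg_gen (insert X C)"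
  shows "free_difference_quotient e C X y = D y"
proof -
  let ?A = "alg_gen (insert X C)" and ?D = "restrict D (alg_gen (insert X C))"
  have D': "is_free_difference_quotient e C X ?D"
    unfolding is_free_difference_quotient_def Let_def linear_map_on_def
    using free_difference_quotientD[OF D] by (auto simp: alg_gen_closed alg_gen_base)
  have "free_difference_quotient e C X = ?D"
    unfolding free_difference_quotient_def
  proof (rule the_equality)
    fix F assume F: "F \<in> extensional ?A \<and> is_free_difference_quotient e C X F"
    show "F = ?D"
      by (rule extensionalityI[OF conjunct1[OF F]])
        (simp_all only: restrict_extensional free_difference_quotient_unique[OF conjunct2[OF F] D'])
  qed (simp add: D')
  then show ?thesis using y by simp
qed

text \<open>A free difference quotient over \<open>C\<close> restricts to one over any smaller algebra \<open>B\<close>, so no algebraic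
  freeness from \<open>B\<close> has to be checked.\<close>

lemma free_difference_quotient_span:
  assumes D: "is_free_difference_quotient e C X D"
    and sub: "S \<subseteq> alg_gen (insert X C)" and S: "\<And>s. s \<in> S \<Longrightarrow> D s \<in> tensor_span (alg_gen S) (alg_gen S)"
    and y: "y \<in> alg_gen S"
  shows "D y \<in> tensor_span (alg_gen S) (alg_gen S)"
proof -
  have le: "a \<in> alg_gen (insert X C)" if "a \<in> alg_gen S" for a
    using alg_gen_minimal[OF sub subalgebra_alg_gen] that by auto
  note Dd = free_difference_quotientD[OF D]
  show ?thesis
    using y
  proof (induction rule: alg_gen_induct)
    case (mult a b)
    have "tensor_rmult (D a) b \<in> tensor_span (alg_gen S) (alg_gen S)"
      by (rule tensor_span_rmult[OF mult(3)]) (simp add: alg_gen_closed mult)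
    moreover have "tensor_lmult a (D b) \<in> tensor_span (alg_gen S) (alg_gen S)"
      by (rule tensor_span_lmult[OF mult(4)]) (simp add: alg_gen_closed mult)
    ultimately show ?case
      by (simp add: Dd le mult tensor_span_add)
  qed (simp_all add: Dd le S tensor_span_add tensor_span_0 tensor_span_scaleC csubspace_subalgebra
      subalgebra_alg_gen)
qed

subsection \<open>Existence\<close>

definition word_eval :: "'h::chilbert_space bop \<Rightarrow> 'h bop option list \<Rightarrow> 'h bop" where
  "word_eval X w = prod_list (map (case_option X (\<lambda>c. c)) w)"

lemma word_eval_simps [simp]:
  "word_eval X [] = 1" "word_eval X (None # w) = X * word_eval X w"
  "word_eval X (Some c # w) = c * word_eval X w" "word_eval X (u @ v) = word_eval X u * word_eval X v"
  by (simp_all add: word_eval_def)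

lemma nc_eval_pm_ext: "nc_eval e X = pm_ext (\<lambda>w z. z *\<^sub>C (e * word_eval X w))"
  by (simp add: fun_eq_iff nc_eval_def pm_ext_def word_eval_def)

lemma nc_words_simps [simp]:
  "[] \<in> nc_words C" "l # w \<in> nc_words C \<longleftrightarrow> (l = None \<or> l \<in> Some ` C) \<and> w \<in> nc_words C"
  "u @ v \<in> nc_words C \<longleftrightarrow> u \<in> nc_words C \<and> v \<in> nc_words C"
  by (auto simp: nc_words_def)

text \<open>The sum of u(X) \<otimes> v(X) over all factorisations u t v of the word. Both halves
  are evaluated at once, so no tensor product of polynomial algebras is involved.\<close>

fun word_deriv :: "'h::chilbert_space bop \<Rightarrow> 'h bop option list \<Rightarrow> ('h bop, 'h bop) tensor" where
  "word_deriv X [] = 0"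
| "word_deriv X (None # w) = 1 \<otimes>\<^sub>t word_eval X w + tensor_lmult X (word_deriv X w)"
| "word_deriv X (Some c # w) = tensor_lmult c (word_deriv X w)"

lemma word_deriv_append:
  "word_deriv X (u @ v) = tensor_rmult (word_deriv X u) (word_eval X v) + tensor_lmult (word_eval X u) (word_deriv X v)"
  by (induction X u rule: word_deriv.induct) (simp_all add: tensor_bimodule add.assoc)

definition poly_deriv :: "'h::chilbert_space bop \<Rightarrow> ('h bop option list \<Rightarrow>\<^sub>0 complex) \<Rightarrow> ('h bop, 'h bop) tensor" where
  "poly_deriv X = pm_ext (\<lambda>w z. z *\<^sub>C word_deriv X w)"

text \<open>The relations concern coefficient letters only. These have derivative zero, and where
  another letter is differentiated they enter through evaluations, which respect the
  relations.\<close>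

lemma poly_deriv_nc_ideal: "f \<in> nc_ideal 1 A \<Longrightarrow> poly_deriv X f = 0"
proof (induction rule: nc_ideal.induct)
  case (add_rel u v c d z)
  have "word_deriv X (u @ [Some (c + d)] @ v) = word_deriv X (u @ [Some c] @ v) + word_deriv X (u @ [Some d] @ v)"
    by (simp add: word_deriv_append tensor_bimodule distrib_right distrib_left add_ac)
  then show ?case
    by (simp only: poly_deriv_def pm_ext_diff pm_ext_single coeff_additive_scaleC scaleC_add_right) simp
next
  case (scale_rel u v c k z)
  have "word_deriv X (u @ [Some (k *\<^sub>C c)] @ v) = k *\<^sub>C word_deriv X (u @ [Some c] @ v)"
    by (simp add: word_deriv_append tensor_bimodule scaleC_mult_left scaleC_mult_right scaleC_add_right)
  then show ?case
    by (simp only: poly_deriv_def pm_ext_diff pm_ext_single coeff_additive_scaleC scaleC_scaleC mult.commute) simp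
next
  case (mult_rel u v c d z)
  have "word_deriv X (u @ [Some (c * d)] @ v) = word_deriv X (u @ [Some c, Some d] @ v)"
    by (simp add: word_deriv_append tensor_bimodule mult.assoc)
  then show ?case
    by (simp only: poly_deriv_def pm_ext_diff pm_ext_single coeff_additive_scaleC) simp
next
  case (unit_rel u v z)
  have "word_deriv X (u @ [Some 1] @ v) = word_deriv X (u @ v)"
    by (simp add: word_deriv_append tensor_bimodule)
  then show ?case
    by (simp only: poly_deriv_def pm_ext_diff pm_ext_single coeff_additive_scaleC) simp
qed (simp_all add: poly_deriv_def pm_ext_diff)

lemma keys_add_single:
  "Poly_Mapping.keys f \<subseteq> W \<Longrightarrow> w \<in> W \<Longrightarrow> Poly_Mapping.keys (f + Poly_Mapping.single w z) \<subseteq> W"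
  by (rule order_trans[OF keys_add]) auto

lemma keys_add_subset:
  "Poly_Mapping.keys f \<subseteq> W \<Longrightarrow> Poly_Mapping.keys g \<subseteq> W \<Longrightarrow> Poly_Mapping.keys (f + g) \<subseteq> W"
  by (rule order_trans[OF keys_add]) auto

text \<open>In place of a product of polynomials, a witness with the value and derivative of the
  product is exhibited; appending w to each word of f provides it.\<close>

lemma poly_mult_single_exists:
  assumes "Poly_Mapping.keys f \<subseteq> nc_words A" "w \<in> nc_words A"
  shows "\<exists>h. Poly_Mapping.keys h \<subseteq> nc_words A \<and> nc_eval 1 X h = nc_eval 1 X f * (z *\<^sub>C word_eval X w)
    \<and> poly_deriv X h = tensor_rmult (poly_deriv X f) (z *\<^sub>C word_eval X w)
        + tensor_lmult (nc_eval 1 X f) (z *\<^sub>C word_deriv X w)"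
  using assms(1)
proof (induction f rule: pm_induct)
  case zero
  show ?case
    by (rule exI[of _ 0]) (simp add: nc_eval_pm_ext poly_deriv_def tensor_bimodule)
next
  case (add_single f w' z')
  then obtain h where h: "Poly_Mapping.keys h \<subseteq> nc_words A"
    "nc_eval 1 X h = nc_eval 1 X f * (z *\<^sub>C word_eval X w)"
    "poly_deriv X h = tensor_rmult (poly_deriv X f) (z *\<^sub>C word_eval X w)
        + tensor_lmult (nc_eval 1 X f) (z *\<^sub>C word_deriv X w)"
    by auto
  let ?h = "h + Poly_Mapping.single (w' @ w) (z' * z)"
  have "nc_eval 1 X ?h = nc_eval 1 X (f + Poly_Mapping.single w' z') * (z *\<^sub>C word_eval X w)"
    using h(2) by (simp add: nc_eval_pm_ext pm_ext_add pm_ext_single distrib_right scaleC_mult_left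
        scaleC_mult_right scaleC_scaleC scaleC_add_right mult.commute)
  moreover have "poly_deriv X ?h = tensor_rmult (poly_deriv X (f + Poly_Mapping.single w' z')) (z *\<^sub>C word_eval X w)
        + tensor_lmult (nc_eval 1 X (f + Poly_Mapping.single w' z')) (z *\<^sub>C word_deriv X w)"
  proof -
    have "poly_deriv X ?h = poly_deriv X h + (z' * z) *\<^sub>C word_deriv X (w' @ w)"
      by (simp add: poly_deriv_def pm_ext_add pm_ext_single)
    moreover have "poly_deriv X (f + Poly_Mapping.single w' z') = poly_deriv X f + z' *\<^sub>C word_deriv X w'"
      by (simp add: poly_deriv_def pm_ext_add pm_ext_single)
    moreover have "nc_eval 1 X (f + Poly_Mapping.single w' z') = nc_eval 1 X f + z' *\<^sub>C word_eval X w'"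
      by (simp add: nc_eval_pm_ext pm_ext_add pm_ext_single)
    ultimately show ?thesis
      by (simp add: h(3) word_deriv_append tensor_bimodule scaleC_add_right scaleC_scaleC mult.commute add_ac)
  qed
  ultimately show ?case
    using keys_add_single[OF h(1), of "w' @ w"] add_single.hyps(2) assms(2) by auto
qed

lemma poly_mult_exists:
  assumes f: "Poly_Mapping.keys f \<subseteq> nc_words A" and g: "Poly_Mapping.keys g \<subseteq> nc_words A"
  shows "\<exists>h. Poly_Mapping.keys h \<subseteq> nc_words A \<and> nc_eval 1 X h = nc_eval 1 X f * nc_eval 1 X g
    \<and> poly_deriv X h = tensor_rmult (poly_deriv X f) (nc_eval 1 X g) + tensor_lmult (nc_eval 1 X f) (poly_deriv X g)"
  using g
proof (induction g rule: pm_induct)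
  case zero
  show ?case
    by (rule exI[of _ 0]) (simp add: nc_eval_pm_ext poly_deriv_def tensor_bimodule)
next
  case (add_single g w z)
  then obtain h where h: "Poly_Mapping.keys h \<subseteq> nc_words A"
    "nc_eval 1 X h = nc_eval 1 X f * nc_eval 1 X g"
    "poly_deriv X h = tensor_rmult (poly_deriv X f) (nc_eval 1 X g) + tensor_lmult (nc_eval 1 X f) (poly_deriv X g)"
    by auto
  obtain k where k: "Poly_Mapping.keys k \<subseteq> nc_words A"
    "nc_eval 1 X k = nc_eval 1 X f * (z *\<^sub>C word_eval X w)"
    "poly_deriv X k = tensor_rmult (poly_deriv X f) (z *\<^sub>C word_eval X w)
        + tensor_lmult (nc_eval 1 X f) (z *\<^sub>C word_deriv X w)"
    using poly_mult_single_exists[OF f add_single.hyps(2)] by metis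
  have ev: "nc_eval 1 X (a + b) = nc_eval 1 X a + nc_eval 1 X b"
    "poly_deriv X (a + b) = poly_deriv X a + poly_deriv X b" for a b
    by (simp_all add: nc_eval_pm_ext poly_deriv_def pm_ext_add)
  have single: "nc_eval 1 X (Poly_Mapping.single w z) = z *\<^sub>C word_eval X w"
    "poly_deriv X (Poly_Mapping.single w z) = z *\<^sub>C word_deriv X w"
    by (simp_all add: nc_eval_pm_ext poly_deriv_def pm_ext_single)
  show ?case
  proof (intro exI[of _ "h + k"] conjI)
    show "Poly_Mapping.keys (h + k) \<subseteq> nc_words A"
      by (rule keys_add_subset[OF h(1) k(1)])
    show "nc_eval 1 X (h + k) = nc_eval 1 X f * nc_eval 1 X (g + Poly_Mapping.single w z)"
      unfolding ev single h(2) k(2) by (simp only: distrib_left)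
    show "poly_deriv X (h + k) = tensor_rmult (poly_deriv X f) (nc_eval 1 X (g + Poly_Mapping.single w z))
        + tensor_lmult (nc_eval 1 X f) (poly_deriv X (g + Poly_Mapping.single w z))"
      unfolding ev single h(3) k(3) tensor_bimodule(5) tensor_lmult_simps(2) by (simp only: add_ac)
  qed
qed

text \<open>Differentiate any polynomial representing y. By algebraic freeness two representatives
  differ by an element of \<open>nc_ideal\<close>, so the result depends on y alone.\<close>

theorem free_difference_quotient_exists:
  assumes A: "subalgebra A" "1 \<in> A" and free: "algebraically_free 1 A X"
  shows "\<exists>D. is_free_difference_quotient 1 A X D"
proof -
  let ?A = "alg_gen (insert X A)"
  define R where "R f y \<longleftrightarrow> Poly_Mapping.keys f \<subseteq> nc_words A \<and> nc_eval 1 X f = y" for f y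
  have unique: "poly_deriv X f = poly_deriv X g" if "R f y" "R g y" for f g y
  proof -
    have "f - g \<in> nc_ideal 1 A"
      using that free by (simp add: R_def algebraically_free_def)
    from poly_deriv_nc_ideal[OF this, of X] show ?thesis
      by (simp add: poly_deriv_def pm_ext_diff)
  qed
  have word: "R (Poly_Mapping.single w 1) (word_eval X w)"
    "poly_deriv X (Poly_Mapping.single w 1) = word_deriv X w" if "w \<in> nc_words A" for w
    using that by (auto simp: R_def nc_eval_pm_ext poly_deriv_def pm_ext_single scaleC_one)
  have R_add: "R (f + g) (a + b)" "poly_deriv X (f + g) = poly_deriv X f + poly_deriv X g"
    if "R f a" "R g b" for f g a b
    using that keys_add_subset[of f _ g] by (simp_all add: R_def nc_eval_pm_ext poly_deriv_def pm_ext_add)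
  have R_mult: "\<exists>h. R h (a * b) \<and> poly_deriv X h = tensor_rmult (poly_deriv X f) b + tensor_lmult a (poly_deriv X g)"
    if "R f a" "R g b" for f g a b
    using poly_mult_exists[of f A g X] that unfolding R_def by metis
  have R_scale: "\<exists>h. R h (c *\<^sub>C a) \<and> poly_deriv X h = c *\<^sub>C poly_deriv X f" if f: "R f a" for f a c
  proof -
    \<comment> \<open>Scaling is realised as multiplication by the one-letter word whose coefficient
      is c times the unit.\<close>
    have w: "[Some (c *\<^sub>C 1)] \<in> nc_words A"
      using subalgebraD(4)[OF A] by simp
    from R_mult[OF word(1)[OF w] f] show ?thesis
      unfolding word(2)[OF w] by (simp add: scaleC_mult_left tensor_bimodule)
  qed
  have ex: "\<exists>f. R f y \<and> poly_deriv X f \<in> tensor_span ?A ?A" if "y \<in> ?A" for y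
    using that
  proof (induction rule: alg_gen_induct)
    case (base x)
    show ?case
    proof (cases "x = X")
      case True
      then show ?thesis
        using word[of "[None]"] alg_gen_base[of 1 "insert X A"] A(2)
        by (intro exI[of _ "Poly_Mapping.single [None] 1"]) (simp add: tensor_spanI)
    next
      case False
      then show ?thesis
        using word[of "[Some x]"] base
        by (intro exI[of _ "Poly_Mapping.single [Some x] 1"]) (simp add: tensor_span_0)
    qed
  next
    case zero
    show ?case
      by (rule exI[of _ 0]) (simp add: R_def nc_eval_pm_ext poly_deriv_def tensor_span_0)
  next
    case (add a b)
    then obtain f g where "R f a" "poly_deriv X f \<in> tensor_span ?A ?A" "R g b" "poly_deriv X g \<in> tensor_span ?A ?A"
      by auto
    then show ?case
      using R_add[of f a g b] by (intro exI[of _ "f + g"]) (simp add: tensor_span_add)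
  next
    case (mult a b)
    then obtain f g where f: "R f a" "poly_deriv X f \<in> tensor_span ?A ?A"
      and g: "R g b" "poly_deriv X g \<in> tensor_span ?A ?A"
      by auto
    obtain h where h: "R h (a * b)"
      "poly_deriv X h = tensor_rmult (poly_deriv X f) b + tensor_lmult a (poly_deriv X g)"
      using R_mult[OF f(1) g(1)] by auto
    have "tensor_rmult (poly_deriv X f) b \<in> tensor_span ?A ?A"
      by (rule tensor_span_rmult[OF f(2)]) (simp add: alg_gen_closed mult)
    moreover have "tensor_lmult a (poly_deriv X g) \<in> tensor_span ?A ?A"
      by (rule tensor_span_lmult[OF g(2)]) (simp add: alg_gen_closed mult)
    ultimately show ?case
      using h by (intro exI[of _ h]) (simp add: tensor_span_add)
  next
    case (scale c a)
    then obtain f where f: "R f a" "poly_deriv X f \<in> tensor_span ?A ?A"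
      by auto
    obtain h where "R h (c *\<^sub>C a)" "poly_deriv X h = c *\<^sub>C poly_deriv X f"
      using R_scale[OF f(1)] by auto
    then show ?case
      using f(2) by (intro exI[of _ h]) (simp add: tensor_span_scaleC csubspace_subalgebra subalgebra_alg_gen)
  qed
  define D where "D y = poly_deriv X (SOME f. R f y)" for y
  have D: "D y = poly_deriv X f" if "R f y" for f y
    unfolding D_def by (rule unique[OF someI[of "\<lambda>f. R f y", OF that] that])
  have "is_free_difference_quotient 1 A X D"
    unfolding is_free_difference_quotient_def Let_def linear_map_on_def
  proof (intro conjI ballI allI)
    show "D \<in> ?A \<rightarrow> tensor_span ?A ?A"
      using ex D by fastforce
    show "D (a + b) = D a + D b" if ab: "a \<in> ?A" "b \<in> ?A" for a b
    proof -
      obtain f g where fg: "R f a" "R g b" using ex ab by metis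
      then show ?thesis
        using D[OF R_add(1)[OF fg]] R_add(2)[OF fg] by (simp add: D)
    qed
    show "D (c *\<^sub>C a) = c *\<^sub>C D a" if ab: "a \<in> ?A" for c a
    proof -
      obtain f where f: "R f a" using ex ab by metis
      obtain h where "R h (c *\<^sub>C a)" "poly_deriv X h = c *\<^sub>C poly_deriv X f"
        using R_scale[OF f] by auto
      then show ?thesis using D f by simp
    qed
    show "D (a * b) = tensor_rmult (D a) b + tensor_lmult a (D b)" if ab: "a \<in> ?A" "b \<in> ?A" for a b
    proof -
      obtain f g where fg: "R f a" "R g b" using ex ab by metis
      obtain h where "R h (a * b)"
        "poly_deriv X h = tensor_rmult (poly_deriv X f) b + tensor_lmult a (poly_deriv X g)"
        using R_mult[OF fg] by auto
      then show ?thesis using D fg by simp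
    qed
    show "D c = 0" if "c \<in> A" for c
    proof -
      have w: "[Some c] \<in> nc_words A" using that by simp
      show ?thesis using D[of _ c] word[OF w] by simp
    qed
    have w: "[None] \<in> nc_words A" by simp
    show "D X = 1 \<otimes>\<^sub>t 1"
      using D[of _ X] word[OF w] by simp
  qed
  then show ?thesis by auto
qed


section \<open>Algebraic freeness in the corner\<close>

lemma nc_ideal_add: "f \<in> nc_ideal e C \<Longrightarrow> g \<in> nc_ideal e C \<Longrightarrow> f + g \<in> nc_ideal e C"
  using nc_ideal.diff[of f e C "0 - g"] nc_ideal.diff[OF nc_ideal.zero, of g e C] by simp

lemma nc_ideal_trans:
  assumes "f - g \<in> nc_ideal e C" "g - h \<in> nc_ideal e C"
  shows "f - h \<in> nc_ideal e C"
  using nc_ideal_add[OF assms] by simp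

fun var_degree :: "'a option list \<Rightarrow> nat" where
  "var_degree [] = 0"
| "var_degree (None # w) = Suc (var_degree w)"
| "var_degree (Some c # w) = var_degree w"

lemma var_degree_append [simp]: "var_degree (u @ v) = var_degree u + var_degree v"
  by (induction u rule: var_degree.induct) auto

fun inflate_word :: "'a \<Rightarrow> 'a option list \<Rightarrow> 'a option list" where
  "inflate_word p [] = []"
| "inflate_word p (None # w) = Some p # None # Some p # inflate_word p w"
| "inflate_word p (Some c # w) = Some c # inflate_word p w"

definition deflate_word :: "'a::times \<Rightarrow> 'a option list \<Rightarrow> 'a option list" where
  "deflate_word p = map (map_option (\<lambda>a. a * p))"

lemma deflate_word_simps [simp]:
  "deflate_word p [] = []" "deflate_word p (None # w) = None # deflate_word p w"
  "deflate_word p (Some c # w) = Some (c * p) # deflate_word p w"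
  "deflate_word p (u @ v) = deflate_word p u @ deflate_word p v"
  by (simp_all add: deflate_word_def)

lemma var_degree_inflate [simp]: "var_degree (inflate_word p w) = var_degree w"
  by (induction p w rule: inflate_word.induct) auto

lemma var_degree_deflate [simp]: "var_degree (deflate_word p w) = var_degree w"
  by (induction w rule: var_degree.induct) auto

text \<open>The inclusion of the corner is \<open>t \<mapsto> \<beta> p t p\<close> on noncommutative polynomials. Since \<open>p\<close> is
  central in \<open>A\<close>, it has the left inverse \<open>a \<mapsto> a p\<close>, \<open>t \<mapsto> \<beta>\<^sup>-\<^sup>1 t\<close>, so it is injective.\<close>

lemma algebraically_free_corner:
  fixes A :: "'h::chilbert_space bop set"
  assumes A: "subalgebra A" "p \<in> A" and p: "p * p = p" "\<And>a. a \<in> A \<Longrightarrow> p * a = a * p"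
    and \<beta>: "\<alpha> * \<beta> = 1" and free: "algebraically_free 1 A X"
  shows "algebraically_free p ((\<lambda>a. a * p) ` A) (\<beta> *\<^sub>C (p * X * p))"
proof -
  let ?C = "(\<lambda>a. a * p) ` A" and ?Y = "\<beta> *\<^sub>C (p * X * p)"
  \<comment> \<open>The leading letter p mirrors the factor \<open>e\<close> in
    \<open>nc_eval\<close>: in the corner the empty word evaluates to p, not to 1.\<close>
  define T where "T = pm_ext (\<lambda>w z. Poly_Mapping.single (Some p # inflate_word p w) (\<beta> ^ var_degree w * z))"
  define R where "R = pm_ext (\<lambda>w z. Poly_Mapping.single (deflate_word p w) (\<alpha> ^ var_degree w * z))"
  have T: "coeff_additive (\<lambda>w z. Poly_Mapping.single (Some p # inflate_word p w) (\<beta> ^ var_degree w * z))"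
    and R: "coeff_additive (\<lambda>w z. Poly_Mapping.single (deflate_word p w) (\<alpha> ^ var_degree w * z))"
    by (simp_all add: coeff_additive_def distrib_left single_add)
  have CA: "c \<in> A" if "c \<in> ?C" for c
    using that subalgebraD(3)[OF A(1) _ A(2)] by auto
  have Cp: "c * p = c" if "c \<in> ?C" for c
    using that p(1) by (auto simp: mult.assoc)
  have pC: "p \<in> ?C"
    using A(2) p(1) by (intro image_eqI[of _ _ p]) auto
  have T_words: "inflate_word p w \<in> nc_words A" if "w \<in> nc_words ?C" for w
    using that by (induction w rule: var_degree.induct) (use A(2) CA in auto)
  have R_words: "deflate_word p w \<in> nc_words ?C" if "w \<in> nc_words A" for w
    using that by (induction w rule: var_degree.induct) auto
  have T_keys: "Poly_Mapping.keys (T f) \<subseteq> nc_words A" if "Poly_Mapping.keys f \<subseteq> nc_words ?C" for f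
    using that
  proof (induction f rule: pm_induct)
    case (add_single f w z)
    then show ?case
      unfolding T_def pm_ext_add[OF T] pm_ext_single[OF T]
      by (intro keys_add_single) (simp_all add: T_words A(2))
  qed (simp add: T_def)
  have T_eval: "nc_eval 1 X (T f) = nc_eval p ?Y f" if "Poly_Mapping.keys f \<subseteq> UNIV" for f
    using that
  proof (induction f rule: pm_induct)
    case (add_single f w z)
    have word: "\<beta> ^ var_degree w *\<^sub>C word_eval X (inflate_word p w) = word_eval ?Y w"
    proof (induction w rule: var_degree.induct)
      case (2 w)
      have "\<beta> ^ var_degree (None # w) *\<^sub>C word_eval X (inflate_word p (None # w))
          = \<beta> *\<^sub>C (p * X * p * (\<beta> ^ var_degree w *\<^sub>C word_eval X (inflate_word p w)))"
        by (simp add: scaleC_mult_right scaleC_scaleC mult.assoc)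
      then show ?case
        by (simp only: 2 word_eval_simps scaleC_mult_left)
    next
      case (3 c w)
      then show ?case
        by (simp add: scaleC_mult_right flip: 3)
    qed (simp add: scaleC_one)
    have "(\<beta> ^ var_degree w * z) *\<^sub>C (p * word_eval X (inflate_word p w))
        = z *\<^sub>C (p * (\<beta> ^ var_degree w *\<^sub>C word_eval X (inflate_word p w)))"
      by (simp add: scaleC_mult_right scaleC_scaleC mult.commute)
    then have "(\<beta> ^ var_degree w * z) *\<^sub>C (p * word_eval X (inflate_word p w)) = z *\<^sub>C (p * word_eval ?Y w)"
      by (simp only: word)
    with add_single.IH show ?case
      by (simp add: T_def pm_ext_add[OF T] pm_ext_single[OF T] nc_eval_pm_ext pm_ext_add pm_ext_single)
  qed (simp add: T_def nc_eval_pm_ext)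
  have R_ideal: "R f \<in> nc_ideal p ?C" if "f \<in> nc_ideal 1 A" for f
    using that
  proof (induction rule: nc_ideal.induct)
    case zero
    show ?case by (simp add: R_def nc_ideal.zero)
  next
    case (diff f g)
    then show ?case
      by (simp add: R_def pm_ext_diff[OF R] nc_ideal.diff)
  next
    case (add_rel u v c d z)
    then show ?case
      using nc_ideal.add_rel[of "deflate_word p u" ?C "deflate_word p v" "c * p" "d * p" "\<alpha> ^ (var_degree u + var_degree v) * z"]
      by (simp add: R_def pm_ext_diff[OF R] pm_ext_single[OF R] R_words distrib_right)
  next
    case (scale_rel u v c k z)
    then show ?case
      using nc_ideal.scale_rel[of "deflate_word p u" ?C "deflate_word p v" "c * p" k "\<alpha> ^ (var_degree u + var_degree v) * z"]
      by (simp add: R_def pm_ext_diff[OF R] pm_ext_single[OF R] R_words scaleC_mult_left mult.left_commute)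
  next
    case (mult_rel u v c d z)
    have "c * d * p = (c * p) * (d * p)"
      using p(1) p(2)[OF mult_rel(4)] by (metis mult.assoc)
    then show ?case
      using nc_ideal.mult_rel[of "deflate_word p u" ?C "deflate_word p v" "c * p" "d * p" "\<alpha> ^ (var_degree u + var_degree v) * z"]
        mult_rel by (simp add: R_def pm_ext_diff[OF R] pm_ext_single[OF R] R_words)
  next
    case (unit_rel u v z)
    then show ?case
      using nc_ideal.unit_rel[of "deflate_word p u" ?C "deflate_word p v" p "\<alpha> ^ (var_degree u + var_degree v) * z"]
      by (simp add: R_def pm_ext_diff[OF R] pm_ext_single[OF R] R_words)
  qed
  \<comment> \<open>Deflating an inflated word leaves a letter p on either side of each t. Unit
    relations of the corner erase these one at a time, with u recording the part already
    cleaned.\<close>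
  have word: "Poly_Mapping.single (u @ deflate_word p (inflate_word p w)) z - Poly_Mapping.single (u @ w) z \<in> nc_ideal p ?C"
    if "u \<in> nc_words ?C" "w \<in> nc_words ?C" for u w z
    using that
  proof (induction w arbitrary: u rule: var_degree.induct)
    case 1
    show ?case by (simp add: nc_ideal.zero)
  next
    case (2 w)
    let ?r = "deflate_word p (inflate_word p w)"
    have r: "?r \<in> nc_words ?C"
      using 2 by (intro R_words T_words) simp
    have "Poly_Mapping.single (u @ [Some p] @ ([None, Some p] @ ?r)) z
        - Poly_Mapping.single (u @ ([None, Some p] @ ?r)) z \<in> nc_ideal p ?C"
      using 2 r pC by (intro nc_ideal.unit_rel) auto
    moreover have "Poly_Mapping.single ((u @ [None]) @ [Some p] @ ?r) z
        - Poly_Mapping.single ((u @ [None]) @ ?r) z \<in> nc_ideal p ?C"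
      using 2 r by (intro nc_ideal.unit_rel) auto
    moreover have "Poly_Mapping.single ((u @ [None]) @ ?r) z - Poly_Mapping.single ((u @ [None]) @ w) z \<in> nc_ideal p ?C"
      using 2 by (intro 2(1)) auto
    ultimately have "Poly_Mapping.single (u @ [Some p] @ ([None, Some p] @ ?r)) z
        - Poly_Mapping.single ((u @ [None]) @ w) z \<in> nc_ideal p ?C"
      using nc_ideal_trans by (metis append.assoc append_Cons append_Nil)
    then show ?case
      using p(1) by simp
  next
    case (3 c w)
    have "c \<in> ?C" "w \<in> nc_words ?C"
      using 3(3) by auto
    then show ?case
      using 3(1)[of "u @ [Some c]"] 3(2) Cp[of c] by simp
  qed
  have inverse: "R (T f) - f \<in> nc_ideal p ?C" if "Poly_Mapping.keys f \<subseteq> nc_words ?C" for f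
    using that
  proof (induction f rule: pm_induct)
    case zero
    show ?case by (simp add: R_def T_def nc_ideal.zero)
  next
    case (add_single f w z)
    have "\<alpha> ^ var_degree w * \<beta> ^ var_degree w = 1"
      using \<beta> by (metis power_mult_distrib power_one)
    then have "R (T (f + Poly_Mapping.single w z)) - (f + Poly_Mapping.single w z)
      = (R (T f) - f) + (Poly_Mapping.single (Some p # deflate_word p (inflate_word p w)) z - Poly_Mapping.single w z)"
      using p(1) by (simp add: mult.assoc[symmetric] T_def R_def pm_ext_add[OF T] pm_ext_single[OF T] pm_ext_add[OF R] pm_ext_single[OF R])
    moreover have "Poly_Mapping.single (Some p # deflate_word p (inflate_word p w)) z - Poly_Mapping.single w z \<in> nc_ideal p ?C"
    proof (rule nc_ideal_trans)
      show "Poly_Mapping.single (Some p # deflate_word p (inflate_word p w)) z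
          - Poly_Mapping.single (Some p # w) z \<in> nc_ideal p ?C"
        using word[of "[Some p]" w z] pC add_single.hyps(2) by simp
      show "Poly_Mapping.single (Some p # w) z - Poly_Mapping.single w z \<in> nc_ideal p ?C"
        using nc_ideal.unit_rel[of "[]" ?C w p z] add_single.hyps(2) by simp
    qed
    ultimately show ?case
      using add_single.IH by (simp only: nc_ideal_add)
  qed
  show ?thesis
    unfolding algebraically_free_def
  proof (intro allI impI)
    fix f g assume f: "Poly_Mapping.keys f \<subseteq> nc_words ?C" and g: "Poly_Mapping.keys g \<subseteq> nc_words ?C"
      and eq: "nc_eval p ?Y f = nc_eval p ?Y g"
    have "T f - T g \<in> nc_ideal 1 A"
      using free T_keys[OF f] T_keys[OF g] eq unfolding algebraically_free_def by (simp add: T_eval)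
    from R_ideal[OF this] have "R (T f) - R (T g) \<in> nc_ideal p ?C"
      by (simp add: R_def pm_ext_diff[OF R])
    moreover have "f - R (T f) \<in> nc_ideal p ?C"
      using nc_ideal.diff[OF nc_ideal.zero inverse[OF f]] by simp
    ultimately show "f - g \<in> nc_ideal p ?C"
      using inverse[OF g] by (metis nc_ideal_trans)
  qed
qed

section \<open>Alternating words\<close>

text \<open>Only the core of a word, starting and ending in A with all letters centred; the outer
  factors from C, not necessarily centred, are attached in \<open>alternating_span\<close>. Growth
  on the right matches the later right multiplication by generators.\<close>

inductive_set alternating_words ::
  "'h::chilbert_space bop set \<Rightarrow> 'h bop set \<Rightarrow> ('h bop \<Rightarrow> 'h bop) \<Rightarrow> 'h bop list set"
  for A C :: "'h bop set" and F :: "'h bop \<Rightarrow> 'h bop" where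
  single: "a \<in> A \<Longrightarrow> F a = 0 \<Longrightarrow> [a] \<in> alternating_words A C F"
| snoc: "w \<in> alternating_words A C F \<Longrightarrow> x \<in> C \<Longrightarrow> F x = 0 \<Longrightarrow> a \<in> A \<Longrightarrow> F a = 0 \<Longrightarrow>
    w @ [x, a] \<in> alternating_words A C F"

text \<open>The clause \<open>last is\<close> records that the word ends in A, which keeps the index
  list alternating when a letter of C is appended.\<close>

lemma alternating_words_indices:
  assumes "w \<in> alternating_words A C F"
  shows "\<exists>is. is \<noteq> [] \<and> last is \<and> distinct_adj is \<and>
    list_all2 (\<lambda>i a. a \<in> (if i then A else C) \<and> F a = 0) is w"
  using assms
proof (induction rule: alternating_words.induct)
  case (single a)
  then show ?case by (intro exI[of _ "[True]"]) auto
next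
  case (snoc w x a)
  then obtain "is" where "is": "is \<noteq> []" "last is" "distinct_adj is"
    "list_all2 (\<lambda>i a. a \<in> (if i then A else C) \<and> F a = 0) is w"
    by auto
  then show ?case
    using snoc.hyps
    by (intro exI[of _ "is @ [False, True]"]) (auto simp: distinct_adj_append_iff intro!: list_all2_appendI)
qed

lemma free_over_alternating:
  assumes free: "free_over F (\<lambda>i. if i then A else C)" and w: "w \<in> alternating_words A C F"
  shows "F (prod_list w) = 0" "x \<in> C \<Longrightarrow> F x = 0 \<Longrightarrow> F (prod_list w * x) = 0"
proof -
  obtain "is" where "is": "is \<noteq> []" "last is" "distinct_adj is"
    "list_all2 (\<lambda>i a. a \<in> (if i then A else C) \<and> F a = 0) is w"
    using alternating_words_indices[OF w] by auto
  have "w \<noteq> []"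
    using "is"(1,4) by auto
  then show "F (prod_list w) = 0"
    using free "is"(3,4) unfolding free_over_def by blast
  show "F (prod_list w * x) = 0" if x: "x \<in> C" "F x = 0"
  proof -
    have "list_all2 (\<lambda>i a. a \<in> (if i then A else C) \<and> F a = 0) (is @ [False]) (w @ [x])"
      by (intro list_all2_appendI "is"(4)) (simp add: x)
    moreover have "distinct_adj (is @ [False])"
      using "is" by (auto simp: distinct_adj_append_iff)
    moreover have "w @ [x] \<noteq> []" by simp
    ultimately have "F (prod_list (w @ [x])) = 0"
      using free unfolding free_over_def by blast
    then show ?thesis by simp
  qed
qed

inductive_set alternating_span ::
  "'h::chilbert_space bop set \<Rightarrow> 'h bop set \<Rightarrow> ('h bop \<Rightarrow> 'h bop) \<Rightarrow> 'h bop set"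
  for A C :: "'h bop set" and F :: "'h bop \<Rightarrow> 'h bop" where
  zero: "0 \<in> alternating_span A C F"
| word: "w \<in> alternating_words A C F \<Longrightarrow> x \<in> C \<Longrightarrow> y \<in> C \<Longrightarrow> x * prod_list w * y \<in> alternating_span A C F"
| add: "k \<in> alternating_span A C F \<Longrightarrow> l \<in> alternating_span A C F \<Longrightarrow> k + l \<in> alternating_span A C F"

lemma alternating_span_bimodule:
  assumes C: "subalgebra C" and k: "k \<in> alternating_span A C F" and c: "c \<in> C"
  shows "c * k \<in> alternating_span A C F" "k * c \<in> alternating_span A C F"
proof -
  show "c * k \<in> alternating_span A C F"
    using k
  proof (induction rule: alternating_span.induct)
    case (word w x y)
    have "(c * x) * prod_list w * y \<in> alternating_span A C F"
      by (intro alternating_span.word word subalgebraD(3)[OF C] c)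
    then show ?case by (simp add: mult.assoc)
  qed (simp_all add: alternating_span.zero alternating_span.add distrib_left)
  show "k * c \<in> alternating_span A C F"
    using k
  proof (induction rule: alternating_span.induct)
    case (word w x y)
    have "x * prod_list w * (y * c) \<in> alternating_span A C F"
      by (intro alternating_span.word word subalgebraD(3)[OF C] c)
    then show ?case by (simp add: mult.assoc)
  qed (simp_all add: alternating_span.zero alternating_span.add distrib_right)
qed


section \<open>Free difference quotients and conditional expectations\<close>

locale free_pair = tracial_von_neumann_algebra M \<tau>
  for M :: "'h::chilbert_space bop set" and \<tau> :: "'h bop \<Rightarrow> complex" +
  fixes B :: "'h bop set" and X p :: "'h bop"
  assumes B: "von_neumann_algebra B" "B \<subseteq> M" and X: "X \<in> M" "adj X = X" and p: "p \<in> M"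
    and free: "amalg_free_with M \<tau> B p X"
    and alg_free: "algebraically_free 1 (alg_gen (insert p B)) X"
begin

abbreviation "A \<equiv> alg_gen (insert p B)"
abbreviation "C \<equiv> alg_gen (insert X B)"
abbreviation "D \<equiv> alg_gen (insert X A)"
abbreviation "F \<equiv> cond_exp M \<tau> B"
abbreviation "E \<equiv> cond_exp M \<tau> C"
abbreviation "K \<equiv> alternating_span A C F"

lemma BA: "b \<in> B \<Longrightarrow> b \<in> A" and BC: "b \<in> B \<Longrightarrow> b \<in> C" and AD: "a \<in> A \<Longrightarrow> a \<in> D"
  by (simp_all add: alg_gen_base)

lemma CD: "C \<subseteq> D"
  by (rule alg_gen_mono) (auto simp: alg_gen_base)

lemma AM: "A \<subseteq> M" and CM: "C \<subseteq> M"
  using B(2) X p by (auto intro!: alg_gen_minimal M(1) del: subsetI)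

lemma DM: "D \<subseteq> M"
  using X AM by (intro alg_gen_minimal M(1)) auto

lemma one: "1 \<in> B" "1 \<in> A" "1 \<in> C"
  using von_neumann_algebraD(2)[OF B(1)] by (simp_all add: BA BC)

lemma adj_C: "c \<in> C \<Longrightarrow> adj c \<in> C"
proof (induction rule: alg_gen_induct)
  case (base x)
  then show ?case
    using X von_neumann_algebraD(3)[OF B(1)] by (auto simp: alg_gen_base)
qed (simp_all add: alg_gen_closed)

lemma expectation_B: "trace_preserving_cond_exp M \<tau> B F"
  using cond_exp_trace_preserving[OF B(2)] by (simp add: vn_gen_eq B(1))

lemmas F = trace_preserving_cond_expD[OF expectation_B B]

lemma N: "von_neumann_algebra (vn_gen C)" "vn_gen C \<subseteq> M"
  by (rule von_neumann_algebra_vn_gen, rule vn_gen_minimal[OF CM vna])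

lemmas E = trace_preserving_cond_expD[OF cond_exp_trace_preserving[OF CM] N]

lemma CN: "c \<in> C \<Longrightarrow> c \<in> vn_gen C"
  using vn_gen_superset[of C] by auto

section \<open>Centring of letters over B\<close>

lemma F_center:
  assumes "a \<in> M"
  shows "F (a - F a) = 0"
proof -
  have Fa: "F a \<in> B" using F(1) assms .
  then have "F a \<in> M" using B(2) by auto
  then have "F (a + (- 1) *\<^sub>C F a) = F a + (- 1) *\<^sub>C F (F a)"
    using assms by (simp add: F M)
  then show ?thesis
    using F(2)[OF Fa] by (simp add: scaleC_minus_one)
qed

lemma split_A:
  assumes "a \<in> A"
  obtains b a' where "a = b + a'" "b \<in> B" "a' \<in> A" "F a' = 0"
proof
  have "a \<in> M" using AM assms by auto
  then show "F a \<in> B" "F (a - F a) = 0" by (auto simp: F F_center)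
  then show "a - F a \<in> A" using assms BA by (intro alg_gen_closed)
qed simp

lemma split_C:
  assumes "c \<in> C"
  obtains b c' where "c = b + c'" "b \<in> B" "c' \<in> C" "F c' = 0"
proof
  have "c \<in> M" using CM assms by auto
  then show "F c \<in> B" "F (c - F c) = 0" by (auto simp: F F_center)
  then show "c - F c \<in> C" using assms BC by (intro alg_gen_closed)
qed simp

lemma free_AC: "free_over F (\<lambda>i. if i then A else C)"
  using free by (simp add: amalg_free_with_def)

lemma alternating_words_D: "w \<in> alternating_words A C F \<Longrightarrow> prod_list w \<in> D"
  by (induction rule: alternating_words.induct) (use CD in \<open>auto simp: AD alg_gen_closed subset_iff\<close>)

lemma K_D: "k \<in> K \<Longrightarrow> k \<in> D"
  by (induction rule: alternating_span.induct)
    (use CD in \<open>auto simp: alternating_words_D alg_gen_closed subset_iff\<close>)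

text \<open>Freeness makes an alternating word orthogonal to \<open>C\<close>, hence to the von Neumann algebra
  generated by \<open>C\<close>.\<close>

lemma E_alternating_word:
  assumes w: "w \<in> alternating_words A C F"
  shows "E (prod_list w) = 0"
proof -
  have wM: "prod_list w \<in> M"
    using alternating_words_D[OF w] DM by auto
  have zero: "\<tau> (prod_list w * c) = 0" if c: "c \<in> C" for c
  proof -
    \<comment> \<open>The centred part of c lengthens the alternating word, while the part in B can
      be taken out of F on the right; both contributions vanish.\<close>
    obtain b c' where bc: "c = b + c'" "b \<in> B" "c' \<in> C" "F c' = 0"
      using split_C[OF c] by metis
    have m: "b \<in> M" "c' \<in> M" "c \<in> M"
      using bc B(2) CM c by auto
    have "F (prod_list w * c) = F (prod_list w) * b + F (prod_list w * c')"
      using m wM bc(2) by (simp add: bc(1) distrib_left F M)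
    then have "F (prod_list w * c) = 0"
      using free_over_alternating[OF free_AC w] bc(3,4) by simp
    then show ?thesis
      using F(8)[of "prod_list w * c"] wM m by (simp add: M tau_0)
  qed
  show ?thesis
  proof (rule tau_separates[OF N])
    show "\<tau> (E (prod_list w) * z) = \<tau> (0 * z)" if z: "z \<in> vn_gen C" for z
      using tau_eq_0_vn_gen[OF subalgebra_alg_gen one(3) adj_C CM wM zero z] E(9)[OF wM z]
      by (simp add: tau_0)
  qed (simp_all add: E wM von_neumann_algebraD[OF N(1)])
qed

lemma E_0: "E 0 = 0"
  using E(4)[of 0 0] M(4) by simp

lemma E_K: "k \<in> K \<Longrightarrow> E k = 0"
proof (induction rule: alternating_span.induct)
  case (word w x y)
  have "prod_list w \<in> M"
    using alternating_words_D[OF word(1)] DM by auto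
  then show ?case
    using E(5)[of "prod_list w" x y] word E_alternating_word by (simp add: CN)
next
  case (add k l)
  then show ?case
    using K_D DM by (simp add: E subset_iff)
qed (rule E_0)


text \<open>Every element of \<open>D\<close> is the sum of an element of \<open>C\<close> and one of \<open>K\<close>: the set of these sums
  contains \<open>1\<close> and is stable under right multiplication by the generators.\<close>

definition decomposable :: "'h bop \<Rightarrow> bool" where
  "decomposable z \<longleftrightarrow> (\<exists>c\<in>C. \<exists>k\<in>K. z = c + k)"

lemma decomposable_C: "c \<in> C \<Longrightarrow> decomposable c"
  unfolding decomposable_def by (intro bexI[of _ c] bexI[of _ 0]) (auto simp: alternating_span.zero)

lemma decomposable_K: "k \<in> K \<Longrightarrow> decomposable k"
  unfolding decomposable_def by (intro bexI[of _ 0] bexI[of _ k]) (auto simp: alg_gen_closed)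

lemma decomposable_add:
  assumes "decomposable y" "decomposable z"
  shows "decomposable (y + z)"
proof -
  obtain c k c' k' where "c \<in> C" "k \<in> K" "y = c + k" "c' \<in> C" "k' \<in> K" "z = c' + k'"
    using assms unfolding decomposable_def by auto
  then show ?thesis
    unfolding decomposable_def
    by (intro bexI[of _ "c + c'"] bexI[of _ "k + k'"]) (auto simp: alg_gen_closed alternating_span.add)
qed

lemma decomposable_right_C:
  assumes "decomposable z" "c \<in> C"
  shows "decomposable (z * c)"
proof -
  obtain d k where "d \<in> C" "k \<in> K" "z = d + k"
    using assms(1) unfolding decomposable_def by auto
  then have "d * c \<in> C" "k * c \<in> K" "z * c = d * c + k * c"
    using assms(2) by (auto simp: alg_gen_closed alternating_span_bimodule subalgebra_alg_gen distrib_right)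
  then show ?thesis
    unfolding decomposable_def by auto
qed

lemma decomposable_left_C:
  assumes "decomposable z" "c \<in> C"
  shows "decomposable (c * z)"
proof -
  obtain d k where "d \<in> C" "k \<in> K" "z = d + k"
    using assms(1) unfolding decomposable_def by auto
  then have "c * d \<in> C" "c * k \<in> K" "c * z = c * d + c * k"
    using assms(2) by (auto simp: alg_gen_closed alternating_span_bimodule subalgebra_alg_gen distrib_left)
  then show ?thesis
    unfolding decomposable_def by auto
qed

lemma decomposable_A:
  assumes "a \<in> A"
  shows "decomposable a"
proof -
  obtain b a' where ba: "a = b + a'" "b \<in> B" "a' \<in> A" "F a' = 0"
    using split_A[OF assms] by metis
  have "1 * prod_list [a'] * 1 \<in> K"
    by (intro alternating_span.word alternating_words.single ba one)
  then have "decomposable (b + a')"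
    using ba(2) by (intro decomposable_add decomposable_C decomposable_K) (simp_all add: BC)
  then show ?thesis by (simp add: ba(1))
qed

text \<open>Split a = b + a'. The centred a' prolongs the word, while b is absorbed into x, which
  then becomes the right outer factor in C.\<close>

lemma decomposable_snoc_A:
  assumes w: "w \<in> alternating_words A C F" and x: "x \<in> C" "F x = 0" and a: "a \<in> A"
  shows "decomposable (prod_list w * x * a)"
proof -
  obtain b a' where ba: "a = b + a'" "b \<in> B" "a' \<in> A" "F a' = 0"
    using split_A[OF a] by metis
  have "1 * prod_list (w @ [x, a']) * 1 \<in> K"
    by (intro alternating_span.word alternating_words.snoc w x ba one)
  moreover have "1 * prod_list w * (x * b) \<in> K"
    by (intro alternating_span.word w one alg_gen_closed x BC ba)
  ultimately have "decomposable (1 * prod_list w * (x * b) + 1 * prod_list (w @ [x, a']) * 1)"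
    by (intro decomposable_add decomposable_K)
  then show ?thesis
    by (simp add: ba(1) distrib_left mult.assoc)
qed

text \<open>Merging a with the last letter spoils its centring, so the merged letter is treated as a
  new one to be split again.\<close>

lemma decomposable_word_A:
  assumes w: "w \<in> alternating_words A C F" and a: "a \<in> A"
  shows "decomposable (prod_list w * a)"
  using w
proof cases
  case (single a1)
  then show ?thesis
    using a by (simp add: decomposable_A alg_gen_closed)
next
  case (snoc w' x a1)
  have "decomposable (prod_list w' * x * (a1 * a))"
    using snoc a by (intro decomposable_snoc_A) (simp_all add: alg_gen_closed)
  then show ?thesis
    by (simp add: snoc(1) mult.assoc)
qed

lemma decomposable_right_A:
  assumes z: "decomposable z" and a: "a \<in> A"
  shows "decomposable (z * a)"
proof -
  have "decomposable (k * a)" if "k \<in> K" for k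
    using that
  proof (induction rule: alternating_span.induct)
    case (word w x y)
    \<comment> \<open>The outer factor y turns into an inner one: its part in B merges with a, and
      its centred part becomes a letter of the word.\<close>
    obtain b y' where by': "y = b + y'" "b \<in> B" "y' \<in> C" "F y' = 0"
      using split_C[OF word(3)] by metis
    have "decomposable (prod_list w * (b * a))"
      by (intro decomposable_word_A word alg_gen_closed BA by' a)
    moreover have "decomposable (prod_list w * y' * a)"
      by (intro decomposable_snoc_A word by' a)
    ultimately have "decomposable (x * (prod_list w * (b * a) + prod_list w * y' * a))"
      by (rule decomposable_left_C[OF decomposable_add word(2)])
    then show ?case
      by (simp add: by'(1) distrib_left distrib_right mult.assoc)
  qed (simp_all add: distrib_right decomposable_add decomposable_C alg_gen_closed)
  moreover have "decomposable (c * a)" if "c \<in> C" for c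
    using that a by (intro decomposable_left_C decomposable_A)
  moreover obtain c k where "c \<in> C" "k \<in> K" "z = c + k"
    using z unfolding decomposable_def by auto
  ultimately show ?thesis
    by (simp add: distrib_right decomposable_add)
qed

lemma decomposable_D:
  assumes "d \<in> D"
  shows "decomposable d"
proof -
  \<comment> \<open>Quantifying over the left factor z makes the product case two successive
    applications of the induction hypotheses.\<close>
  have "decomposable (z * d)" if "decomposable z" for z
    using assms that
  proof (induction arbitrary: z rule: alg_gen_induct)
    case (base x)
    then show ?case
      by (auto intro: decomposable_right_A decomposable_right_C alg_gen_base)
  next
    case zero
    show ?case by (simp add: decomposable_C alg_gen_closed)
  next
    case (add a b)
    then show ?case by (simp add: distrib_left decomposable_add)
  next
    case (mult a b)
    from mult(4)[OF mult(3)[OF mult(5)]] show ?case by (simp add: mult.assoc)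
  next
    case (scale c a)
    have "c *\<^sub>C 1 \<in> C" using one(3) by (rule alg_gen_closed)
    then have "decomposable ((z * a) * (c *\<^sub>C 1))"
      by (rule decomposable_right_C[OF scale(2)[OF scale(3)]])
    then show ?case by (simp add: scaleC_mult_right)
  qed
  from this[OF decomposable_C[OF one(3)]] show ?thesis by simp
qed

text \<open>By the decomposition, E maps \<open>D\<close> into the algebra \<open>C\<close> itself
  and not merely into its weak closure. This gives the claim that \<Psi> takes values in the algebra
  generated by B and X.\<close>

lemma E_D: "d \<in> D \<Longrightarrow> E d \<in> C"
proof -
  assume "d \<in> D"
  then obtain c k where ck: "c \<in> C" "k \<in> K" "d = c + k"
    using decomposable_D[of d] unfolding decomposable_def by auto
  then show "E d \<in> C"
    using CM DM K_D[OF ck(2)] by (simp add: E E_K CN subset_iff)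
qed

section \<open>The derivation on \<open>C\<close> and on alternating words\<close>

lemma derivative_C:
  assumes d: "is_free_difference_quotient 1 A X d"
  shows "c \<in> C \<Longrightarrow> d c \<in> tensor_span C C" "is_free_difference_quotient 1 B X d"
proof -
  note dD = free_difference_quotientD[OF d]
  show dC: "d c \<in> tensor_span C C" if "c \<in> C" for c
  proof (rule free_difference_quotient_span[OF d _ _ that])
    show "insert X B \<subseteq> D"
      using alg_gen_base[of X "insert X A"] BA AD by auto
    show "d s \<in> tensor_span C C" if "s \<in> insert X B" for s
      using that BA by (auto simp: dD tensor_spanI one tensor_span_0)
  qed
  show "is_free_difference_quotient 1 B X d"
    unfolding is_free_difference_quotient_def Let_def linear_map_on_def
    using CD BA by (auto simp: dD dC subset_iff)
qed

text \<open>Each term of the derivative of an alternating word contains a centred letter of \<open>A\<close> in one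
  of its two tensor factors, and that factor is killed by \<open>E\<close>.\<close>

lemma derivative_alternating_word:
  assumes d: "is_free_difference_quotient 1 A X d" and w: "w \<in> alternating_words A C F"
  shows "d (prod_list w) \<in> tensor_span K D"
  using w
proof (induction rule: alternating_words.induct)
  case (single a)
  then show ?case
    by (simp add: free_difference_quotientD[OF d] tensor_span_0)
next
  case (snoc w x a)
  have D': "prod_list w \<in> D" "x \<in> D" "a \<in> D" "x * a \<in> D"
    using snoc CD by (auto simp: alternating_words_D AD alg_gen_closed subset_iff)
  \<comment> \<open>The letter a is a constant of d, so only the earlier word and x are
    differentiated. Differentiating x leaves the whole earlier word in the left factor, which
    therefore lies in \<open>K\<close>.\<close>
  have "d (x * a) = tensor_rmult (d x) a"
    using D' snoc(4) by (simp add: free_difference_quotientD[OF d] tensor_lmult_simps)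
  then have "d (prod_list (w @ [x, a]))
      = tensor_rmult (d (prod_list w)) (x * a) + tensor_rmult (tensor_lmult (prod_list w) (d x)) a"
    using D' by (simp add: free_difference_quotientD[OF d] tensor_bimodule)
  moreover have "tensor_rmult (d (prod_list w)) (x * a) \<in> tensor_span K D"
    by (rule tensor_span_rmult[OF snoc.IH]) (simp add: alg_gen_closed D')
  moreover have "tensor_rmult (tensor_lmult (prod_list w) (d x)) a \<in> tensor_span K D"
  proof (rule tensor_span_rmult[OF tensor_span_lmult[OF derivative_C(1)[OF d snoc(2)]]])
    show "prod_list w * c \<in> K" if "c \<in> C" for c
      using alternating_span.word[OF snoc(1) one(3) that] by simp
    show "c * a \<in> D" if "c \<in> C" for c
      using that CD D' by (auto simp: alg_gen_closed subset_iff)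
  qed
  ultimately show ?case
    by (simp add: tensor_span_add)
qed

text \<open>\<open>E'\<close> stands in for E, which is specified on \<open>M\<close> only. Since d
  y is a sum of tensors from \<open>D\<close>, inside \<open>M\<close>, the choice of the extension
  does not affect the left-hand side.\<close>

theorem expectation_derivative:
  assumes d: "is_free_difference_quotient 1 A X d"
    and E': "linear_map_on UNIV E'" "\<And>m. m \<in> M \<Longrightarrow> E' m = E m"
    and y: "y \<in> D"
  shows "tensor_hom E' E' (d y) = d (E y)"
proof -
  note dD = free_difference_quotientD[OF d]
  note dC = derivative_C(1)[OF d]
  have E'C: "E' c = c" if "c \<in> C" for c
    using that CM by (simp add: E' E CN subset_iff)
  have E'K: "E' k = 0" if "k \<in> K" for k
    using that K_D DM by (simp add: E' E_K subset_iff)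
  have hom_C: "tensor_hom E' E' (d c) = d c" if "c \<in> C" for c
  proof -
    have "tensor_hom E' E' (d c) = tensor_hom (\<lambda>x. x) (\<lambda>x. x) (d c)"
      by (rule tensor_hom_cong[OF dC[OF that]]) (simp_all add: E' E'C linear_map_on_mult)
    also have "tensor_hom (\<lambda>x. x) (\<lambda>x. x) u = u" for u :: "('h bop, 'h bop) tensor"
      by (induction u rule: tensor_induct) (simp_all add: tensor_hom_simps linear_map_on_mult)
    finally show ?thesis .
  qed
  have kill_left: "tensor_hom E' E' u = 0" if "u \<in> tensor_span K D" for u
    using that by (induction rule: tensor_span_induct) (simp_all add: tensor_hom_simps E' E'K)
  have kill_right: "tensor_hom E' E' u = 0" if "u \<in> tensor_span C K" for u
    using that by (induction rule: tensor_span_induct) (simp_all add: tensor_hom_simps E' E'K)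
  have hom_K: "tensor_hom E' E' (d k) = 0" if "k \<in> K" for k
    using that
  proof (induction rule: alternating_span.induct)
    case zero
    show ?case by (simp add: dD tensor_hom_simps E')
  next
    case (add k l)
    then show ?case by (simp add: dD K_D tensor_hom_simps E')
  next
    case (word w x y)
    let ?w = "prod_list w"
    have D': "?w \<in> D" "x \<in> D" "y \<in> D" "x * ?w \<in> D"
      using word CD by (auto simp: alternating_words_D alg_gen_closed subset_iff)
    have wK: "?w * c \<in> K" if "c \<in> C" for c
      using alternating_span.word[OF word(1) one(3) that] by simp
    \<comment> \<open>The core stays in the right factor when x is differentiated and in the left
      factor when y is; the middle term differentiates the core itself and has left factors in
      \<open>K\<close>.\<close>
    have "d (x * ?w * y) = tensor_rmult (d x) (?w * y) + tensor_rmult (tensor_lmult x (d ?w)) y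
        + tensor_lmult (x * ?w) (d y)"
      using D' by (simp add: dD tensor_bimodule)
    moreover have "tensor_rmult (d x) (?w * y) \<in> tensor_span C K"
      using wK[OF word(3)] by (intro tensor_span_rmult[OF dC[OF word(2)]])
        (simp add: alternating_span_bimodule subalgebra_alg_gen)
    moreover have "tensor_rmult (tensor_lmult x (d ?w)) y \<in> tensor_span K D"
      by (intro tensor_span_rmult[OF tensor_span_lmult[OF derivative_alternating_word[OF d word(1)]]])
        (simp_all add: alternating_span_bimodule subalgebra_alg_gen word(2) alg_gen_closed D')
    moreover have "tensor_lmult (x * ?w) (d y) \<in> tensor_span K C"
      using wK by (intro tensor_span_lmult[OF dC[OF word(3)]])
        (simp add: mult.assoc alternating_span_bimodule subalgebra_alg_gen word(2))
    then have "tensor_lmult (x * ?w) (d y) \<in> tensor_span K D"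
      using tensor_span_mono[OF order_refl CD] by auto
    ultimately show ?case
      by (simp add: tensor_hom_simps E' kill_left kill_right)
  qed
  obtain c k where ck: "c \<in> C" "k \<in> K" "y = c + k"
    using decomposable_D[OF y] unfolding decomposable_def by auto
  have m: "c \<in> D" "k \<in> D" "c \<in> M" "k \<in> M"
    using ck CD CM K_D DM by auto
  have "E y = c"
    using ck m by (simp add: E E_K CN)
  then show ?thesis
    using ck m by (simp add: dD tensor_hom_simps E' hom_C hom_K)
qed

end


section \<open>The compressed pair\<close>

theorem proposition3p4:
  fixes M B :: "'h::chilbert_space bop set"
    and \<tau> :: "'h bop \<Rightarrow> complex"
    and X p Xp :: "'h bop"
    and \<alpha> :: complex
    and \<psi> \<Psi> :: "'h bop \<Rightarrow> 'h bop"
  assumes "von_neumann_algebra M"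
    and "faithful_normal_trace_state M \<tau>"
    and "von_neumann_algebra B" and "B \<subseteq> M"
    and "X \<in> M" and "adj X = X"
    and "p \<in> M" and "adj p = p" and "p * p = p" and "p \<noteq> 0"
    and "amalg_free_with M \<tau> B p X"
    and "\<forall>b\<in>B. p * b = b * p"
    and "algebraically_free 1 (alg_gen (insert p B)) X"
    and "\<alpha> = \<tau> p"
    and "Xp = inverse \<alpha> *\<^sub>C (p * X * p)"
    and "\<forall>m\<in>M. \<psi> (p * m * p) = inverse \<alpha> *\<^sub>C (p * m * p)"
    and "\<forall>m\<in>M. \<Psi> (p * m * p) = cond_exp M \<tau> (alg_gen (insert X B)) (\<psi> (p * m * p))"
  shows "algebraically_free p ((\<lambda>b. b * p) ` B) Xp
    \<and> (\<forall>y \<in> alg_gen (insert Xp ((\<lambda>b. b * p) ` B)).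
         \<Psi> y \<in> alg_gen (insert X B)
         \<and> tensor_map (alg_gen (insert Xp ((\<lambda>b. b * p) ` B))) (alg_gen (insert Xp ((\<lambda>b. b * p) ` B)))
               \<Psi> \<Psi> (free_difference_quotient p ((\<lambda>b. b * p) ` B) Xp y)
             = free_difference_quotient 1 B X (\<Psi> y))"
proof -
  interpret free_pair M \<tau> B X p
    using assms by unfold_locales
  note pp = assms(9) and com = assms(12)
  let ?\<beta> = "inverse \<alpha>"
  let ?Bp = "(\<lambda>b. b * p) ` B"
  let ?Q = "alg_gen (insert Xp ?Bp)"
  \<comment> \<open>As a projection p equals \<open>adj p * p\<close>, so faithfulness excludes
    trace zero for a nonzero p.\<close>
  have "\<tau> p \<noteq> 0"
    using tau_faithful[OF p] assms(8-10) by auto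
  then have \<alpha>: "\<alpha> * ?\<beta> = 1"
    by (simp add: assms(14))
  have pA: "p \<in> A" by (simp add: alg_gen_base)
  have Bp_A: "b \<in> ?Bp \<Longrightarrow> b \<in> A" for b
    using pA by (auto simp: BA alg_gen_closed)
  have comA: "p * a = a * p" if "a \<in> A" for a
    using that
  proof (induction rule: alg_gen_induct)
    case (mult a b)
    then show ?case by (metis mult.assoc)
  qed (auto simp: com distrib_left distrib_right scaleC_mult_left scaleC_mult_right)
  \<comment> \<open>Multiplication by p turns each p inside an element of B[p] into the corner unit,
    so the compression of B[p] is just Bp and freeness from B[p] can be compressed.\<close>
  have Ap: "a * p \<in> ?Bp" if "a \<in> A" for a
    using that
  proof (induction rule: alg_gen_induct)
    case (base x)
    have "p * p \<in> ?Bp" using pp one(1) by (intro image_eqI[of _ _ 1]) simp_all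
    then show ?case using base by auto
  next
    case zero
    show ?case by (intro image_eqI[of _ _ 0]) (simp_all add: von_neumann_algebraD[OF B(1)])
  next
    case (add a b)
    then obtain a' b' where "a * p = a' * p" "a' \<in> B" "b * p = b' * p" "b' \<in> B" by auto
    then show ?case
      by (intro image_eqI[of _ _ "a' + b'"]) (simp_all add: distrib_right von_neumann_algebraD[OF B(1)])
  next
    case (mult a b)
    then obtain a' b' where ab: "a * p = a' * p" "a' \<in> B" "b * p = b' * p" "b' \<in> B" by auto
    have "a * b * p = a * (b' * p)"
      by (simp add: mult.assoc ab(3))
    also have "\<dots> = (a * p) * b'"
      using com ab(4) by (simp add: mult.assoc)
    also have "\<dots> = a' * (p * b')"
      by (simp add: ab(1) mult.assoc)
    also have "\<dots> = (a' * b') * p"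
      using com ab(4) by (simp add: mult.assoc)
    finally show ?case
      using ab by (intro image_eqI[of _ _ "a' * b'"]) (simp_all add: von_neumann_algebraD[OF B(1)])
  next
    case (scale c a)
    then obtain a' where "a * p = a' * p" "a' \<in> B" by auto
    then show ?case
      by (intro image_eqI[of _ _ "c *\<^sub>C a'"]) (simp_all add: scaleC_mult_left von_neumann_algebraD[OF B(1)])
  qed
  have "(\<lambda>a. a * p) ` A = ?Bp"
    using Ap BA by auto
  then have corner_free: "algebraically_free p ?Bp Xp"
    using algebraically_free_corner[OF subalgebra_alg_gen pA pp comA \<alpha> alg_free] by (simp add: assms(15))
  have X_D: "X \<in> D" and p_D: "p \<in> D"
    using pA by (simp_all add: alg_gen_base AD)
  have Xp_D: "Xp \<in> D"
    unfolding assms(15) by (intro alg_gen_closed X_D p_D)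
  have Q_D: "?Q \<subseteq> D"
    using Xp_D Bp_A AD by (intro alg_gen_minimal subalgebra_alg_gen) auto
  \<comment> \<open>\<psi> and \<Psi> are specified only on elements of the form p m p; this puts
    the corner algebra into that form.\<close>
  have Q_p: "p * y * p = y" if "y \<in> ?Q" for y
  proof -
    have "p * y = y \<and> y * p = y"
      using that
    proof (induction rule: alg_gen_induct)
      case (base x)
      then consider "x = Xp" | b where "b \<in> B" "x = b * p" by auto
      then show ?case
      proof cases
        case 1
        have "p * (p * X * p) = p * X * p" "p * X * p * p = p * X * p"
          using pp by (metis mult.assoc)+
        then show ?thesis
          by (simp add: 1 assms(15) scaleC_mult_left scaleC_mult_right)
      next
        case (2 b)
        have "p * (b * p) = b * (p * p)"
          using com 2(1) by (metis mult.assoc)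
        then show ?thesis
          using pp by (simp add: 2(2) mult.assoc)
      qed
    next
      case (mult a b)
      then show ?case by (metis mult.assoc)
    qed (simp_all add: distrib_left distrib_right scaleC_mult_left scaleC_mult_right)
    then show ?thesis by simp
  qed
  have \<Psi>: "\<Psi> y = ?\<beta> *\<^sub>C E y" if y: "y \<in> ?Q" for y
  proof -
    have "y \<in> M" using y Q_D DM by auto
    then show ?thesis
      using assms(16,17) Q_p[OF y] by (metis E(4))
  qed
  obtain d where d: "is_free_difference_quotient 1 A X d"
    using free_difference_quotient_exists[OF subalgebra_alg_gen one(2) alg_free] by auto
  note dD = free_difference_quotientD[OF d]
  have d_Xp: "\<alpha> *\<^sub>C d Xp = p \<otimes>\<^sub>t p"
  proof -
    have "d (p * X * p) = p \<otimes>\<^sub>t p"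
      using X_D p_D pA by (simp add: dD alg_gen_closed)
    moreover have "d Xp = ?\<beta> *\<^sub>C d (p * X * p)"
      unfolding assms(15) by (intro dD(4) alg_gen_closed X_D p_D)
    ultimately show ?thesis
      using \<alpha> by (simp add: scaleC_scaleC scaleC_one)
  qed
  have p_Q: "p \<in> ?Q"
    using one(1) by (intro alg_gen_base insertI2 image_eqI[of _ _ 1]) simp_all
  have Q_sub: "csubspace ?Q"
    by (intro csubspace_subalgebra subalgebra_alg_gen)
  have d_Q: "d y \<in> tensor_span ?Q ?Q" if "y \<in> ?Q" for y
  proof (rule free_difference_quotient_span[OF d _ _ that])
    show "insert Xp ?Bp \<subseteq> D" using Xp_D Bp_A AD by auto
    have "d Xp = ?\<beta> *\<^sub>C (\<alpha> *\<^sub>C d Xp)"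
      using \<alpha> by (simp add: scaleC_scaleC scaleC_one mult.commute)
    then have "d Xp \<in> tensor_span ?Q ?Q"
      by (simp add: d_Xp tensor_span_scaleC[OF tensor_spanI[OF p_Q p_Q] Q_sub])
    then show "d s \<in> tensor_span ?Q ?Q" if "s \<in> insert Xp ?Bp" for s
      using that Bp_A by (auto simp: dD tensor_span_0)
  qed
  have dp: "is_free_difference_quotient p ?Bp Xp (\<lambda>y. \<alpha> *\<^sub>C d y)"
    unfolding is_free_difference_quotient_def Let_def linear_map_on_def
  proof (intro conjI ballI allI)
    show "(\<lambda>y. \<alpha> *\<^sub>C d y) \<in> ?Q \<rightarrow> tensor_span ?Q ?Q"
      using d_Q Q_sub by (auto intro: tensor_span_scaleC)
    show "\<alpha> *\<^sub>C d c = 0" if "c \<in> ?Bp" for c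
      using that Bp_A by (simp add: dD)
    show "\<alpha> *\<^sub>C d Xp = p \<otimes>\<^sub>t p" by (rule d_Xp)
  qed (use Q_D in \<open>auto simp: dD subset_iff scaleC_add_right scaleC_scaleC mult.commute\<close>)
  have "csubspace M" "linear_map_on M E"
    by (auto simp: csubspace_subalgebra M linear_map_on_def E)
  then obtain E' where E': "linear_map_on UNIV E'" "\<And>m. m \<in> M \<Longrightarrow> E' m = E m"
    using linear_map_on_extend[of M E] by auto
  let ?F = "\<lambda>x. ?\<beta> *\<^sub>C E' x"
  have F'_lin: "linear_map_on UNIV ?F"
    using E'(1) by (simp add: linear_map_on_def scaleC_add_right scaleC_scaleC mult.commute)
  have F': "?F y = \<Psi> y" if "y \<in> ?Q" for y
    using that Q_D DM by (auto simp: \<Psi> E')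
  have \<Psi>_lin: "linear_map_on ?Q \<Psi>"
    using F'_lin unfolding linear_map_on_def by (auto simp: alg_gen_closed simp flip: F')
  have scaled: "tensor_hom ?F ?F u = (?\<beta> * ?\<beta>) *\<^sub>C tensor_hom E' E' u" for u
    by (induction u rule: tensor_induct)
      (simp_all add: tensor_hom_simps F'_lin E' tensor_prod_scaleC scaleC_scaleC scaleC_add_right)
  have "\<Psi> y \<in> C \<and> tensor_map ?Q ?Q \<Psi> \<Psi> (free_difference_quotient p ?Bp Xp y)
      = free_difference_quotient 1 B X (\<Psi> y)" if y: "y \<in> ?Q" for y
  proof
    have yD: "y \<in> D" using y Q_D by auto
    have Ey: "E y \<in> C" using yD by (rule E_D)
    show \<Psi>y: "\<Psi> y \<in> C"
      unfolding \<Psi>[OF y] by (intro alg_gen_closed Ey)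
    have "tensor_map ?Q ?Q \<Psi> \<Psi> (free_difference_quotient p ?Bp Xp y)
        = tensor_map ?Q ?Q \<Psi> \<Psi> (\<alpha> *\<^sub>C d y)"
      by (simp only: free_difference_quotient_eq[OF dp y])
    also have "\<dots> = tensor_hom ?F ?F (\<alpha> *\<^sub>C d y)"
      by (rule tensor_map_eq_hom[OF Q_sub \<Psi>_lin Q_sub \<Psi>_lin F'_lin F' F'_lin F'])
        (simp_all add: tensor_span_scaleC d_Q y Q_sub)
    also have "\<dots> = (?\<beta> * (\<alpha> * ?\<beta>)) *\<^sub>C tensor_hom E' E' (d y)"
      by (simp add: scaled tensor_hom_simps E' scaleC_scaleC mult_ac)
    also have "\<dots> = ?\<beta> *\<^sub>C d (E y)"
      using \<alpha> expectation_derivative[OF d E' yD] by simp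
    also have "\<dots> = d (\<Psi> y)"
      using Ey CD by (auto simp: \<Psi>[OF y] dD)
    also have "\<dots> = free_difference_quotient 1 B X (\<Psi> y)"
      by (simp only: free_difference_quotient_eq[OF derivative_C(2)[OF d] \<Psi>y])
    finally show "tensor_map ?Q ?Q \<Psi> \<Psi> (free_difference_quotient p ?Bp Xp y)
      = free_difference_quotient 1 B X (\<Psi> y)" .
  qed
  with corner_free show ?thesis by simp
qed

end
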